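(* Assume the electric field $E$ satisfies the bootstrap assumptions on $[0,T]$ (stated in the context). Let $X_{s,t}(x,v),V_{s,t}(x,v)$, $0\le s\le t\le T$, be the nonlinear characteristics, i.e. $\frac{d}{ds}X_{s,t}=\widehat V_{s,t}$, $\frac{d}{ds}V_{s,t}=E(s,X_{s,t})$, $X_{t,t}(x,v)=x$, $V_{t,t}(x,v)=v$. Then $$V_{s,t}(x,v)=v-V^{osc}_{t,t}(x,v)+V^{osc}_{s,t}(x,v)+V^{tr}_{s,t}(x,v),$$ where $$V^{osc}_{s,t}(x,v)=\sum_\pm E^{osc,1}_\pm(s,X_{s,t}(x,v),V_{s,t}(x,v)),\qquad V^{tr}_{s,t}(x,v)=-\int_s^tQ^{tr}(\tau,X_{\tau,t}(x,v),V_{\tau,t}(x,v))\,d\tau,$$ in which $$Q^{tr}(t,x,v)=-\sum_\pm[a_\pm(i\partial_x)\phi_{\pm,1}\star_xF]+\sum_\pm(\nabla_v\hat v\,E)\cdot\nabla_xE^{osc,2}_\pm+E^r.$$ In addition, $$\|V^{osc}_{s,t}\|_{L^\infty_{x,v}}\lesssim\epsilon\langle s\rangle^{-3/2},\qquad\|V^{tr}_{s,t}\|_{L^\infty_{x,v}}\lesssim\epsilon\langle s\rangle^{-2},\qquad\|V_{s,t}-v+V^{osc}_{t,t}\|_{L^\infty_{x,v}}\lesssim\epsilon\langle s\rangle^{-3/2}.$$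
   Context: Notation: $x,v,k\in\mathbb{R}^3$; $\langle y\rangle=\sqrt{1+|y|^2}$; $\hat v=v/\langle v\rangle$, $\widehat V_{s,t}=V_{s,t}/\langle V_{s,t}\rangle$. $A\lesssim B$ means $A\le CB$ with $C$ independent of $s,t,T,x,v,\epsilon$. $m(i\partial_x)$ denotes the Fourier multiplier with symbol $m(k)$; $\lambda_\pm(k)=\pm i\langle k\rangle$, $a_\pm(k)=\mp\frac i2\langle k\rangle^{-1}$; $G^{osc}_\pm(t,x)$ has spatial Fourier transform $e^{\lambda_\pm(k)t}a_\pm(k)$. $\star_x$ is convolution in $x$, and $(G\star_{t,x}F)(t,x)=\int_0^t\int G(t-s,x-y)F(s,y)\,dy\,ds$. Setting: $(f,E)$ is a solution on $[0,T]$ of $\partial_tf+\hat v\cdot\nabla_xf+E\cdot\nabla_vf=0$, $E=-\nabla_x\phi$, $(\partial_t^2-\Delta_x+1)\phi=-\int f\,dv$, with initial data $f_0,\phi_0,\phi_1$, $f_0$ compactly supported in $v$. Bootstrap assumptions: fix an integer $\alpha_0\ge8$ and a sufficiently small $\epsilon>0$; put $\delta_\alpha=\frac{|\alpha|}{\alpha_0-1}$, $\delta_1=\frac1{\alpha_0-1}$. The field has the form $E=\sum_\pm E^{osc}_\pm+E^r$, $E^{osc}_\pm=G^{osc}_\pm\star_xF_0+G^{osc}_\pm\star_{t,x}F$, where $F_0=\nabla_x\mathcal S_0$ (depending only on the initial data), $F=\nabla_x\mathcal S$, and $E^r$ is also a gradient; and for all $t\in[0,T]$: (i) $\|\mathcal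 S(t)\|_{L^p_x}+\|\partial_x\mathcal S(t)\|_{L^p_x}\le\epsilon\langle t\rangle^{-3(1-1/p)}$ and $\|E^r(t)\|_{L^p_x}\le\epsilon\langle t\rangle^{-3(1-1/p)}$ for $p\in[1,\infty]$; $\|E^{osc}_\pm(t)\|_{L^p_x}\le\epsilon\langle t\rangle^{-3(1/2-1/p)}$ for $p\in[2,\infty]$; (ii) for $1\le|\alpha|\le\alpha_0-1$: $\|\partial_x^\alpha\mathcal S(t)\|_{L^p_x}+\|\partial_x^\alpha E^r(t)\|_{L^p_x}\le\epsilon\langle t\rangle^{-3(1-1/p)+\delta_\alpha}$ for $p\in[1,\infty]$, and derivatives of $E^r$ of order $|\alpha|+1$ are bounded in $L^2_x$ by $\epsilon\langle t\rangle^{-3/2+\delta_\alpha}$; (iii) $\|E^{osc}_\pm(t)\|_{H^{\alpha_0}_x}\le\epsilon$ and $\|E^{osc}_\pm(t)\|_{H^{\alpha_0+1}_x}+\|E^r(t)\|_{H^{\alpha_0+1}_x}+\|\mathcal S(t)\|_{H^{\alpha_0}_x}\le\epsilon\langle t\rangle^{\delta_1}$. Collective fields: for $j\ge1$, $\phi_{\pm,j}(x,v)=\int_{\mathbb{R}^3}e^{ik\cdot x}(\lambda_\pm(k)+ik\cdot\hat v)^{-j}\,dk$ (as a distribution in $x$) and $E^{osc,j}_\pm(t,x,v)=[E^{osc}_\pm\star_x\phi_{\pm,j}](t,x,v)$; Fourier normalization constants are suppressed, so that convolution with $\phi_{\pm,j}(\cdot,v)$ is the Fourier multiplier with symbol $(\lambda_\pm(k)+ik\cdot\hat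 v)^{-j}$.
   Formalization: The three bounds are stated for |v| ≤ R, for every R, with a constant that may depend on R: with the supremum over all v they fail, because the symbol of φ_{±,1} reaches size ⟨v⟩. The decomposition is stated for all x, v. *)

theory Defs
  imports "HOL-Probability.Essential_Supremum"
begin

type_synonym R3 = "real^3"
type_synonym C3 = "complex^3"

section \<open>Brackets, velocities and symbols\<close>

definition jb :: "'a::real_normed_vector \<Rightarrow> real" where
  "jb y = sqrt (1 + (norm y)\<^sup>2)"

definition vhat :: "R3 \<Rightarrow> R3" where
  "vhat v = (1 / jb v) *\<^sub>R v"

definition cvec :: "R3 \<Rightarrow> C3" where
  "cvec u = (\<chi> i. complex_of_real (u $ i))"

text \<open>The sign \<open>\<plusminus>\<close> is a real number \<open>\<sigma>\<close> ranging over the set \<open>{1, -1}\<close>.\<close>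

definition lam :: "real \<Rightarrow> R3 \<Rightarrow> complex" where
  "lam \<sigma> k = of_real \<sigma> * \<i> * of_real (jb k)"

definition osc_a :: "real \<Rightarrow> R3 \<Rightarrow> complex" where
  "osc_a \<sigma> k = - of_real \<sigma> * (\<i> / 2) * of_real (1 / jb k)"

text \<open>The symbol of convolution in \<open>x\<close> with \<open>\<phi>\<^sub>\<plusminus>\<^sub>,\<^sub>j(\<cdot>, v)\<close>.\<close>

definition phi_symbol :: "real \<Rightarrow> nat \<Rightarrow> R3 \<Rightarrow> R3 \<Rightarrow> complex" where
  "phi_symbol \<sigma> j v k = 1 / (lam \<sigma> k + \<i> * of_real (k \<bullet> vhat v)) ^ j"


section \<open>Derivatives, test functions and norms\<close>

definition pd :: "3 \<Rightarrow> (R3 \<Rightarrow> 'b::real_normed_vector) \<Rightarrow> R3 \<Rightarrow> 'b" where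
  "pd i u x = frechet_derivative u (at x) (axis i 1)"

definition grad :: "(R3 \<Rightarrow> real) \<Rightarrow> R3 \<Rightarrow> R3" where
  "grad u x = (\<chi> i. pd i u x)"

type_synonym multiindex = "3 \<Rightarrow> nat"

definition msize :: "multiindex \<Rightarrow> nat" where
  "msize \<alpha> = (\<Sum>i\<in>UNIV. \<alpha> i)"

definition mpd :: "multiindex \<Rightarrow> (R3 \<Rightarrow> 'b::real_normed_vector) \<Rightarrow> R3 \<Rightarrow> 'b" where
  "mpd \<alpha> u = (pd 1 ^^ \<alpha> 1) ((pd 2 ^^ \<alpha> 2) ((pd 3 ^^ \<alpha> 3) u))"

definition smooth :: "(R3 \<Rightarrow> 'b::real_normed_vector) \<Rightarrow> bool" where
  "smooth u \<longleftrightarrow> (\<forall>\<alpha> x. mpd \<alpha> u differentiable (at x))"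

definition test_function :: "(R3 \<Rightarrow> real) \<Rightarrow> bool" where
  "test_function \<psi> \<longleftrightarrow> smooth \<psi> \<and> (\<exists>r. \<forall>x. norm x > r \<longrightarrow> \<psi> x = 0)"

definition schwartz :: "(R3 \<Rightarrow> complex) \<Rightarrow> bool" where
  "schwartz \<psi> \<longleftrightarrow> smooth \<psi> \<and> (\<forall>n \<alpha>. bounded (range (\<lambda>x. jb x ^ n *\<^sub>R mpd \<alpha> \<psi> x)))"

definition locally_integrable :: "(R3 \<Rightarrow> 'b::euclidean_space) \<Rightarrow> bool" where
  "locally_integrable u \<longleftrightarrow> (\<forall>K. compact K \<longrightarrow> set_integrable lborel K u)"

definition has_weak_deriv ::
  "multiindex \<Rightarrow> (R3 \<Rightarrow> 'b::euclidean_space) \<Rightarrow> (R3 \<Rightarrow> 'b) \<Rightarrow> bool" where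
  "has_weak_deriv \<alpha> u g \<longleftrightarrow>
     locally_integrable u \<and> locally_integrable g \<and>
     (\<forall>\<psi>. test_function \<psi> \<longrightarrow>
        (LINT x|lborel. \<psi> x *\<^sub>R g x)
          = (- 1) ^ msize \<alpha> *\<^sub>R (LINT x|lborel. mpd \<alpha> \<psi> x *\<^sub>R u x))"

definition epowr :: "ennreal \<Rightarrow> real \<Rightarrow> ennreal" where
  "epowr y a = (if y = \<infinity> then \<infinity> else ennreal (enn2real y powr a))"

definition Lp_norm :: "ennreal \<Rightarrow> (R3 \<Rightarrow> 'b::real_normed_vector) \<Rightarrow> ennreal" where
  "Lp_norm p u =
     (if u \<notin> borel_measurable lborel then \<infinity>
      else if p = \<infinity> then esssup lborel (\<lambda>x. ennreal (norm (u x)))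
      else epowr (\<integral>\<^sup>+ x. ennreal (norm (u x) powr enn2real p) \<partial>lborel) (1 / enn2real p))"

text \<open>The \<open>L\<^sup>p\<close> norm of the weak derivative \<open>\<partial>\<^sup>\<alpha>u\<close>. The infimum runs over a single class of
  almost everywhere equal functions; it is \<open>\<infinity>\<close> when there is no weak derivative.\<close>

definition Lp_deriv_norm ::
  "ennreal \<Rightarrow> multiindex \<Rightarrow> (R3 \<Rightarrow> 'b::euclidean_space) \<Rightarrow> ennreal" where
  "Lp_deriv_norm p \<alpha> u = (INF g\<in>{g. has_weak_deriv \<alpha> u g}. Lp_norm p g)"

lemma finite_msize_le: "finite {\<alpha>. msize \<alpha> \<le> n}"
proof (rule finite_subset)
  show "{\<alpha>. msize \<alpha> \<le> n} \<subseteq> PiE UNIV (\<lambda>_. {..n})"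
    unfolding msize_def using member_le_sum[of _ "UNIV :: 3 set"]
    by (auto simp: PiE_iff intro: order_trans)
qed (simp add: finite_PiE)

definition sobolev_norm :: "nat \<Rightarrow> (R3 \<Rightarrow> 'b::euclidean_space) \<Rightarrow> ennreal" where
  "sobolev_norm n u = epowr (\<Sum>\<alpha>\<in>{\<alpha>. msize \<alpha> \<le> n}. (Lp_deriv_norm 2 \<alpha> u)\<^sup>2) (1/2)"


section \<open>Fourier multipliers\<close>

definition fourier_integral :: "(R3 \<Rightarrow> complex) \<Rightarrow> R3 \<Rightarrow> complex" where
  "fourier_integral \<psi> x = (LINT k|lborel. exp (- \<i> * of_real (k \<bullet> x)) * \<psi> k)"

text \<open>\<open>g\<close> is the Fourier transform of \<open>u\<close> in the sense of tempered distributions. This covers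
  fields that are in \<open>L\<^sup>2\<close> but not in \<open>L\<^sup>1\<close>; it determines \<open>g\<close> almost everywhere.\<close>

definition has_fourier_transform :: "(R3 \<Rightarrow> C3) \<Rightarrow> (R3 \<Rightarrow> C3) \<Rightarrow> bool" where
  "has_fourier_transform u g \<longleftrightarrow>
     (\<forall>\<psi>. schwartz \<psi> \<longrightarrow>
        integrable lborel (\<lambda>x. fourier_integral \<psi> x *s u x) \<and>
        integrable lborel (\<lambda>k. \<psi> k *s g k) \<and>
        (LINT x|lborel. fourier_integral \<psi> x *s u x) = (LINT k|lborel. \<psi> k *s g k))"

definition fourier :: "(R3 \<Rightarrow> C3) \<Rightarrow> R3 \<Rightarrow> C3" where
  "fourier u = (SOME g. has_fourier_transform u g)"

text \<open>The continuous representative of the multiplier, given by the absolutely convergent inverse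
  Fourier integral. The condition \<open>multiplier_converges\<close> expresses that it is meaningful.\<close>

definition multiplier :: "(R3 \<Rightarrow> complex) \<Rightarrow> (R3 \<Rightarrow> C3) \<Rightarrow> R3 \<Rightarrow> C3" where
  "multiplier m u x =
     (1 / (2 * pi) ^ 3) *\<^sub>R
       (LINT k|lborel. (exp (\<i> * of_real (k \<bullet> x)) * m k) *s fourier u k)"

definition multiplier_converges :: "(R3 \<Rightarrow> complex) \<Rightarrow> (R3 \<Rightarrow> C3) \<Rightarrow> bool" where
  "multiplier_converges m u \<longleftrightarrow>
     (\<exists>g. has_fourier_transform u g \<and> integrable lborel (\<lambda>k. m k *s g k))"


section \<open>The Vlasov--Klein--Gordon system and its characteristics\<close>

definition compactly_supported_in_v :: "(R3 \<Rightarrow> R3 \<Rightarrow> real) \<Rightarrow> bool" where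
  "compactly_supported_in_v f0 \<longleftrightarrow> (\<exists>r. \<forall>x v. norm v > r \<longrightarrow> f0 x v = 0)"

definition VKG_solution ::
  "real \<Rightarrow> (R3 \<Rightarrow> R3 \<Rightarrow> real) \<Rightarrow> (R3 \<Rightarrow> real) \<Rightarrow> (R3 \<Rightarrow> real) \<Rightarrow>
   (real \<Rightarrow> R3 \<Rightarrow> R3 \<Rightarrow> real) \<Rightarrow> (real \<Rightarrow> R3 \<Rightarrow> real) \<Rightarrow> (real \<Rightarrow> R3 \<Rightarrow> R3) \<Rightarrow> bool" where
  "VKG_solution T f0 \<phi>0 \<phi>1 f \<phi> E \<longleftrightarrow>
     (\<forall>t\<in>{0..T}. \<forall>x v. \<exists>D.
        ((\<lambda>(t, x, v). f t x v) has_derivative D) (at (t, x, v) within {0..T} \<times> UNIV) \<and>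
        D (1, 0, 0) + D (0, vhat v, 0) + D (0, 0, E t x) = 0) \<and>
     (\<forall>t\<in>{0..T}. \<forall>x. \<phi> t differentiable (at x) \<and> E t x = - grad (\<phi> t) x \<and>
        grad (\<phi> t) differentiable (at x) \<and> integrable lborel (f t x)) \<and>
     (\<exists>\<phi>t \<phi>tt.
        (\<forall>t\<in>{0..T}. \<forall>x.
           ((\<lambda>t. \<phi> t x) has_real_derivative \<phi>t t x) (at t within {0..T}) \<and>
           ((\<lambda>t. \<phi>t t x) has_real_derivative \<phi>tt t x) (at t within {0..T}) \<and>
           \<phi>tt t x - (\<Sum>i\<in>UNIV. pd i (pd i (\<phi> t)) x) + \<phi> t x = - (LINT v|lborel. f t x v)) \<and>
        \<phi>t 0 = \<phi>1) \<and>
     f 0 = f0 \<and> \<phi> 0 = \<phi>0"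

definition characteristics ::
  "real \<Rightarrow> (real \<Rightarrow> R3 \<Rightarrow> R3) \<Rightarrow>
   (real \<Rightarrow> real \<Rightarrow> R3 \<Rightarrow> R3 \<Rightarrow> R3) \<Rightarrow> (real \<Rightarrow> real \<Rightarrow> R3 \<Rightarrow> R3 \<Rightarrow> R3) \<Rightarrow> bool" where
  "characteristics T E X V \<longleftrightarrow>
     (\<forall>t\<in>{0..T}. \<forall>x v.
        X t t x v = x \<and> V t t x v = v \<and>
        (\<forall>s\<in>{0..t}.
           ((\<lambda>s. X s t x v) has_vector_derivative vhat (V s t x v)) (at s within {0..t}) \<and>
           ((\<lambda>s. V s t x v) has_vector_derivative E s (X s t x v)) (at s within {0..t})))"


section \<open>Oscillatory fields and the bootstrap assumptions\<close>

text \<open>\<open>E\<^sup>o\<^sup>s\<^sup>c\<^sub>\<plusminus> = G\<^sup>o\<^sup>s\<^sup>c\<^sub>\<plusminus> \<star>\<^sub>x F\<^sub>0 + G\<^sup>o\<^sup>s\<^sup>c\<^sub>\<plusminus> \<star>\<^sub>t\<^sub>,\<^sub>x F\<close> with \<open>F\<^sub>0 = \<nabla>S\<^sub>0\<close>, \<open>F = \<nabla>S\<close>. The two signs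
  give complex valued fields; only their sum is real.\<close>

definition Eosc :: "(R3 \<Rightarrow> real) \<Rightarrow> (real \<Rightarrow> R3 \<Rightarrow> real) \<Rightarrow> real \<Rightarrow> real \<Rightarrow> R3 \<Rightarrow> C3" where
  "Eosc S0 S \<sigma> t x =
     multiplier (\<lambda>k. exp (lam \<sigma> k * of_real t) * osc_a \<sigma> k) (\<lambda>y. cvec (grad S0 y)) x +
     (LINT s:{0..t}|lborel.
        multiplier (\<lambda>k. exp (lam \<sigma> k * of_real (t - s)) * osc_a \<sigma> k) (\<lambda>y. cvec (grad (S s) y)) x)"

definition Eoscj ::
  "(R3 \<Rightarrow> real) \<Rightarrow> (real \<Rightarrow> R3 \<Rightarrow> real) \<Rightarrow> real \<Rightarrow> nat \<Rightarrow> real \<Rightarrow> R3 \<Rightarrow> R3 \<Rightarrow> C3" where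
  "Eoscj S0 S \<sigma> j t x v = multiplier (phi_symbol \<sigma> j v) (Eosc S0 S \<sigma> t) x"

text \<open>The exponent \<open>p \<in> [1, \<infinity>]\<close> is an \<^typ>\<open>ennreal\<close>, so that \<open>1 / \<infinity> = 0\<close>. The measurability of \<open>S\<close>
  and the convergence of the multiplier integral for \<open>F\<^sub>0 = \<nabla>S\<^sub>0\<close> make the two convolutions
  defining \<^const>\<open>Eosc\<close> meaningful.\<close>

definition bootstrap ::
  "real \<Rightarrow> nat \<Rightarrow> real \<Rightarrow> (R3 \<Rightarrow> real) \<Rightarrow> (real \<Rightarrow> R3 \<Rightarrow> real) \<Rightarrow>
   (real \<Rightarrow> R3 \<Rightarrow> R3) \<Rightarrow> (real \<Rightarrow> R3 \<Rightarrow> R3) \<Rightarrow> bool" where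
  "bootstrap T \<alpha>0 \<epsilon> S0 S Er E \<longleftrightarrow>
     (\<forall>x. S0 differentiable (at x)) \<and>
     (\<forall>\<sigma>\<in>{1, -1}. multiplier_converges (osc_a \<sigma>) (\<lambda>y. cvec (grad S0 y))) \<and>
     set_borel_measurable borel ({0..T} \<times> UNIV) (\<lambda>(t, x). S t x) \<and>
     (\<forall>t\<in>{0..T}.
        (\<forall>x. S t differentiable (at x)) \<and>
        (\<exists>u. \<forall>x. u differentiable (at x) \<and> Er t x = grad u x) \<and>
        (\<forall>x. cvec (E t x) = (\<Sum>\<sigma>\<in>{1, -1}. Eosc S0 S \<sigma> t x) + cvec (Er t x)) \<and>
        \<comment> \<open>(i)\<close>
        (\<forall>p\<ge>1. Lp_norm p (S t) + Lp_norm p (grad (S t))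
            \<le> ennreal (\<epsilon> * jb t powr (- 3 * (1 - enn2real (1 / p))))) \<and>
        (\<forall>p\<ge>1. Lp_norm p (Er t)
            \<le> ennreal (\<epsilon> * jb t powr (- 3 * (1 - enn2real (1 / p))))) \<and>
        (\<forall>\<sigma>\<in>{1, -1}. \<forall>p\<ge>2. Lp_norm p (Eosc S0 S \<sigma> t)
            \<le> ennreal (\<epsilon> * jb t powr (- 3 * (1/2 - enn2real (1 / p))))) \<and>
        \<comment> \<open>(ii), with \<open>\<delta>\<^sub>\<alpha> = |\<alpha>| / (\<alpha>\<^sub>0 - 1)\<close>\<close>
        (\<forall>\<alpha>. 1 \<le> msize \<alpha> \<and> msize \<alpha> \<le> \<alpha>0 - 1 \<longrightarrow>
           (\<forall>p\<ge>1. Lp_deriv_norm p \<alpha> (S t) + Lp_deriv_norm p \<alpha> (Er t)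
              \<le> ennreal (\<epsilon> * jb t powr
                    (- 3 * (1 - enn2real (1 / p)) + real (msize \<alpha>) / (real \<alpha>0 - 1)))) \<and>
           (\<forall>\<beta>. msize \<beta> = msize \<alpha> + 1 \<longrightarrow>
              Lp_deriv_norm 2 \<beta> (Er t)
                \<le> ennreal (\<epsilon> * jb t powr (- 3/2 + real (msize \<alpha>) / (real \<alpha>0 - 1))))) \<and>
        \<comment> \<open>(iii), with \<open>\<delta>\<^sub>1 = 1 / (\<alpha>\<^sub>0 - 1)\<close>\<close>
        (\<forall>\<sigma>\<in>{1, -1}.
           sobolev_norm \<alpha>0 (Eosc S0 S \<sigma> t) \<le> ennreal \<epsilon> \<and>
           sobolev_norm (\<alpha>0 + 1) (Eosc S0 S \<sigma> t) + sobolev_norm (\<alpha>0 + 1) (Er t)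
               + sobolev_norm \<alpha>0 (S t)
             \<le> ennreal (\<epsilon> * jb t powr (1 / (real \<alpha>0 - 1)))))"


section \<open>The decomposition of the velocity\<close>

text \<open>Pitfall: for bounded \<open>v\<close> the symbols \<^const>\<open>phi_symbol\<close> are bounded below in the denominator,
  but \<open>min\<^sub>k (\<langle>k\<rangle> - |k \<bullet> vhat v|) = 1 / \<langle>v\<rangle>\<close>, so that bounds on the fields below which are uniform
  in time hold on bounded sets of velocities (\<open>f\<close> being compactly supported in \<open>v\<close>), with a constant
  depending on that set. The algebraic decomposition holds for all \<open>v\<close>. The fields are complex
  valued as sums of two complex conjugate terms, and real velocities are embedded by
  \<^const>\<open>cvec\<close>.\<close>

definition Vosc ::
  "(R3 \<Rightarrow> real) \<Rightarrow> (real \<Rightarrow> R3 \<Rightarrow> real) \<Rightarrow>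
   (real \<Rightarrow> real \<Rightarrow> R3 \<Rightarrow> R3 \<Rightarrow> R3) \<Rightarrow> (real \<Rightarrow> real \<Rightarrow> R3 \<Rightarrow> R3 \<Rightarrow> R3) \<Rightarrow>
   real \<Rightarrow> real \<Rightarrow> R3 \<Rightarrow> R3 \<Rightarrow> C3" where
  "Vosc S0 S X V s t x v = (\<Sum>\<sigma>\<in>{1, -1}. Eoscj S0 S \<sigma> 1 s (X s t x v) (V s t x v))"

definition Qtr ::
  "(R3 \<Rightarrow> real) \<Rightarrow> (real \<Rightarrow> R3 \<Rightarrow> real) \<Rightarrow> (real \<Rightarrow> R3 \<Rightarrow> R3) \<Rightarrow> (real \<Rightarrow> R3 \<Rightarrow> R3) \<Rightarrow>
   real \<Rightarrow> R3 \<Rightarrow> R3 \<Rightarrow> C3" where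
  "Qtr S0 S Er E t x v =
     - (\<Sum>\<sigma>\<in>{1, -1}.
          multiplier (\<lambda>k. osc_a \<sigma> k * phi_symbol \<sigma> 1 v k) (\<lambda>y. cvec (grad (S t) y)) x)
     + (\<Sum>\<sigma>\<in>{1, -1}.
          frechet_derivative (\<lambda>y. Eoscj S0 S \<sigma> 2 t y v) (at x)
            (frechet_derivative vhat (at v) (E t x)))
     + cvec (Er t x)"

definition Vtr ::
  "(R3 \<Rightarrow> real) \<Rightarrow> (real \<Rightarrow> R3 \<Rightarrow> real) \<Rightarrow> (real \<Rightarrow> R3 \<Rightarrow> R3) \<Rightarrow> (real \<Rightarrow> R3 \<Rightarrow> R3) \<Rightarrow>
   (real \<Rightarrow> real \<Rightarrow> R3 \<Rightarrow> R3 \<Rightarrow> R3) \<Rightarrow> (real \<Rightarrow> real \<Rightarrow> R3 \<Rightarrow> R3 \<Rightarrow> R3) \<Rightarrow>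
   real \<Rightarrow> real \<Rightarrow> R3 \<Rightarrow> R3 \<Rightarrow> C3" where
  "Vtr S0 S Er E X V s t x v =
     - (LINT \<tau>:{s..t}|lborel. Qtr S0 S Er E \<tau> (X \<tau> t x v) (V \<tau> t x v))"

end

theory Submission
  imports Defs "HOL-Probability.Characteristic_Functions" "HOL-Probability.Sinc_Integral"
    "HOL-Computational_Algebra.Polynomial" "HOL-Real_Asymp.Real_Asymp"
begin

text \<open>
  Why the theorem holds. The phase of a frequency \<open>k\<close> of \<open>E\<^sup>o\<^sup>s\<^sup>c\<^sub>\<plusminus>\<close>, seen by a particle of velocity
  \<open>v\<close>, turns at the rate \<open>\<lambda>\<^sub>\<plusminus>(k) + i k \<bullet> vhat v\<close>, and this number is not zero since \<open>|vhat v| < 1\<close>.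
  Dividing by it therefore integrates the oscillation, and the quotient is \<open>E\<^sup>o\<^sup>s\<^sup>c\<^sup>,\<^sup>1\<^sub>\<plusminus>\<close>.
  Differentiate \<open>E\<^sup>o\<^sup>s\<^sup>c\<^sup>,\<^sup>1\<^sub>\<plusminus>(\<tau>, X, V)\<close> along a characteristic: the phase and the motion of \<open>X\<close>
  together restore \<open>E\<^sup>o\<^sup>s\<^sup>c\<^sub>\<plusminus>\<close>; the motion of \<open>V\<close>, through the symbol
  \<open>(\<lambda>\<^sub>\<plusminus> + i k \<bullet> vhat v)\<^sup>-\<^sup>1\<close>, produces the gradient of \<open>E\<^sup>o\<^sup>s\<^sup>c\<^sup>,\<^sup>2\<^sub>\<plusminus>\<close> in the direction of the
  derivative of \<open>vhat V\<close>; the source \<open>F\<close> in the equation for \<open>E\<^sup>o\<^sup>s\<^sup>c\<^sub>\<plusminus>\<close> produces the remaining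
  term. In short \<open>d/d\<tau> V\<^sup>o\<^sup>s\<^sup>c = E - Q\<^sup>t\<^sup>r\<close> (\<open>Qtr_eq\<close>), and integration from \<open>s\<close> to \<open>t\<close> together with
  \<open>dV/d\<tau> = E\<close> is the decomposition (\<open>velocity_decomposition\<close>). The source is merely integrable in
  time, so that the fields need not be differentiable in \<open>\<tau>\<close>; the identity is therefore
  established in integrated form, for each frequency separately by an integration by parts, and
  then for the fields by Fubini's theorem (\<open>characteristic_identity\<close>).

  The estimates rest on two facts about the symbols. After extraction of a constant of modulus 1,
  the symbol \<open>(\<lambda>\<^sub>\<plusminus> + i k \<bullet> vhat v)\<^sup>-\<^sup>1\<close> is \<open>1 / (\<langle>k\<rangle> + k \<bullet> b)\<close> with \<open>b = \<plusminus> vhat v\<close>, and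
  \<open>1 / (A + B) = \<integral>\<^sub>0\<^sup>\<infinity> x (A\<^sup>2 + 2xB + x\<^sup>2)\<^sup>-\<^sup>3\<^sup>/\<^sup>2 dx\<close>. For \<open>A = \<langle>k\<rangle>\<close>, \<open>B = k \<bullet> b\<close> the bracket is
  \<open>1 + (1 - |b|\<^sup>2) x\<^sup>2 + |k + x b|\<^sup>2\<close>, and its power \<open>-3/2\<close> is a superposition of Gaussians in \<open>k\<close>.
  A Gaussian is the Fourier transform of a probability density, and multiplication by it
  increases no supremum norm. Adding up the norms shows that the symbol acts on bounded functions
  with norm at most \<open>1 / (1 - |b|\<^sup>2) = \<langle>v\<rangle>\<^sup>2\<close> (\<open>Linf_multiplier_resolvent\<close>). The derivative of the
  integral representation with respect to \<open>B\<close> gives in the same way a bound for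
  \<open>(k \<bullet> w) / (\<langle>k\<rangle> + k \<bullet> b)\<^sup>2\<close> (\<open>Linf_multiplier_resolvent_deriv\<close>). Hence \<open>E\<^sup>o\<^sup>s\<^sup>c\<^sup>,\<^sup>1\<^sub>\<plusminus>\<close> decays like
  \<open>E\<^sup>o\<^sup>s\<^sup>c\<^sub>\<plusminus>\<close>, that is like \<open>\<epsilon>\<langle>t\<rangle>\<^sup>-\<^sup>3\<^sup>/\<^sup>2\<close>, while all three parts of \<open>Q\<^sup>t\<^sup>r\<close> are of size \<open>\<epsilon>\<langle>t\<rangle>\<^sup>-\<^sup>3\<close>: the
  source and \<open>E\<^sup>r\<close> by assumption, the middle one as a product of two fields of size \<open>\<epsilon>\<langle>t\<rangle>\<^sup>-\<^sup>3\<^sup>/\<^sup>2\<close>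
  (\<open>norm_Qtr_le\<close>). Finally \<open>\<integral>\<^sub>s\<^sup>\<infinity> \<langle>\<tau>\<rangle>\<^sup>-\<^sup>3 d\<tau> \<le> \<langle>s\<rangle>\<^sup>-\<^sup>2\<close>. Since \<open>E\<close> is integrable in time, a velocity
  changes by at most 12, so that the powers of \<open>\<langle>V\<rangle>\<close> are bounded when \<open>|v| \<le> R\<close>.

  The rest of the work gives these formal computations a meaning. Six derivatives of \<open>\<S>\<close> in \<open>L\<^sup>1\<close>
  bound the transform of \<open>F\<close> by a multiple of \<open>\<langle>k\<rangle>\<^sup>-\<^sup>5\<close> (\<open>norm_ft_gradient_le\<close>), and the factor \<open>a\<^sub>\<plusminus>(k)\<close>
  supplies one more power, which makes the product integrable in three dimensions; for the data \<open>F\<^sub>0\<close>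
  the integrability is assumed. Hence all Fourier integrals in question converge absolutely.
  A Fourier transform in the sense of tempered distributions is unique almost everywhere
  (\<open>has_fourier_transform_unique\<close>), which allows every multiplier to be computed from an explicit
  transform (\<open>multiplier_eq\<close>). The \<open>L\<^sup>\<infinity>\<close> bounds of the assumptions hold almost
  everywhere only; they become pointwise bounds because the fields are continuous.
\<close>

section \<open>Fourier multipliers on bounded functions\<close>

lemma norm_complex_vscale: "norm (c *s u) = norm c * norm (u :: C3)" for c :: complex
  by (simp add: norm_vec_def norm_mult L2_set_right_distrib)

lemma bounded_bilinear_vscale: "bounded_bilinear (\<lambda>(c::complex) (u::C3). c *s u)"
  by (rule bounded_bilinear.intro)
    (auto simp: vec_eq_iff algebra_simps norm_complex_vscale intro!: exI[of _ 1])

lemma borel_measurable_vscale [measurable (raw)]: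
  fixes f :: "'a \<Rightarrow> complex" and g :: "'a \<Rightarrow> C3"
  assumes "f \<in> borel_measurable M" "g \<in> borel_measurable M"
  shows "(\<lambda>x. f x *s g x) \<in> borel_measurable M"
proof -
  have "continuous_on UNIV (\<lambda>p :: complex \<times> C3. fst p *s snd p)"
    by (intro bounded_bilinear.continuous_on[OF bounded_bilinear_vscale] continuous_intros)
  then have "(\<lambda>p :: complex \<times> C3. fst p *s snd p) \<in> borel_measurable borel"
    by (rule borel_measurable_continuous_onI)
  from measurable_compose[OF borel_measurable_Pair[OF assms] this] show ?thesis by simp
qed

lemmas integral_vscale_left = integral_bounded_linear[OF bounded_bilinear.bounded_linear_left[OF bounded_bilinear_vscale]]
lemmas integral_vscale_right = integral_bounded_linear[OF bounded_bilinear.bounded_linear_right[OF bounded_bilinear_vscale]]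

definition wave :: "R3 \<Rightarrow> R3 \<Rightarrow> complex" where
  "wave x k = exp (\<i> * of_real (k \<bullet> x))"

lemma norm_wave [simp]: "norm (wave x k) = 1"
  by (simp add: wave_def)

lemma wave_add: "wave (x + y) k = wave x k * wave y k"
  by (simp add: wave_def inner_add_right exp_add[symmetric] algebra_simps)

lemma borel_measurable_wave [measurable (raw)]:
  assumes [measurable]: "f \<in> borel_measurable M" "g \<in> borel_measurable M"
  shows "(\<lambda>x. wave (f x) (g x)) \<in> borel_measurable M"
  unfolding wave_def by measurable

lemma integrable_vscale_bounded:
  fixes g :: "'a \<Rightarrow> C3"
  assumes "integrable M g" "m \<in> borel_measurable M" "\<And>k. norm (m k) \<le> B"
  shows "integrable M (\<lambda>k. m k *s g k)"
proof (rule Bochner_Integration.integrable_bound)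
  show "integrable M (\<lambda>k. B * norm (g k))" using assms by simp
  show "AE k in M. norm (m k *s g k) \<le> norm (B * norm (g k))"
  proof (rule AE_I2)
    fix k
    have "norm (m k) * norm (g k) \<le> B * norm (g k)"
      by (intro mult_right_mono assms) auto
    also have "\<dots> \<le> norm (B * norm (g k))" by simp
    finally show "norm (m k *s g k) \<le> norm (B * norm (g k))" by (simp add: norm_complex_vscale)
  qed
  have [measurable]: "m \<in> borel_measurable M" "g \<in> borel_measurable M" using assms by auto
  show "(\<lambda>k. m k *s g k) \<in> borel_measurable M" by measurable
qed

text \<open>The norm of \<open>m\<close> as a multiplier on bounded functions, tested on functions \<open>\<integral> e\<^sup>i\<^sup>k\<^sup>\<bullet>\<^sup>x g(k) dk\<close> with
integrable \<open>g\<close>; on these, multipliers are plain integrals. The pointwise bound of the symbol keeps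
\<open>m g\<close> integrable, so that the class is closed under products.\<close>

definition Linf_multiplier :: "real \<Rightarrow> (R3 \<Rightarrow> complex) \<Rightarrow> bool" where
  "Linf_multiplier B m \<longleftrightarrow>
     m \<in> borel_measurable borel \<and> (\<forall>k. norm (m k) \<le> B) \<and>
     (\<forall>(g :: R3 \<Rightarrow> C3) M. integrable lborel g \<longrightarrow>
        (\<forall>x. norm (LINT k|lborel. wave x k *s g k) \<le> M) \<longrightarrow>
        (\<forall>x. norm (LINT k|lborel. (wave x k * m k) *s g k) \<le> B * M))"

lemma Linf_multiplierD:
  assumes "Linf_multiplier B m"
  shows "m \<in> borel_measurable borel" "norm (m k) \<le> B"
    "integrable lborel g \<Longrightarrow> (\<And>x. norm (LINT k|lborel. wave x k *s g k) \<le> M) \<Longrightarrow>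
      norm (LINT k|lborel. (wave x k * m k) *s (g k :: C3)) \<le> B * M"
  using assms unfolding Linf_multiplier_def by blast+

lemma Linf_multiplier_nonneg: "Linf_multiplier B m \<Longrightarrow> 0 \<le> B"
  using Linf_multiplierD(2)[of B m 0] norm_ge_zero order_trans by blast

lemma Linf_multiplier_mono:
  assumes "Linf_multiplier B m" "B \<le> B'"
  shows "Linf_multiplier B' m"
  unfolding Linf_multiplier_def
proof (intro conjI allI impI)
  fix g :: "R3 \<Rightarrow> C3" and M x
  assume g: "integrable lborel g" and M: "\<forall>x. norm (LINT k|lborel. wave x k *s g k) \<le> M"
  have "norm (LINT k|lborel. (wave x k * m k) *s g k) \<le> B * M"
    using Linf_multiplierD(3)[OF assms(1) g] M by blast
  also have "\<dots> \<le> B' * M"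
    using M[rule_format, of 0] norm_ge_zero order_trans assms(2) by (intro mult_right_mono) blast+
  finally show "norm (LINT k|lborel. (wave x k * m k) *s g k) \<le> B' * M" .
qed (use assms Linf_multiplierD[OF assms(1)] order_trans in blast)+

text \<open>Multiplication by a plane wave is a translation in space.\<close>

lemma Linf_multiplier_wave: "Linf_multiplier 1 (wave y)"
  unfolding Linf_multiplier_def by (auto simp: wave_add[symmetric])

lemma Linf_multiplier_mult:
  assumes 1: "Linf_multiplier B m" and 2: "Linf_multiplier C n"
  shows "Linf_multiplier (B * C) (\<lambda>k. m k * n k)"
  unfolding Linf_multiplier_def
proof (intro conjI allI impI)
  note [measurable] = Linf_multiplierD(1)[OF 1] Linf_multiplierD(1)[OF 2]
  show "(\<lambda>k. m k * n k) \<in> borel_measurable borel" by measurable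
  show "norm (m k * n k) \<le> B * C" for k
    using Linf_multiplierD(2)[OF 1, of k] Linf_multiplierD(2)[OF 2, of k] Linf_multiplier_nonneg[OF 1]
    by (simp add: norm_mult mult_mono)
  fix g :: "R3 \<Rightarrow> C3" and M x
  assume g: "integrable lborel g" and M: "\<forall>x. norm (LINT k|lborel. wave x k *s g k) \<le> M"
  have ng: "integrable lborel (\<lambda>k. n k *s g k)"
    by (rule integrable_vscale_bounded[OF g _ Linf_multiplierD(2)[OF 2]]) simp
  have "norm (LINT k|lborel. (wave y k * n k) *s g k) \<le> C * M" for y
    using Linf_multiplierD(3)[OF 2 g] M by blast
  then have "norm (LINT k|lborel. (wave x k * m k) *s (n k *s g k)) \<le> B * (C * M)"
    using Linf_multiplierD(3)[OF 1 ng] by simp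
  then show "norm (LINT k|lborel. (wave x k * (m k * n k)) *s g k) \<le> B * C * M"
    by (simp add: mult.assoc)
qed

lemma Linf_multiplier_add:
  assumes 1: "Linf_multiplier B m" and 2: "Linf_multiplier C n"
  shows "Linf_multiplier (B + C) (\<lambda>k. m k + n k)"
  unfolding Linf_multiplier_def
proof (intro conjI allI impI)
  note [measurable] = Linf_multiplierD(1)[OF 1] Linf_multiplierD(1)[OF 2]
  show "(\<lambda>k. m k + n k) \<in> borel_measurable borel" by measurable
  show "norm (m k + n k) \<le> B + C" for k
    using Linf_multiplierD(2)[OF 1, of k] Linf_multiplierD(2)[OF 2, of k]
    by (intro norm_triangle_le) simp
  fix g :: "R3 \<Rightarrow> C3" and M x
  assume g: "integrable lborel g" and M: "\<forall>x. norm (LINT k|lborel. wave x k *s g k) \<le> M"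
  have "(LINT k|lborel. (wave x k * (m k + n k)) *s g k)
    = (LINT k|lborel. (wave x k * m k) *s g k + (wave x k * n k) *s g k)"
    by (simp add: distrib_left vector_sadd_rdistrib)
  also have "\<dots> = (LINT k|lborel. (wave x k * m k) *s g k) + (LINT k|lborel. (wave x k * n k) *s g k)"
    using Linf_multiplierD(2)[OF 1] Linf_multiplierD(2)[OF 2]
    by (intro Bochner_Integration.integral_add; intro integrable_vscale_bounded[OF g])
      (auto simp: norm_mult)
  also have "norm \<dots> \<le> B * M + C * M"
    using Linf_multiplierD(3)[OF 1 g] Linf_multiplierD(3)[OF 2 g] M by (intro norm_triangle_le add_mono) blast+
  finally show "norm (LINT k|lborel. (wave x k * (m k + n k)) *s g k) \<le> (B + C) * M"
    by (simp add: distrib_right)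
qed

lemma Linf_multiplier_const: "Linf_multiplier (norm c) (\<lambda>k. c)"
  unfolding Linf_multiplier_def
proof (intro conjI allI impI)
  fix g :: "R3 \<Rightarrow> C3" and M x
  assume g: "integrable lborel g" and M: "\<forall>x. norm (LINT k|lborel. wave x k *s g k) \<le> M"
  have "(LINT k|lborel. (wave x k * c) *s g k) = (LINT k|lborel. c *s (wave x k *s g k))"
    by (simp add: ac_simps)
  also have "\<dots> = c *s (LINT k|lborel. wave x k *s g k)"
    by (intro integral_vscale_right integrable_vscale_bounded[OF g, where B=1]) auto
  finally show "norm (LINT k|lborel. (wave x k * c) *s g k) \<le> norm c * M"
    using M by (simp add: norm_complex_vscale mult_left_mono)
qed auto

text \<open>Fubini's theorem puts the integral over \<open>w\<close> outside, where the triangle inequality applies. All bounds on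
concrete symbols come from this lemma, starting from plane waves.\<close>

lemma Linf_multiplier_integral:
  fixes m :: "real \<Rightarrow> R3 \<Rightarrow> complex"
  assumes [measurable]: "(\<lambda>(w,k). m w k) \<in> borel_measurable (borel \<Otimes>\<^sub>M borel)"
    and b: "integrable lborel b" and m: "\<And>w. Linf_multiplier (b w) (m w)"
  shows "Linf_multiplier (LINT w|lborel. b w) (\<lambda>k. LINT w|lborel. m w k)"
  unfolding Linf_multiplier_def
proof (intro conjI allI impI)
  note mb = Linf_multiplierD(2)[OF m] and b0 = Linf_multiplier_nonneg[OF m]
  have mi: "integrable lborel (\<lambda>w. m w k)" for k
    by (rule Bochner_Integration.integrable_bound[OF b]) (use mb b0 in \<open>auto\<close>)
  show "(\<lambda>k. LINT w|lborel. m w k) \<in> borel_measurable borel" by measurable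
  show "norm (LINT w|lborel. m w k) \<le> (LINT w|lborel. b w)" for k
    by (rule order_trans[OF integral_norm_bound integral_mono]) (use mi b mb in auto)
  fix g :: "R3 \<Rightarrow> C3" and M x
  assume g: "integrable lborel g" and M: "\<forall>x. norm (LINT k|lborel. wave x k *s g k) \<le> M"
  have [measurable]: "g \<in> borel_measurable borel" using g by auto
  let ?f = "\<lambda>w k. (wave x k * m w k) *s g k"
  have fi: "integrable lborel (?f w)" for w
    by (rule integrable_vscale_bounded[OF g, where B="b w"]) (use mb in \<open>auto simp: norm_mult\<close>)
  have int: "integrable (lborel \<Otimes>\<^sub>M lborel) (case_prod ?f)"
  proof (rule lborel_pair.Fubini_integrable)
    show "integrable lborel (\<lambda>w. LINT k|lborel. norm (case (w, k) of (w,k) \<Rightarrow> ?f w k))"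
    proof (rule Bochner_Integration.integrable_bound)
      show "integrable lborel (\<lambda>w. b w * (LINT k|lborel. norm (g k)))" using b by simp
      have "(LINT k|lborel. norm (?f w k)) \<le> b w * (LINT k|lborel. norm (g k))" for w
      proof -
        have "(LINT k|lborel. norm (?f w k)) \<le> (LINT k|lborel. b w * norm (g k))"
        proof (rule integral_mono)
          show "integrable lborel (\<lambda>k. norm (?f w k))" by (rule integrable_norm[OF fi])
          show "integrable lborel (\<lambda>k. b w * norm (g k))" using g by simp
          show "norm (?f w k) \<le> b w * norm (g k)" for k
            using mb[of w k] by (simp add: norm_complex_vscale norm_mult mult_right_mono)
        qed
        then show ?thesis by simp
      qed
      then show "AE w in lborel. norm (LINT k|lborel. norm (case (w, k) of (w,k) \<Rightarrow> ?f w k))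
          \<le> norm (b w * (LINT k|lborel. norm (g k)))"
        by (intro AE_I2) (simp add: b0)
    qed measurable
  qed (use fi in auto)
  have "(LINT k|lborel. (wave x k * (LINT w|lborel. m w k)) *s g k)
      = (LINT k|lborel. LINT w|lborel. ?f w k)"
  proof (intro Bochner_Integration.integral_cong refl)
    fix k
    have "(LINT w|lborel. ?f w k) = (LINT w|lborel. wave x k * m w k) *s g k"
      by (rule integral_vscale_left) (simp add: mi)
    then show "(wave x k * (LINT w|lborel. m w k)) *s g k = (LINT w|lborel. ?f w k)" by simp
  qed
  also have "\<dots> = (LINT w|lborel. LINT k|lborel. ?f w k)"
    by (rule lborel_pair.Fubini_integral[OF int])
  finally have eq: "(LINT k|lborel. (wave x k * (LINT w|lborel. m w k)) *s g k)
     = (LINT w|lborel. LINT k|lborel. ?f w k)" .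
  have i2: "integrable lborel (\<lambda>w. LINT k|lborel. ?f w k)"
    using lborel_pair.integrable_fst[OF int] by simp
  have "norm (LINT w|lborel. LINT k|lborel. ?f w k) \<le> (LINT w|lborel. b w * M)"
    by (rule order_trans[OF integral_norm_bound integral_mono])
      (use i2 b Linf_multiplierD(3)[OF m g] M in auto)
  then show "norm (LINT k|lborel. (wave x k * (LINT w|lborel. m w k)) *s g k) \<le> (LINT w|lborel. b w) * M"
    using eq by simp
qed

section \<open>Integrals of derivatives\<close>

lemma integral_translation:
  fixes f :: "'a::euclidean_space \<Rightarrow> 'b::{banach, second_countable_topology}"
  assumes [measurable]: "f \<in> borel_measurable borel"
  shows "(LINT x|lborel. f (x + a)) = (LINT x|lborel. f x)"
proof -
  have "(LINT x|lborel. f x) = (LINT x|distr lborel borel ((+) a). f x)"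
    by (simp add: lborel_distr_plus)
  also have "\<dots> = (LINT x|lborel. f (a + x))" by (rule integral_distr) auto
  finally show ?thesis by (simp add: add.commute)
qed

lemma integrable_translation:
  fixes f :: "'a::euclidean_space \<Rightarrow> 'b::{banach, second_countable_topology}"
  assumes "integrable lborel f"
  shows "integrable lborel (\<lambda>x. f (x + a))"
proof -
  have [measurable]: "f \<in> borel_measurable borel" using assms by auto
  have "integrable (distr lborel borel ((+) a)) f"
    using assms by (simp add: lborel_distr_plus)
  then have "integrable lborel (\<lambda>x. f (a + x))" by (subst (asm) integrable_distr_eq) auto
  then show ?thesis by (simp add: add.commute)
qed

text \<open>By translation invariance the integral of \<open>u'\<close> equals that of its mean over the segments from \<open>x\<close>
to \<open>x + e\<close>. This mean is \<open>u (x + e) - u x\<close>, whose integral vanishes. Decay of \<open>u\<close> at infinity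
enters through integrability alone.\<close>

lemma integral_directional_derivative_eq_0:
  fixes u u' :: "'a::euclidean_space \<Rightarrow> 'b::euclidean_space"
  assumes D: "\<And>x. ((\<lambda>t. u (x + t *\<^sub>R e)) has_vector_derivative u' x) (at 0)"
    and u: "integrable lborel u" and u': "integrable lborel u'"
  shows "(LINT x|lborel. u' x) = 0"
proof -
  have [measurable]: "u \<in> borel_measurable borel" "u' \<in> borel_measurable borel" using u u' by auto
  have D': "((\<lambda>t. u (x + t *\<^sub>R e)) has_vector_derivative u' (x + t *\<^sub>R e)) (at t)" for x t
  proof -
    have 1: "((\<lambda>r. r - t) has_vector_derivative 1) (at t)"
      by (auto intro!: derivative_eq_intros)
    have "((\<lambda>s. u (x + t *\<^sub>R e + s *\<^sub>R e)) has_vector_derivative u' (x + t *\<^sub>R e)) (at (t - t))"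
      using D[of "x + t *\<^sub>R e"] by simp
    from vector_diff_chain_at[OF 1 this] show ?thesis
      by (simp add: o_def algebra_simps)
  qed
  let ?F = "\<lambda>t x. indicator {0..1::real} t *\<^sub>R u' (x + t *\<^sub>R e)"
  have int: "integrable (lborel \<Otimes>\<^sub>M lborel) (case_prod ?F)"
  proof (rule lborel_pair.Fubini_integrable)
    have "(LINT x|lborel. norm (u' (x + t *\<^sub>R e))) = (LINT x|lborel. norm (u' x))" for t
      by (rule integral_translation[of "\<lambda>x. norm (u' x)"]) simp
    then have eq: "(\<lambda>t. LINT x|lborel. norm (case (t, x) of (t,x) \<Rightarrow> ?F t x))
      = (\<lambda>t. indicator {0..1} t * (LINT x|lborel. norm (u' x)))"
      by (auto simp: fun_eq_iff)
    show "integrable lborel (\<lambda>t. LINT x|lborel. norm (case (t, x) of (t,x) \<Rightarrow> ?F t x))"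
      unfolding eq by (intro integrable_mult_left integrable_real_indicator) auto
    show "AE t in lborel. integrable lborel (\<lambda>x. case (t, x) of (t,x) \<Rightarrow> ?F t x)"
      using integrable_translation[OF u'] by auto
  qed measurable
  have "(LINT x|lborel. u' x) = (LINT t|lborel. LINT x|lborel. ?F t x)"
    by (simp add: integral_translation)
  also have "\<dots> = (LINT x|lborel. LINT t|lborel. ?F t x)"
    by (rule lborel_pair.Fubini_integral[OF int, symmetric])
  also have "\<dots> = (LINT x|lborel. u (x + e) - u x)"
  proof (rule integral_cong_AE)
    \<comment> \<open>The gauge integral of a derivative is the difference of the end values; for almost every
      \<open>x\<close> the derivative is also Lebesgue integrable over the segment, and the integrals agree.\<close>
    show "AE x in lborel. (LINT t|lborel. ?F t x) = u (x + e) - u x"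
      using lborel_pair.AE_integrable_snd[OF int]
    proof eventually_elim
      case (elim x)
      then have si: "set_integrable lborel {0..1} (\<lambda>t. u' (x + t *\<^sub>R e))"
        by (simp add: set_integrable_def)
      have "((\<lambda>t. u' (x + t *\<^sub>R e)) has_integral (u (x + 1 *\<^sub>R e) - u (x + 0 *\<^sub>R e))) {0..1}"
        by (intro fundamental_theorem_of_calculus) (auto intro: has_vector_derivative_at_within D')
      then have "integral {0..1} (\<lambda>t. u' (x + t *\<^sub>R e)) = u (x + e) - u x"
        by (simp add: integral_unique)
      then show ?case
        using set_borel_integral_eq_integral(2)[OF si] by (simp add: set_lebesgue_integral_def)
    qed
  qed measurable
  also have "\<dots> = 0"
    using u by (simp add: integrable_translation integral_translation)
  finally show ?thesis .
qed

section \<open>Gaussian multipliers\<close>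

lemma gaussian_char:
  "(LINT z|lborel. exp (\<i> * of_real (s * z)) * of_real (std_normal_density z)) = of_real (exp (- s\<^sup>2 / 2))"
proof -
  have "char std_normal_distribution s = (LINT z|lborel. std_normal_density z *\<^sub>R iexp (s * z))"
    unfolding char_def by (subst integral_density) (auto simp: normal_density_nonneg)
  then show ?thesis
    by (simp add: char_std_normal_distribution scaleR_conv_of_real mult.commute)
qed

lemma integrable_std_normal_moment_complex:
  "integrable lborel (\<lambda>z. of_real (z ^ n * std_normal_density z) :: complex)"
  using integrable_std_normal_moment[of n] by (intro integrable_of_real) (simp add: mult.commute)

text \<open>The derivative in \<open>s\<close> of the characteristic function, computed by an integration by parts in \<open>z\<close>.\<close>

lemma gaussian_char_deriv:
  "(LINT z|lborel. exp (\<i> * of_real (s * z)) * (- \<i> * of_real (z * std_normal_density z)))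
    = of_real (s * exp (- s\<^sup>2 / 2))"
proof -
  let ?E = "\<lambda>z. exp (\<i> * of_real (s * z))"
  let ?u = "\<lambda>z. ?E z * of_real (std_normal_density z)"
  let ?w = "\<lambda>z. ?E z * of_real (z * std_normal_density z)"
  let ?u' = "\<lambda>z. \<i> * of_real s * ?u z - ?w z"
  have i0: "integrable lborel ?u"
    by (intro Bochner_Integration.integrable_bound[OF integrable_std_normal_moment_complex[of 0]]) (auto simp: norm_mult)
  have i1: "integrable lborel ?w"
    by (intro Bochner_Integration.integrable_bound[OF integrable_std_normal_moment_complex[of 1]]) (auto simp: norm_mult)
  define c :: complex where "c = of_real (1 / sqrt (2 * pi))"
  have n: "of_real (std_normal_density z) = c * exp (- (of_real z * of_real z) / 2)" for z
    by (simp add: c_def std_normal_density_def power2_eq_square exp_of_real[symmetric] del: exp_of_real)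
  have D: "(?u has_vector_derivative ?u' z) (at z)" for z
    unfolding of_real_mult n
    by (auto intro!: derivative_eq_intros has_vector_derivative_real_field simp: algebra_simps)
  have D0: "((\<lambda>t. ?u (z + t *\<^sub>R 1)) has_vector_derivative ?u' z) (at 0)" for z
  proof -
    have 1: "((\<lambda>t. z + t *\<^sub>R 1) has_vector_derivative 1) (at 0)"
      by (auto intro!: derivative_eq_intros)
    have 2: "(?u has_vector_derivative ?u' z) (at (z + 0 *\<^sub>R 1))" using D by simp
    from vector_diff_chain_at[OF 1 2] show ?thesis by (simp add: o_def)
  qed
  have "integrable lborel ?u'"
    using i0 i1 by (intro Bochner_Integration.integrable_diff integrable_mult_right) auto
  from integral_directional_derivative_eq_0[OF D0 i0 this]
  have "(LINT z|lborel. \<i> * of_real s * ?u z) = (LINT z|lborel. ?w z)"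
    using i0 i1 by (subst (asm) Bochner_Integration.integral_diff) (auto intro: integrable_mult_right)
  then have "(LINT z|lborel. ?w z) = \<i> * of_real s * of_real (exp (- s\<^sup>2 / 2))"
    unfolding gaussian_char[symmetric] by simp
  moreover have "(LINT z|lborel. ?E z * (- \<i> * of_real (z * std_normal_density z))) = (LINT z|lborel. - \<i> * ?w z)"
    by (simp add: algebra_simps)
  ultimately show ?thesis by (simp add: algebra_simps)
qed

text \<open>The Fourier transform of an integrable function of one coordinate is a superposition of plane waves.
The bound does not depend on the scale \<open>q\<close>.\<close>

lemma Linf_multiplier_axis:
  assumes w: "integrable lborel w"
  shows "Linf_multiplier (LINT z|lborel. norm (w z))
    (\<lambda>k. LINT z|lborel. exp (\<i> * of_real (q * (k $ i + p) * z)) * w z)"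
proof -
  have [measurable]: "w \<in> borel_measurable borel" using w by auto
  have "Linf_multiplier (LINT z|lborel. norm (w z))
    (\<lambda>k. LINT z|lborel. wave ((q * z) *\<^sub>R axis i 1) k * (exp (\<i> * of_real (q * p * z)) * w z))"
  proof (rule Linf_multiplier_integral)
    show "integrable lborel (\<lambda>z. norm (w z))" using w by simp
    show "Linf_multiplier (norm (w z)) (\<lambda>k. wave ((q * z) *\<^sub>R axis i 1) k * (exp (\<i> * of_real (q * p * z)) * w z))" for z
      using Linf_multiplier_mult[OF Linf_multiplier_wave Linf_multiplier_const[of "exp (\<i> * of_real (q * p * z)) * w z"]]
      by (simp add: norm_mult)
  qed measurable
  moreover have "wave ((q * z) *\<^sub>R axis i 1) k * (exp (\<i> * of_real (q * p * z)) * w z)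
      = exp (\<i> * of_real (q * (k $ i + p) * z)) * w z" for z k
  proof -
    have "\<i> * of_real (q * (k $ i + p) * z) = \<i> * of_real (k \<bullet> ((q * z) *\<^sub>R axis i 1)) + \<i> * of_real (q * p * z)"
      by (simp add: inner_axis algebra_simps)
    then show ?thesis by (simp add: wave_def exp_add del: of_real_mult of_real_add)
  qed
  ultimately show ?thesis by (simp only:)
qed

lemma Linf_multiplier_gaussian_axis:
  "Linf_multiplier 1 (\<lambda>k. of_real (exp (- (q * (k $ i + p))\<^sup>2 / 2)))"
  using Linf_multiplier_axis[of "\<lambda>z. of_real (std_normal_density z)" q i p]
    integrable_std_normal_moment_complex[of 0]
  unfolding gaussian_char by simp

lemma Linf_multiplier_gaussian_deriv_axis:
  "Linf_multiplier 1 (\<lambda>k. of_real (q * (k $ i + p) * exp (- (q * (k $ i + p))\<^sup>2 / 2)))"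
proof (rule Linf_multiplier_mono)
  show "Linf_multiplier (LINT z|lborel. norm (- \<i> * of_real (z * std_normal_density z)))
     (\<lambda>k. of_real (q * (k $ i + p) * exp (- (q * (k $ i + p))\<^sup>2 / 2)))"
    using Linf_multiplier_axis[of "\<lambda>z. - \<i> * of_real (z * std_normal_density z)" q i p]
      integrable_mult_right[OF integrable_std_normal_moment_complex[of 1], of "- \<i>"]
    unfolding gaussian_char_deriv by simp
  have "(LINT z|lborel. norm (- \<i> * of_real (z * std_normal_density z))) = sqrt (2 / pi)"
    using integral_std_normal_moment_abs_odd[of 0]
    by (simp add: norm_mult normal_density_nonneg abs_mult mult.commute)
  also have "\<dots> \<le> 1"
    using pi_gt3 by (simp add: field_simps)
  finally show "(LINT z|lborel. norm (- \<i> * of_real (z * std_normal_density z))) \<le> 1" .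
qed

lemma norm_sq_R3: "(norm (x :: R3))\<^sup>2 = (x $ 1)\<^sup>2 + (x $ 2)\<^sup>2 + (x $ 3)\<^sup>2"
  by (simp add: norm_vec_def L2_set_def sum_3 real_sqrt_pow2 add_nonneg_nonneg)

lemma Linf_multiplier_gaussian:
  "Linf_multiplier 1 (\<lambda>k. of_real (exp (- (q\<^sup>2 * (norm (k + b))\<^sup>2) / 2)))"
proof -
  let ?g = "\<lambda>i k. of_real (exp (- (q * (k $ i + b $ i))\<^sup>2 / 2)) :: complex"
  have "Linf_multiplier (1 * 1 * 1) (\<lambda>k. ?g 1 k * ?g 2 k * ?g 3 k)"
    by (intro Linf_multiplier_mult Linf_multiplier_gaussian_axis)
  moreover have "?g 1 k * ?g 2 k * ?g 3 k = of_real (exp (- (q\<^sup>2 * (norm (k + b))\<^sup>2) / 2))" for k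
    unfolding norm_sq_R3
    by (simp add: exp_add[symmetric] power2_eq_square field_simps
        flip: of_real_mult)
  ultimately show ?thesis by simp
qed

text \<open>The factor \<open>q\<close> makes the bound uniform in the scale: the symbol is a sum over the coordinates of
products of two Gaussians and the derivative of a third.\<close>

lemma Linf_multiplier_gaussian_deriv:
  "Linf_multiplier (3 * norm w) (\<lambda>k. of_real (q * ((k + b) \<bullet> w) * exp (- (q\<^sup>2 * (norm (k + b))\<^sup>2) / 2)))"
proof -
  let ?g = "\<lambda>i k. of_real (exp (- (q * (k $ i + b $ i))\<^sup>2 / 2)) :: complex"
  let ?d = "\<lambda>i k. of_real (q * (k $ i + b $ i) * exp (- (q * (k $ i + b $ i))\<^sup>2 / 2)) :: complex"
  let ?c = "\<lambda>i. of_real (w $ i) :: complex"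
  have "Linf_multiplier (norm (?c 1) * (1 * 1 * 1) + norm (?c 2) * (1 * 1 * 1) + norm (?c 3) * (1 * 1 * 1))
     (\<lambda>k. ?c 1 * (?d 1 k * ?g 2 k * ?g 3 k) + ?c 2 * (?g 1 k * ?d 2 k * ?g 3 k) + ?c 3 * (?g 1 k * ?g 2 k * ?d 3 k))"
    by (intro Linf_multiplier_add Linf_multiplier_mult Linf_multiplier_const
        Linf_multiplier_gaussian_axis Linf_multiplier_gaussian_deriv_axis)
  moreover have "?c 1 * (?d 1 k * ?g 2 k * ?g 3 k) + ?c 2 * (?g 1 k * ?d 2 k * ?g 3 k) + ?c 3 * (?g 1 k * ?g 2 k * ?d 3 k)
     = of_real (q * ((k + b) \<bullet> w) * exp (- (q\<^sup>2 * (norm (k + b))\<^sup>2) / 2))" for k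
  proof -
    have "exp (- (q\<^sup>2 * (norm (k + b))\<^sup>2) / 2) = exp (- (q * (k $ 1 + b $ 1))\<^sup>2 / 2)
        * exp (- (q * (k $ 2 + b $ 2))\<^sup>2 / 2) * exp (- (q * (k $ 3 + b $ 3))\<^sup>2 / 2)"
      unfolding norm_sq_R3
      by (simp add: exp_add[symmetric] power2_eq_square field_simps)
    then show ?thesis
      by (simp add: inner_vec_def sum_3 algebra_simps del: exp_of_real of_real_exp flip: of_real_mult of_real_add)
  qed
  ultimately have "Linf_multiplier (\<bar>w $ 1\<bar> + \<bar>w $ 2\<bar> + \<bar>w $ 3\<bar>)
    (\<lambda>k. of_real (q * ((k + b) \<bullet> w) * exp (- (q\<^sup>2 * (norm (k + b))\<^sup>2) / 2)))" by simp
  then show ?thesis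
    by (rule Linf_multiplier_mono)
      (use component_le_norm_cart[of w 1] component_le_norm_cart[of w 2] component_le_norm_cart[of w 3] in simp)
qed

section \<open>Superpositions of Gaussians\<close>

text \<open>With \<open>P\<close> as the inverse variance, even moments of the normal distribution represent the powers
\<open>P\<^sup>-\<^sup>3\<^sup>/\<^sup>2\<close> and \<open>P\<^sup>-\<^sup>5\<^sup>/\<^sup>2\<close> by exponentials of \<open>P\<close>. The odd moment appears in the bounds only.\<close>

lemma gaussian_power_moments:
  fixes P :: real
  assumes "0 < P"
  shows gaussian_moment_2: "has_bochner_integral lborel (\<lambda>q. q\<^sup>2 * exp (- (q\<^sup>2 * P) / 2) / sqrt (2 * pi)) (1 / sqrt P ^ 3)"
    and gaussian_moment_4: "has_bochner_integral lborel (\<lambda>q. q ^ 4 * exp (- (q\<^sup>2 * P) / 2) / sqrt (2 * pi)) (3 / sqrt P ^ 5)"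
    and gaussian_moment_abs_3: "has_bochner_integral lborel (\<lambda>q. \<bar>q\<bar> ^ 3 * exp (- (q\<^sup>2 * P) / 2) / sqrt (2 * pi)) (2 * sqrt (2 / pi) / P\<^sup>2)"
proof -
  define s where "s = 1 / sqrt P"
  have s: "0 < s" "1 / s\<^sup>2 = P" "s\<^sup>2 = 1 / P" using assms by (auto simp: s_def power_divide)
  have n: "s * (normal_density 0 s q * c) = c * exp (- (q\<^sup>2 * P) / 2) / sqrt (2 * pi)" for q c
    using s(1) by (simp add: normal_density_def real_sqrt_mult s(2)[symmetric] field_simps)
  have "has_bochner_integral lborel (\<lambda>q. s * (normal_density 0 s q * (q - 0) ^ (2 * 1))) (s * (fact (2 * 1) / ((2 / s\<^sup>2)^1 * fact 1)))"
    by (intro has_bochner_integral_mult_right normal_moment_even s)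
  moreover have "s * (fact (2 * 1) / ((2 / s\<^sup>2)^1 * fact 1)) = 1 / sqrt P ^ 3"
    by (simp add: s_def power_divide power3_eq_cube power2_eq_square)
  ultimately show "has_bochner_integral lborel (\<lambda>q. q\<^sup>2 * exp (- (q\<^sup>2 * P) / 2) / sqrt (2 * pi)) (1 / sqrt P ^ 3)"
    unfolding n by simp
  have "has_bochner_integral lborel (\<lambda>q. s * (normal_density 0 s q * (q - 0) ^ (2 * 2))) (s * (fact (2 * 2) / ((2 / s\<^sup>2)^2 * fact 2)))"
    by (intro has_bochner_integral_mult_right normal_moment_even s)
  moreover have "s * (fact (2 * 2) / ((2 / s\<^sup>2)^2 * fact 2)) = 3 / sqrt P ^ 5"
    using s(1) by (simp add: s_def power_divide fact_numeral eval_nat_numeral field_simps)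
  ultimately show "has_bochner_integral lborel (\<lambda>q. q ^ 4 * exp (- (q\<^sup>2 * P) / 2) / sqrt (2 * pi)) (3 / sqrt P ^ 5)"
    unfolding n by simp
  have "has_bochner_integral lborel (\<lambda>q. s * (normal_density 0 s q * \<bar>q - 0\<bar> ^ (2 * 1 + 1))) (s * (2 ^ 1 * s ^ (2 * 1 + 1) * fact 1 * sqrt (2 / pi)))"
    by (intro has_bochner_integral_mult_right normal_moment_abs_odd s)
  moreover have "s * (2 ^ 1 * s ^ (2 * 1 + 1) * fact 1 * sqrt (2 / pi)) = 2 * sqrt (2 / pi) / P\<^sup>2"
  proof -
    have "s * (2 ^ 1 * s ^ (2 * 1 + 1) * fact 1 * sqrt (2 / pi)) = 2 * sqrt (2 / pi) * (s\<^sup>2 * s\<^sup>2)"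
      by (simp add: power3_eq_cube power2_eq_square)
    also have "\<dots> = 2 * sqrt (2 / pi) / P\<^sup>2"
      unfolding s(3) by (simp add: power2_eq_square)
    finally show ?thesis .
  qed
  ultimately show "has_bochner_integral lborel (\<lambda>q. \<bar>q\<bar> ^ 3 * exp (- (q\<^sup>2 * P) / 2) / sqrt (2 * pi)) (2 * sqrt (2 / pi) / P\<^sup>2)"
    unfolding n by (simp add: eval_nat_numeral)
qed

text \<open>The symbol is the second Gaussian moment with \<open>P = Y + |k + b|\<^sup>2\<close>. For each \<open>q\<close> the part \<open>Y\<close> is a
constant factor, and what remains is a Gaussian in \<open>k\<close> of norm 1, so that the norms add up to
the value of the symbol at \<open>k = -b\<close>.\<close>

lemma Linf_multiplier_inverse_cube:
  assumes "0 < Y"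
  shows "Linf_multiplier (1 / sqrt Y ^ 3) (\<lambda>k. of_real (1 / sqrt (Y + (norm (k + b))\<^sup>2) ^ 3))"
proof -
  let ?c = "\<lambda>q. q\<^sup>2 * exp (- (q\<^sup>2 * Y) / 2) / sqrt (2 * pi)"
  let ?m = "\<lambda>q k. of_real (?c q) * of_real (exp (- (q\<^sup>2 * (norm (k + b))\<^sup>2) / 2)) :: complex"
  have "Linf_multiplier (LINT q|lborel. ?c q) (\<lambda>k. LINT q|lborel. ?m q k)"
  proof (rule Linf_multiplier_integral)
    show "Linf_multiplier (?c q) (?m q)" for q
      using Linf_multiplier_mult[OF Linf_multiplier_const[of "of_real (?c q)"] Linf_multiplier_gaussian[of q b]]
      by (simp add: norm_divide norm_mult norm_power)
    show "integrable lborel ?c" using gaussian_moment_2[OF assms] by (rule integrable.intros)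
  qed measurable
  moreover have "(LINT q|lborel. ?c q) = 1 / sqrt Y ^ 3"
    using gaussian_moment_2[OF assms] by (rule has_bochner_integral_integral_eq)
  moreover have "(LINT q|lborel. ?m q k) = of_real (1 / sqrt (Y + (norm (k + b))\<^sup>2) ^ 3)" for k
  proof -
    have P: "0 < Y + (norm (k + b))\<^sup>2" using assms by (simp add: add_pos_nonneg)
    have "?m q k = of_real (q\<^sup>2 * exp (- (q\<^sup>2 * (Y + (norm (k + b))\<^sup>2)) / 2) / sqrt (2 * pi))" for q
    proof -
      have "exp (- (q\<^sup>2 * (Y + (norm (k + b))\<^sup>2)) / 2) = exp (- (q\<^sup>2 * Y) / 2) * exp (- (q\<^sup>2 * (norm (k + b))\<^sup>2) / 2)"
        by (simp add: exp_add[symmetric] field_simps)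
      then show ?thesis unfolding of_real_mult[symmetric] by simp
    qed
    then show ?thesis
      using has_bochner_integral_integral_eq[OF gaussian_moment_2[OF P]]
      by (simp only: integral_complex_of_real)
  qed
  ultimately show ?thesis by simp
qed

text \<open>The fourth moment, multiplied by \<open>k \<bullet> w = (k + b) \<bullet> w - b \<bullet> w\<close>. The first part is absorbed into the
derivative of the Gaussian, at the price of one power of \<open>q\<close>; this leaves the third absolute moment.\<close>

lemma Linf_multiplier_inverse_fifth:
  assumes "0 < Y"
  shows "Linf_multiplier (6 * norm w / Y\<^sup>2 + 3 * \<bar>b \<bullet> w\<bar> / sqrt Y ^ 5)
    (\<lambda>k. of_real (3 * (k \<bullet> w) / sqrt (Y + (norm (k + b))\<^sup>2) ^ 5))"
proof -
  let ?c = "\<lambda>n q. q ^ n * exp (- (q\<^sup>2 * Y) / 2) / sqrt (2 * pi)"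
  let ?d = "\<lambda>q. \<bar>q\<bar> ^ 3 * exp (- (q\<^sup>2 * Y) / 2) / sqrt (2 * pi)"
  let ?G = "\<lambda>q k. exp (- (q\<^sup>2 * (norm (k + b))\<^sup>2) / 2)"
  let ?m = "\<lambda>q k. of_real (?c 3 q) * of_real (q * ((k + b) \<bullet> w) * ?G q k)
     + of_real (- (?c 4 q * (b \<bullet> w))) * of_real (?G q k) :: complex"
  let ?B = "\<lambda>q. ?d q * (3 * norm w) + ?c 4 q * \<bar>b \<bullet> w\<bar>"
  have i4: "integrable lborel (?c 4)" and i3: "integrable lborel ?d"
    using gaussian_moment_4[OF assms] gaussian_moment_abs_3[OF assms] by (auto intro: integrable.intros)
  have "Linf_multiplier (LINT q|lborel. ?B q) (\<lambda>k. LINT q|lborel. ?m q k)"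
  proof (rule Linf_multiplier_integral)
    show "Linf_multiplier (?B q) (?m q)" for q
      using Linf_multiplier_add[OF
          Linf_multiplier_mult[OF Linf_multiplier_const[of "of_real (?c 3 q)"] Linf_multiplier_gaussian_deriv[of w q b]]
          Linf_multiplier_mult[OF Linf_multiplier_const[of "of_real (- (?c 4 q * (b \<bullet> w)))"] Linf_multiplier_gaussian[of q b]]]
      by (simp add: norm_divide norm_mult norm_power abs_mult power_abs)
    show "integrable lborel ?B" using i3 i4 by (intro Bochner_Integration.integrable_add integrable_mult_left)
  qed measurable
  moreover have "has_bochner_integral lborel ?B (2 * sqrt (2 / pi) / Y\<^sup>2 * (3 * norm w) + 3 / sqrt Y ^ 5 * \<bar>b \<bullet> w\<bar>)"
    by (intro has_bochner_integral_add has_bochner_integral_mult_left gaussian_moment_abs_3 gaussian_moment_4 assms)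
  ultimately have *: "Linf_multiplier (2 * sqrt (2 / pi) / Y\<^sup>2 * (3 * norm w) + 3 / sqrt Y ^ 5 * \<bar>b \<bullet> w\<bar>) (\<lambda>k. LINT q|lborel. ?m q k)"
    by (simp only: has_bochner_integral_integral_eq)
  have "(LINT q|lborel. ?m q k) = of_real (3 * (k \<bullet> w) / sqrt (Y + (norm (k + b))\<^sup>2) ^ 5)" for k
  proof -
    let ?P = "Y + (norm (k + b))\<^sup>2"
    have P: "0 < ?P" using assms by (simp add: add_pos_nonneg)
    have "?m q k = of_real ((k \<bullet> w) * (q ^ 4 * exp (- (q\<^sup>2 * ?P) / 2) / sqrt (2 * pi)))" for q
    proof -
      have "exp (- (q\<^sup>2 * ?P) / 2) = exp (- (q\<^sup>2 * Y) / 2) * ?G q k"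
        by (simp add: exp_add[symmetric] field_simps)
      then show ?thesis
        unfolding of_real_mult[symmetric] of_real_add[symmetric]
        by (simp add: inner_add_left field_simps eval_nat_numeral)
    qed
    then have "(LINT q|lborel. ?m q k) = of_real (LINT q|lborel. (k \<bullet> w) * (q ^ 4 * exp (- (q\<^sup>2 * ?P) / 2) / sqrt (2 * pi)))"
      by (simp only: integral_complex_of_real)
    also have "(LINT q|lborel. (k \<bullet> w) * (q ^ 4 * exp (- (q\<^sup>2 * ?P) / 2) / sqrt (2 * pi))) = (k \<bullet> w) * (3 / sqrt ?P ^ 5)"
      by (rule has_bochner_integral_integral_eq, rule has_bochner_integral_mult_right) (rule gaussian_moment_4[OF P])
    finally show ?thesis by (simp add: ac_simps)
  qed
  with * have "Linf_multiplier (2 * sqrt (2 / pi) / Y\<^sup>2 * (3 * norm w) + 3 / sqrt Y ^ 5 * \<bar>b \<bullet> w\<bar>)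
    (\<lambda>k. of_real (3 * (k \<bullet> w) / sqrt (Y + (norm (k + b))\<^sup>2) ^ 5))" by simp
  then show ?thesis
  proof (rule Linf_multiplier_mono)
    have "sqrt (2 / pi) \<le> 1" using pi_gt3 by (simp add: field_simps)
    then have "2 * sqrt (2 / pi) / Y\<^sup>2 * (3 * norm w) \<le> 2 * 1 / Y\<^sup>2 * (3 * norm w)"
      by (intro mult_right_mono divide_right_mono mult_left_mono) auto
    then show "2 * sqrt (2 / pi) / Y\<^sup>2 * (3 * norm w) + 3 / sqrt Y ^ 5 * \<bar>b \<bullet> w\<bar>
        \<le> 6 * norm w / Y\<^sup>2 + 3 * \<bar>b \<bullet> w\<bar> / sqrt Y ^ 5" by simp
  qed
qed

lemma quadratic_pos:
  fixes A B x :: real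
  assumes "\<bar>B\<bar> < A" shows "0 < A\<^sup>2 + 2 * x * B + x\<^sup>2"
proof -
  have "B\<^sup>2 < A\<^sup>2" using assms by (intro power2_strict_mono) auto
  moreover have eq: "A\<^sup>2 + 2 * x * B + x\<^sup>2 = (A\<^sup>2 - B\<^sup>2) + (x + B)\<^sup>2" by (simp add: power2_eq_square algebra_simps)
  ultimately show ?thesis unfolding eq by (intro add_pos_nonneg) auto
qed

lemma DERIV_sqrt_quadratic:
  fixes A B x :: real
  assumes "\<bar>B\<bar> < A"
  shows "((\<lambda>x. sqrt (A\<^sup>2 + 2 * x * B + x\<^sup>2)) has_real_derivative (x + B) / sqrt (A\<^sup>2 + 2 * x * B + x\<^sup>2)) (at x)"
  using quadratic_pos[OF assms, of x]
  by (auto intro!: derivative_eq_intros simp: field_simps)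

text \<open>With \<open>s(x) = (A\<^sup>2 + 2xB + x\<^sup>2)\<^sup>1\<^sup>/\<^sup>2\<close> and \<open>D = A\<^sup>2 - B\<^sup>2\<close>, a primitive of the integrand is
\<open>- (A\<^sup>2 + Bx) / (D s(x))\<close>; it runs from \<open>- A / D\<close> to \<open>- B / D\<close>.\<close>

lemma inverse_as_integral:
  fixes A B :: real
  assumes AB: "\<bar>B\<bar> < A"
  shows "has_bochner_integral lborel (\<lambda>x. indicator {0..} x * (x / sqrt (A\<^sup>2 + 2 * x * B + x\<^sup>2) ^ 3)) (1 / (A + B))"
proof -
  define s where "s x = sqrt (A\<^sup>2 + 2 * x * B + x\<^sup>2)" for x
  define D where "D = A\<^sup>2 - B\<^sup>2"
  have D0: "0 < D" using AB power2_strict_mono[of B A] by (simp add: D_def)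
  have s0: "0 < s x" and s2: "(s x)\<^sup>2 = A\<^sup>2 + 2 * x * B + x\<^sup>2" for x
    using quadratic_pos[OF AB, of x] by (auto simp: s_def)
  have Ds: "(s has_real_derivative (x + B) / s x) (at x)" for x
    unfolding s_def by (rule DERIV_sqrt_quadratic[OF AB])
  let ?F = "\<lambda>x. - (A\<^sup>2 + B * x) / (D * s x)"
  have DF: "(?F has_real_derivative x / s x ^ 3) (at x)" for x
  proof -
    have "(?F has_real_derivative (- B * (D * s x) - (- (A\<^sup>2 + B * x)) * (D * ((x + B) / s x))) / (D * s x * (D * s x))) (at x)"
      using s0[of x] D0 by (intro DERIV_divide DERIV_cmult Ds) (auto intro!: derivative_eq_intros)
    moreover have "(- B * (D * s x) - (- (A\<^sup>2 + B * x)) * (D * ((x + B) / s x))) / (D * s x * (D * s x))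
       = (- B * (s x)\<^sup>2 + (A\<^sup>2 + B * x) * (x + B)) / (D * s x ^ 3)"
      using s0[of x] D0 by (simp add: field_simps power2_eq_square power3_eq_cube)
    moreover have "- B * (s x)\<^sup>2 + (A\<^sup>2 + B * x) * (x + B) = D * x"
      unfolding s2 D_def by (simp add: power2_eq_square algebra_simps)
    ultimately show ?thesis using D0 by simp
  qed
  have lim: "(?F \<longlongrightarrow> - B / D) at_top"
  proof -
    have "((\<lambda>x. - (A\<^sup>2 + B * x) / sqrt (A\<^sup>2 + 2 * x * B + x\<^sup>2)) \<longlongrightarrow> - B) at_top"
      by real_asymp
    from tendsto_divide[OF this tendsto_const[of D]] D0 show ?thesis
      by (simp add: s_def mult.commute)
  qed
  have "(\<integral>\<^sup>+x. ennreal (x / s x ^ 3) * indicator {0 ..} x \<partial>lborel) = - B / D - ?F 0"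
    using s0 by (intro nn_integral_FTC_atLeast[OF _ DF _ lim])
      (auto simp: s_def less_imp_le intro!: borel_measurable_divide borel_measurable_power)
  also have "- B / D - ?F 0 = 1 / (A + B)"
  proof -
    have "s 0 = A" using AB by (simp add: s_def)
    moreover have "D = (A + B) * (A - B)" by (simp add: D_def power2_eq_square algebra_simps)
    ultimately show ?thesis using AB by (simp add: power2_eq_square divide_simps)
  qed
  finally have nn: "(\<integral>\<^sup>+x. ennreal (indicator {0..} x * (x / s x ^ 3)) \<partial>lborel) = ennreal (1 / (A + B))"
    by (subst nn_integral_cong[where v="\<lambda>x. ennreal (x / s x ^ 3) * indicator {0 ..} x"])
      (auto simp: indicator_def)
  show ?thesis
    unfolding s_def[symmetric]
    by (rule has_bochner_integral_nn_integral[OF _ _ _ nn])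
      (use s0 AB in \<open>auto simp: s_def indicator_def less_imp_le\<close>)
qed

text \<open>The derivative of the preceding formula with respect to \<open>B\<close>, up to sign. It is proved through the
\<open>B\<close>-derivative of the primitive, instead of differentiating under the integral.\<close>

lemma inverse_square_as_integral:
  fixes A B :: real
  assumes AB: "\<bar>B\<bar> < A"
  shows "has_bochner_integral lborel (\<lambda>x. indicator {0..} x * (3 * x\<^sup>2 / sqrt (A\<^sup>2 + 2 * x * B + x\<^sup>2) ^ 5)) (1 / (A + B)\<^sup>2)"
proof -
  define s where "s x = sqrt (A\<^sup>2 + 2 * x * B + x\<^sup>2)" for x
  define D where "D = A\<^sup>2 - B\<^sup>2"
  have D0: "0 < D" using AB power2_strict_mono[of B A] by (simp add: D_def)
  have s0: "0 < s x" and s2: "(s x)\<^sup>2 = A\<^sup>2 + 2 * x * B + x\<^sup>2" for x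
    using quadratic_pos[OF AB, of x] by (auto simp: s_def)
  have Ds: "(s has_real_derivative (x + B) / s x) (at x)" for x
    unfolding s_def by (rule DERIV_sqrt_quadratic[OF AB])
  let ?N = "\<lambda>x. (x * D + 2 * B * (A\<^sup>2 + B * x)) * (s x)\<^sup>2 - x * (A\<^sup>2 + B * x) * D"
  let ?F = "\<lambda>x. ?N x / (D\<^sup>2 * s x ^ 3)"
  have DF: "(?F has_real_derivative 3 * x\<^sup>2 / s x ^ 5) (at x)" for x
  proof -
    let ?N' = "(D + 2 * B * B) * (s x)\<^sup>2 + (x * D + 2 * B * (A\<^sup>2 + B * x)) * (2 * (x + B)) - (A\<^sup>2 + 2 * B * x) * D"
    have N': "(?N has_real_derivative ?N') (at x)"
      unfolding s2 by (auto intro!: derivative_eq_intros simp: algebra_simps)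
    have S': "((\<lambda>x. D\<^sup>2 * s x ^ 3) has_real_derivative D\<^sup>2 * (3 * s x * (x + B))) (at x)"
      using s0[of x] by (auto intro!: derivative_eq_intros Ds simp: power2_eq_square power3_eq_cube)
    have "(?F has_real_derivative (?N' * (D\<^sup>2 * s x ^ 3) - ?N x * (D\<^sup>2 * (3 * s x * (x + B)))) / (D\<^sup>2 * s x ^ 3 * (D\<^sup>2 * s x ^ 3))) (at x)"
      using s0[of x] D0 by (intro DERIV_divide N' S') auto
    moreover have "(?N' * (D\<^sup>2 * s x ^ 3) - ?N x * (D\<^sup>2 * (3 * s x * (x + B)))) / (D\<^sup>2 * s x ^ 3 * (D\<^sup>2 * s x ^ 3))
       = (?N' * (s x)\<^sup>2 - 3 * ?N x * (x + B)) / (D\<^sup>2 * s x ^ 5)"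
    proof -
      have "?N' * (D\<^sup>2 * s x ^ 3) - ?N x * (D\<^sup>2 * (3 * s x * (x + B))) = (D\<^sup>2 * s x) * (?N' * (s x)\<^sup>2 - 3 * ?N x * (x + B))"
        by (simp add: algebra_simps power2_eq_square power3_eq_cube)
      moreover have "D\<^sup>2 * s x ^ 3 * (D\<^sup>2 * s x ^ 3) = (D\<^sup>2 * s x) * (D\<^sup>2 * s x ^ 5)"
        by (simp add: eval_nat_numeral)
      moreover have "D\<^sup>2 * s x \<noteq> 0" using s0[of x] D0 by simp
      moreover have "a = c * p \<Longrightarrow> b = c * q \<Longrightarrow> c \<noteq> 0 \<Longrightarrow> a / b = p / q" for a b c p q :: real
        by simp
      ultimately show ?thesis by metis
    qed
    moreover have "?N' * (s x)\<^sup>2 - 3 * ?N x * (x + B) = 3 * x\<^sup>2 * D\<^sup>2"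
      unfolding s2 D_def by algebra
    ultimately show ?thesis using D0 by simp
  qed
  have lim: "(?F \<longlongrightarrow> (D + 2 * B\<^sup>2) / D\<^sup>2) at_top"
  proof -
    have 1: "((\<lambda>x. (x * D + 2 * B * (A\<^sup>2 + B * x)) / sqrt (A\<^sup>2 + 2 * x * B + x\<^sup>2)) \<longlongrightarrow> D + 2 * B\<^sup>2) at_top"
      unfolding D_def power2_eq_square[of B] by real_asymp
    have 2: "((\<lambda>x. x * (A\<^sup>2 + B * x) * D / sqrt (A\<^sup>2 + 2 * x * B + x\<^sup>2) ^ 3) \<longlongrightarrow> 0) at_top"
      unfolding D_def by real_asymp
    have "((\<lambda>x. ((x * D + 2 * B * (A\<^sup>2 + B * x)) / s x - x * (A\<^sup>2 + B * x) * D / s x ^ 3) / D\<^sup>2) \<longlongrightarrow> (D + 2 * B\<^sup>2 - 0) / D\<^sup>2) at_top"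
      unfolding s_def using D0 by (intro tendsto_divide tendsto_diff 1 2 tendsto_const) auto
    moreover have "((x * D + 2 * B * (A\<^sup>2 + B * x)) / s x - x * (A\<^sup>2 + B * x) * D / s x ^ 3) / D\<^sup>2 = ?F x" for x
      using s0[of x] D0 by (simp add: field_simps power2_eq_square power3_eq_cube)
    ultimately show ?thesis by simp
  qed
  have "(\<integral>\<^sup>+x. ennreal (3 * x\<^sup>2 / s x ^ 5) * indicator {0 ..} x \<partial>lborel) = (D + 2 * B\<^sup>2) / D\<^sup>2 - ?F 0"
    using s0 by (intro nn_integral_FTC_atLeast[OF _ DF _ lim])
      (auto simp: s_def less_imp_le intro!: borel_measurable_divide borel_measurable_power)
  also have "(D + 2 * B\<^sup>2) / D\<^sup>2 - ?F 0 = 1 / (A + B)\<^sup>2"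
  proof -
    have "s 0 = A" and A: "A \<noteq> 0" using AB by (auto simp: s_def)
    then have "?F 0 = 2 * A * B / D\<^sup>2" by (simp add: field_simps eval_nat_numeral)
    then have "(D + 2 * B\<^sup>2) / D\<^sup>2 - ?F 0 = (A - B)\<^sup>2 / D\<^sup>2"
      by (simp add: diff_divide_distrib[symmetric] D_def power2_eq_square algebra_simps)
    also have "\<dots> = 1 / (A + B)\<^sup>2"
    proof -
      have D: "D = (A + B) * (A - B)" by (simp add: D_def power2_eq_square algebra_simps)
      show ?thesis unfolding D using AB by (simp add: power_mult_distrib)
    qed
    finally show ?thesis .
  qed
  finally have nn: "(\<integral>\<^sup>+x. ennreal (indicator {0..} x * (3 * x\<^sup>2 / s x ^ 5)) \<partial>lborel) = ennreal (1 / (A + B)\<^sup>2)"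
    by (subst nn_integral_cong[where v="\<lambda>x. ennreal (3 * x\<^sup>2 / s x ^ 5) * indicator {0 ..} x"])
      (auto simp: indicator_def)
  show ?thesis
    unfolding s_def[symmetric]
    by (rule has_bochner_integral_nn_integral[OF _ _ _ nn])
      (use s0 AB in \<open>auto simp: s_def indicator_def less_imp_le\<close>)
qed

section \<open>Multipliers with the symbols of the collective fields\<close>

lemma jb_pos [simp]: "0 < jb x" and jb_ge_1 [simp]: "1 \<le> jb x" and jb_sq: "(jb x)\<^sup>2 = 1 + (norm x)\<^sup>2"
  by (auto simp: jb_def add_pos_nonneg)

lemma jb_nonzero [simp]: "jb x \<noteq> 0"
  using jb_pos[of x] by linarith

lemma norm_less_jb: "norm x < jb x"
  by (rule power2_less_imp_less) (auto simp: jb_sq less_imp_le)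

lemma borel_measurable_jb [measurable]: "jb \<in> borel_measurable (borel :: 'a::euclidean_space measure)"
  unfolding jb_def[abs_def] by measurable

lemma inner_abs_less_jb:
  assumes "norm b < 1" shows "\<bar>k \<bullet> b\<bar> < jb k"
proof -
  have "\<bar>k \<bullet> b\<bar> \<le> norm k * norm b" by (rule Cauchy_Schwarz_ineq2)
  also have "\<dots> \<le> norm k * 1" using assms by (intro mult_left_mono) auto
  finally show ?thesis using norm_less_jb[of k] by simp
qed

text \<open>Completing the square in \<open>k\<close>: for fixed \<open>x\<close> the quadratic of the integral representations is a
positive constant plus the square of the distance of \<open>k\<close> to a point, so that Gaussians apply.\<close>

lemma quadratic_eq_shifted:
  fixes k b :: R3
  shows "(jb k)\<^sup>2 + 2 * x * (k \<bullet> b) + x\<^sup>2 = (1 + (1 - (norm b)\<^sup>2) * x\<^sup>2) + (norm (k + x *\<^sub>R b))\<^sup>2"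
  unfolding jb_sq power2_norm_eq_inner
  by (simp add: inner_add_left inner_add_right inner_commute power2_eq_square algebra_simps)

text \<open>The norms add up to \<open>\<integral>\<^sub>0\<^sup>\<infinity> x (1 + g x\<^sup>2)\<^sup>-\<^sup>3\<^sup>/\<^sup>2 dx = 1 / g\<close> with \<open>g = 1 - |b|\<^sup>2\<close>, which is the same
integral representation again, with \<open>A\<^sup>2 = 1 / g\<close> and \<open>B = 0\<close>.\<close>

lemma Linf_multiplier_resolvent:
  assumes b: "norm b < 1"
  shows "Linf_multiplier (1 / (1 - (norm b)\<^sup>2)) (\<lambda>k. of_real (1 / (jb k + k \<bullet> b)))"
proof -
  define g where "g = 1 - (norm b)\<^sup>2"
  have g: "0 < g" using b power_strict_mono[of "norm b" 1 2] by (simp add: g_def)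
  have Y: "0 < 1 + g * x\<^sup>2" for x using g by (simp add: add_pos_nonneg)
  let ?m = "\<lambda>x k. of_real (indicator {0..} x * x) * of_real (1 / sqrt (1 + g * x\<^sup>2 + (norm (k + x *\<^sub>R b))\<^sup>2) ^ 3) :: complex"
  let ?B = "\<lambda>x. (indicator {0..} x * x) * (1 / sqrt (1 + g * x\<^sup>2) ^ 3)"
  have "has_bochner_integral lborel ?B (1 / g)"
  proof -
    define A where "A = 1 / sqrt g"
    have A: "0 < A" "A\<^sup>2 = 1 / g" using g by (auto simp: A_def power_divide)
    have "sqrt (1 + g * x\<^sup>2) = sqrt (A\<^sup>2 + 2 * x * 0 + x\<^sup>2) / A" for x
      unfolding A(2) using g by (simp add: A_def real_sqrt_mult[symmetric] distrib_left add.commute field_simps)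
    then have "?B = (\<lambda>x. A ^ 3 * (indicator {0..} x * (x / sqrt (A\<^sup>2 + 2 * x * 0 + x\<^sup>2) ^ 3)))"
      by (auto simp: power_divide field_simps fun_eq_iff)
    moreover have "has_bochner_integral lborel (\<lambda>x. A ^ 3 * (indicator {0..} x * (x / sqrt (A\<^sup>2 + 2 * x * 0 + x\<^sup>2) ^ 3))) (A ^ 3 * (1 / (A + 0)))"
      using A by (intro has_bochner_integral_mult_right inverse_as_integral) auto
    moreover have "A ^ 3 * (1 / (A + 0)) = 1 / g"
      using A by (simp add: power3_eq_cube power2_eq_square)
    ultimately show ?thesis by simp
  qed
  moreover have "Linf_multiplier (LINT x|lborel. ?B x) (\<lambda>k. LINT x|lborel. ?m x k)"
  proof (rule Linf_multiplier_integral)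
    show "integrable lborel ?B" using calculation by (rule integrable.intros)
    show "Linf_multiplier (?B x) (?m x)" for x
      using Linf_multiplier_mult[OF Linf_multiplier_const[of "of_real (indicator {0..} x * x)"] Linf_multiplier_inverse_cube[OF Y, of x "x *\<^sub>R b"]]
      by (cases "0 \<le> x") (simp_all add: norm_mult)
  qed measurable
  moreover have "(LINT x|lborel. ?m x k) = of_real (1 / (jb k + k \<bullet> b))" for k
  proof -
    have "?m x k = of_real (indicator {0..} x * (x / sqrt ((jb k)\<^sup>2 + 2 * x * (k \<bullet> b) + x\<^sup>2) ^ 3))" for x
      unfolding quadratic_eq_shifted g_def by simp
    then show ?thesis
      using has_bochner_integral_integral_eq[OF inverse_as_integral[OF inner_abs_less_jb[OF b], of k]]
      by (simp only: integral_complex_of_real)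
  qed
  ultimately show ?thesis by (simp add: has_bochner_integral_integral_eq g_def)
qed

lemma integrable_inverse_1_plus_square_UNIV: "integrable lborel (\<lambda>x::real. inverse (1 + x\<^sup>2))"
  and integral_inverse_1_plus_square_UNIV: "(LINT x|lborel. inverse (1 + x\<^sup>2)) = pi"
  using integrable_inverse_1_plus_square LBINT_inverse_1_plus_square
  by (auto simp: set_integrable_def interval_lebesgue_integral_def set_lebesgue_integral_def)

text \<open>Both terms in the norm of the fifth power decay like \<open>x\<^sup>-\<^sup>4\<close>, against the weight \<open>x\<^sup>2\<close>. They are
compared with \<open>1 / (1 + x\<^sup>2)\<close>, at the cost of a third power of \<open>1 / (1 - |b|\<^sup>2)\<close>.\<close>

lemma Linf_multiplier_resolvent_deriv:
  assumes b: "norm b < 1"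
  shows "Linf_multiplier (9 * pi * norm w / (1 - (norm b)\<^sup>2) ^ 3) (\<lambda>k. of_real ((k \<bullet> w) / (jb k + k \<bullet> b)\<^sup>2))"
proof -
  define g where "g = 1 - (norm b)\<^sup>2"
  have g: "0 < g" "g \<le> 1" using b power_strict_mono[of "norm b" 1 2] by (auto simp: g_def)
  have Y: "0 < 1 + g * x\<^sup>2" for x using g by (simp add: add_pos_nonneg)
  let ?m = "\<lambda>x k. of_real (indicator {0..} x * x\<^sup>2) * of_real (3 * (k \<bullet> w) / sqrt (1 + g * x\<^sup>2 + (norm (k + x *\<^sub>R b))\<^sup>2) ^ 5) :: complex"
  let ?B = "\<lambda>x. (9 * norm w / g ^ 3) * inverse (1 + x\<^sup>2)"
  have bound: "indicator {0..} x * x\<^sup>2 * (6 * norm w / (1 + g * x\<^sup>2)\<^sup>2 + 3 * \<bar>(x *\<^sub>R b) \<bullet> w\<bar> / sqrt (1 + g * x\<^sup>2) ^ 5) \<le> ?B x" for x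
  proof (cases "0 \<le> x")
    case x: True
    define S where "S = sqrt (1 + g * x\<^sup>2)"
    have S: "0 < S" "S\<^sup>2 = 1 + g * x\<^sup>2" using Y[of x] by (auto simp: S_def)
    have h: "g\<^sup>2 \<le> g" using g by (simp add: power2_eq_square mult_left_le)
    have gx: "g * x \<le> S"
    proof (rule power2_le_imp_le)
      have "g\<^sup>2 * x\<^sup>2 \<le> g * x\<^sup>2" using h by (intro mult_right_mono) auto
      then show "(g * x)\<^sup>2 \<le> S\<^sup>2" by (simp add: S power_mult_distrib)
    qed (use S in simp)
    have gx2: "g * x\<^sup>2 \<le> S\<^sup>2" and gS: "g * (1 + x\<^sup>2) \<le> S\<^sup>2" using g S by (auto simp: distrib_left)
    have bw: "\<bar>(x *\<^sub>R b) \<bullet> w\<bar> \<le> x * norm w"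
    proof -
      have "\<bar>(x *\<^sub>R b) \<bullet> w\<bar> \<le> x * norm b * norm w" using Cauchy_Schwarz_ineq2[of "x *\<^sub>R b" w] x by simp
      also have "\<dots> \<le> x * 1 * norm w" using x b by (intro mult_right_mono mult_left_mono) auto
      finally show ?thesis by simp
    qed
    have gen: "c * d * a \<le> b \<Longrightarrow> 0 < b \<Longrightarrow> 0 < c * d \<Longrightarrow> a / b \<le> 1 / c * inverse d" for a b c d :: real
      by (simp add: field_simps zero_less_mult_iff)
    have p: "0 < g ^ 3 * (1 + x\<^sup>2)" using g by (simp add: add_pos_nonneg)
    have 1: "x\<^sup>2 / (S\<^sup>2)\<^sup>2 \<le> 1 / g ^ 3 * inverse (1 + x\<^sup>2)"
    proof -
      have "g ^ 3 * (1 + x\<^sup>2) * x\<^sup>2 = g * ((g * (1 + x\<^sup>2)) * (g * x\<^sup>2))" by (simp add: power3_eq_cube algebra_simps)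
      also have "\<dots> \<le> 1 * (S\<^sup>2 * S\<^sup>2)"
        using g gx2 gS x by (intro mult_mono) (auto simp: add_nonneg_nonneg)
      finally have "g ^ 3 * (1 + x\<^sup>2) * x\<^sup>2 \<le> (S\<^sup>2)\<^sup>2" by (simp add: power2_eq_square)
      then show ?thesis by (rule gen) (use S p in \<open>auto simp: zero_less_mult_iff\<close>)
    qed
    have 2: "x\<^sup>2 * x / S ^ 5 \<le> 1 / g ^ 3 * inverse (1 + x\<^sup>2)"
    proof -
      have "g ^ 3 * (1 + x\<^sup>2) * (x\<^sup>2 * x) = (g * (1 + x\<^sup>2)) * ((g * x\<^sup>2) * (g * x))" by (simp add: power3_eq_cube algebra_simps)
      also have "\<dots> \<le> S\<^sup>2 * (S\<^sup>2 * S)"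
        using g gx2 gS gx x by (intro mult_mono) (auto simp: add_nonneg_nonneg)
      finally have "g ^ 3 * (1 + x\<^sup>2) * (x\<^sup>2 * x) \<le> S ^ 5" by (simp add: eval_nat_numeral mult_ac)
      then show ?thesis by (rule gen) (use S p in auto)
    qed
    have "x\<^sup>2 * (6 * norm w / (S\<^sup>2)\<^sup>2 + 3 * \<bar>(x *\<^sub>R b) \<bullet> w\<bar> / S ^ 5)
       \<le> x\<^sup>2 * (6 * norm w / (S\<^sup>2)\<^sup>2 + 3 * (x * norm w) / S ^ 5)"
      using bw S by (intro mult_left_mono add_left_mono divide_right_mono) auto
    also have "\<dots> = norm w * (6 * (x\<^sup>2 / (S\<^sup>2)\<^sup>2) + 3 * (x\<^sup>2 * x / S ^ 5))" by (simp add: algebra_simps)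
    also have "\<dots> \<le> norm w * (6 * (1 / g ^ 3 * inverse (1 + x\<^sup>2)) + 3 * (1 / g ^ 3 * inverse (1 + x\<^sup>2)))"
      by (intro mult_left_mono add_mono 1 2) auto
    also have "\<dots> = ?B x" by (simp add: algebra_simps)
    finally show ?thesis using x S(1) by (simp add: S(2)[symmetric] S_def[symmetric])
  qed (use g in \<open>simp add: add_nonneg_nonneg\<close>)
  have "Linf_multiplier (LINT x|lborel. ?B x) (\<lambda>k. LINT x|lborel. ?m x k)"
  proof (rule Linf_multiplier_integral)
    show "integrable lborel ?B" by (intro integrable_mult_right integrable_inverse_1_plus_square_UNIV)
    show "Linf_multiplier (?B x) (?m x)" for x
      using Linf_multiplier_mult[OF Linf_multiplier_const[of "of_real (indicator {0..} x * x\<^sup>2)"] Linf_multiplier_inverse_fifth[OF Y[of x], of w "x *\<^sub>R b"]]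
      by (rule Linf_multiplier_mono) (use bound[of x] in \<open>simp add: norm_mult norm_power indicator_def split: if_splits\<close>)
  qed measurable
  moreover have "(LINT x|lborel. ?m x k) = of_real ((k \<bullet> w) / (jb k + k \<bullet> b)\<^sup>2)" for k
  proof -
    have "?m x k = of_real ((k \<bullet> w) * (indicator {0..} x * (3 * x\<^sup>2 / sqrt ((jb k)\<^sup>2 + 2 * x * (k \<bullet> b) + x\<^sup>2) ^ 5)))" for x
      unfolding quadratic_eq_shifted g_def of_real_mult[symmetric] by simp
    then have "(LINT x|lborel. ?m x k) = of_real (LINT x|lborel. (k \<bullet> w) * (indicator {0..} x * (3 * x\<^sup>2 / sqrt ((jb k)\<^sup>2 + 2 * x * (k \<bullet> b) + x\<^sup>2) ^ 5)))"
      by (simp only: integral_complex_of_real)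
    also have "(LINT x|lborel. (k \<bullet> w) * (indicator {0..} x * (3 * x\<^sup>2 / sqrt ((jb k)\<^sup>2 + 2 * x * (k \<bullet> b) + x\<^sup>2) ^ 5))) = (k \<bullet> w) * (1 / (jb k + k \<bullet> b)\<^sup>2)"
      by (rule has_bochner_integral_integral_eq, rule has_bochner_integral_mult_right)
        (rule inverse_square_as_integral[OF inner_abs_less_jb[OF b]])
    finally show ?thesis by simp
  qed
  ultimately show ?thesis by (simp add: integral_inverse_1_plus_square_UNIV g_def mult_ac)
qed

lemma one_minus_norm_vhat_sq: "1 - (norm (vhat v))\<^sup>2 = 1 / (jb v)\<^sup>2"
proof -
  have "(norm (vhat v))\<^sup>2 = (norm v)\<^sup>2 / (jb v)\<^sup>2" by (simp add: vhat_def power_divide less_imp_le)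
  then show ?thesis by (simp add: jb_sq field_simps add_pos_nonneg less_imp_neq[THEN not_sym])
qed

lemma norm_vhat_less_1: "norm (vhat v) < 1"
  using norm_less_jb[of v] by (simp add: vhat_def less_imp_le)

text \<open>The constant \<open>1 / (\<plusminus>i)\<close> by which the symbols differ from real resolvents.\<close>

definition sgn_factor :: "real \<Rightarrow> complex" where "sgn_factor \<sigma> = - \<i> * of_real \<sigma>"

lemma phi_symbol_eq:
  assumes "\<sigma> \<in> {1, -1}"
  shows "phi_symbol \<sigma> j v k = sgn_factor \<sigma> ^ j * of_real (1 / (jb k + k \<bullet> (\<sigma> *\<^sub>R vhat v)) ^ j)"
proof -
  have b: "norm (\<sigma> *\<^sub>R vhat v) < 1" using assms norm_vhat_less_1 by auto
  let ?d = "jb k + k \<bullet> (\<sigma> *\<^sub>R vhat v)"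
  have d: "0 < ?d" using inner_abs_less_jb[OF b, of k] by linarith
  have "lam \<sigma> k + \<i> * of_real (k \<bullet> vhat v) = (\<i> * of_real \<sigma>) * of_real ?d"
    using assms by (auto simp: lam_def algebra_simps)
  moreover have "1 / ((\<i> * of_real \<sigma>) * of_real ?d) = sgn_factor \<sigma> * of_real (1 / ?d)"
    using assms by (auto simp: sgn_factor_def divide_simps)
  ultimately show ?thesis
    unfolding phi_symbol_def power_one_over[symmetric] by (simp only: power_mult_distrib of_real_power)
qed

lemma norm_sgn_factor: "\<sigma> \<in> {1, -1} \<Longrightarrow> norm (sgn_factor \<sigma>) = 1"
  by (auto simp: sgn_factor_def norm_mult)

lemma Linf_multiplier_phi_symbol:
  assumes "\<sigma> \<in> {1, -1}"
  shows "Linf_multiplier ((jb v)\<^sup>2) (phi_symbol \<sigma> 1 v)"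
proof -
  have b: "norm (\<sigma> *\<^sub>R vhat v) < 1" using assms norm_vhat_less_1 by auto
  have n: "norm (\<sigma> *\<^sub>R vhat v) = norm (vhat v)" using assms by auto
  have "Linf_multiplier (norm (sgn_factor \<sigma>) * (1 / (1 - (norm (\<sigma> *\<^sub>R vhat v))\<^sup>2)))
     (\<lambda>k. sgn_factor \<sigma> * of_real (1 / (jb k + k \<bullet> (\<sigma> *\<^sub>R vhat v))))"
    by (intro Linf_multiplier_mult Linf_multiplier_const Linf_multiplier_resolvent b)
  then show ?thesis
    unfolding n one_minus_norm_vhat_sq norm_sgn_factor[OF assms] phi_symbol_eq[OF assms, abs_def] by simp
qed

lemma Linf_multiplier_phi_symbol_deriv:
  assumes "\<sigma> \<in> {1, -1}"
  shows "Linf_multiplier (9 * pi * norm w * (jb v) ^ 6) (\<lambda>k. of_real (k \<bullet> w) * phi_symbol \<sigma> 2 v k)"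
proof -
  have b: "norm (\<sigma> *\<^sub>R vhat v) < 1" using assms norm_vhat_less_1 by auto
  have n: "norm (\<sigma> *\<^sub>R vhat v) = norm (vhat v)" using assms by auto
  have "Linf_multiplier (norm (sgn_factor \<sigma> ^ 2) * (9 * pi * norm w / (1 - (norm (\<sigma> *\<^sub>R vhat v))\<^sup>2) ^ 3))
     (\<lambda>k. sgn_factor \<sigma> ^ 2 * of_real ((k \<bullet> w) / (jb k + k \<bullet> (\<sigma> *\<^sub>R vhat v))\<^sup>2))"
    by (intro Linf_multiplier_mult Linf_multiplier_const Linf_multiplier_resolvent_deriv b)
  then show ?thesis
    unfolding n one_minus_norm_vhat_sq norm_power norm_sgn_factor[OF assms] phi_symbol_eq[OF assms, abs_def]
    by (simp add: power_divide power_mult[symmetric] mult_ac)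
qed

text \<open>The resolvent at velocity 0.\<close>

lemma Linf_multiplier_osc_a:
  assumes "\<sigma> \<in> {1, -1}"
  shows "Linf_multiplier 1 (osc_a \<sigma>)"
proof (rule Linf_multiplier_mono)
  have "Linf_multiplier (norm (- of_real \<sigma> * (\<i> / 2)) * (1 / (1 - (norm (0::R3))\<^sup>2)))
     (\<lambda>k. - of_real \<sigma> * (\<i> / 2) * of_real (1 / (jb k + k \<bullet> 0)))"
    by (intro Linf_multiplier_mult Linf_multiplier_const Linf_multiplier_resolvent) simp
  then show "Linf_multiplier (norm (- of_real \<sigma> * (\<i> / 2)) * 1) (osc_a \<sigma>)"
    by (simp add: osc_a_def[abs_def])
qed (use assms in \<open>auto simp: norm_mult\<close>)

lemma norm_osc_a: "\<sigma> \<in> {1, -1} \<Longrightarrow> norm (osc_a \<sigma> k) = 1 / (2 * jb k)"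
  by (auto simp: osc_a_def norm_mult norm_divide less_imp_le)

text \<open>The denominator is at least \<open>\<langle>k\<rangle> (1 - |vhat v|)\<close>, and \<open>1 - |vhat v|\<close> is comparable with \<open>1 / \<langle>v\<rangle>\<^sup>2\<close>.\<close>

lemma norm_phi_symbol_le:
  assumes "\<sigma> \<in> {1, -1}"
  shows "norm (phi_symbol \<sigma> j v k) \<le> (2 * (jb v)\<^sup>2 / jb k) ^ j"
proof -
  have n: "norm (\<sigma> *\<^sub>R vhat v) = norm (vhat v)" using assms by auto
  have "1 / (jb v)\<^sup>2 = (1 - norm (vhat v)) * (1 + norm (vhat v))"
    unfolding one_minus_norm_vhat_sq[symmetric] by (simp add: power2_eq_square algebra_simps)
  also have "\<dots> \<le> (1 - norm (vhat v)) * 2" using norm_vhat_less_1[of v] by (intro mult_left_mono) auto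
  finally have "1 / (2 * (jb v)\<^sup>2) \<le> 1 - norm (vhat v)" by simp
  then have "jb k * (1 / (2 * (jb v)\<^sup>2)) \<le> jb k * (1 - norm (vhat v))" by (intro mult_left_mono) (auto simp: less_imp_le)
  also have "\<dots> = jb k - jb k * norm (\<sigma> *\<^sub>R vhat v)" unfolding n by (simp add: algebra_simps)
  also have "\<dots> \<le> jb k - norm k * norm (\<sigma> *\<^sub>R vhat v)"
    using norm_less_jb[of k] by (intro diff_left_mono mult_right_mono) (auto simp: less_imp_le)
  also have "\<dots> \<le> jb k + k \<bullet> (\<sigma> *\<^sub>R vhat v)" using Cauchy_Schwarz_ineq2[of k "\<sigma> *\<^sub>R vhat v"] by linarith
  finally have le: "jb k / (2 * (jb v)\<^sup>2) \<le> jb k + k \<bullet> (\<sigma> *\<^sub>R vhat v)" by simp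
  define d where "d = jb k + k \<bullet> (\<sigma> *\<^sub>R vhat v)"
  have p: "0 < jb k / (2 * (jb v)\<^sup>2)" by simp
  have le: "jb k / (2 * (jb v)\<^sup>2) \<le> d" using le by (simp add: d_def)
  have d0: "0 < d" using p le by (rule less_le_trans)
  have "norm (phi_symbol \<sigma> j v k) = (1 / d) ^ j"
    unfolding phi_symbol_eq[OF assms] d_def[symmetric]
    using less_le_trans[OF p le] by (simp add: norm_mult norm_power norm_sgn_factor[OF assms] norm_divide power_one_over)
  also have "\<dots> \<le> (1 / (jb k / (2 * (jb v)\<^sup>2))) ^ j"
    using le mult_pos_pos[OF d0 p] d0 by (intro power_mono divide_left_mono) auto
  finally show ?thesis by simp
qed

section \<open>Integration on three-dimensional space\<close>

lemma norm_integral_le_AE: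
  fixes f :: "'a \<Rightarrow> 'b::{banach, second_countable_topology}"
  assumes g: "integrable M g" and le: "AE x in M. norm (f x) \<le> g x"
  shows "norm (LINT x|M. f x) \<le> (LINT x|M. g x)"
proof (cases "integrable M f")
  case True
  then show ?thesis
    by (intro order_trans[OF integral_norm_bound] integral_mono_AE) (use g le in auto)
next
  case False
  have "AE x in M. 0 \<le> g x" using le by eventually_elim (use norm_ge_zero order_trans in blast)
  then show ?thesis using False by (simp add: not_integrable_integral_eq integral_nonneg_AE)
qed

lemma
  fixes f :: "'a::euclidean_space \<Rightarrow> real \<Rightarrow> complex"
  assumes f: "\<And>b. b \<in> Basis \<Longrightarrow> integrable lborel (f b)"
  shows integrable_prod_Basis: "integrable lborel (\<lambda>x::'a. \<Prod>b\<in>Basis. f b (x \<bullet> b))"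
    and integral_prod_Basis: "(LINT x|lborel. (\<Prod>b\<in>Basis. f b ((x::'a) \<bullet> b))) = (\<Prod>b\<in>Basis. (LINT x|lborel. f b x))"
proof -
  interpret product_sigma_finite "\<lambda>_::'a. lborel :: real measure" ..
  let ?T = "\<lambda>g::'a \<Rightarrow> real. \<Sum>b\<in>Basis. g b *\<^sub>R b"
  have T [measurable]: "?T \<in> (\<Pi>\<^sub>M b\<in>Basis. lborel) \<rightarrow>\<^sub>M borel" by measurable
  have [measurable]: "f b \<in> borel_measurable borel" if "b \<in> Basis" for b using f[OF that] by auto
  have F: "(\<lambda>x::'a. \<Prod>b\<in>Basis. f b (x \<bullet> b)) \<in> borel_measurable borel" by measurable
  have comp: "(\<Prod>b\<in>Basis. f b (?T g \<bullet> b)) = (\<Prod>b\<in>Basis. f b (g b))" for g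
    by (intro prod.cong refl) simp
  have "integrable (\<Pi>\<^sub>M b\<in>Basis. lborel) (\<lambda>g. \<Prod>b\<in>Basis. f b (g b))"
    by (intro product_integrable_prod f) auto
  then show "integrable lborel (\<lambda>x::'a. \<Prod>b\<in>Basis. f b (x \<bullet> b))"
    by (subst lborel_eq, subst integrable_distr_eq[OF T F]) (simp only: comp)
  have "(LINT x|lborel. (\<Prod>b\<in>Basis. f b ((x::'a) \<bullet> b))) = (LINT g|(\<Pi>\<^sub>M b\<in>Basis. lborel). (\<Prod>b\<in>Basis. f b (g b)))"
    by (subst lborel_eq, subst integral_distr[OF T F]) (simp only: comp)
  also have "\<dots> = (\<Prod>b\<in>Basis. (LINT x|lborel. f b x))"
    by (intro product_integral_prod f) auto
  finally show "(LINT x|lborel. (\<Prod>b\<in>Basis. f b ((x::'a) \<bullet> b))) = (\<Prod>b\<in>Basis. (LINT x|lborel. f b x))" .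
qed

lemma prod_Basis_R3: "(\<Prod>b\<in>(Basis :: R3 set). h b) = (\<Prod>i\<in>UNIV. h (axis i 1))"
proof -
  have eq: "(Basis :: R3 set) = (\<lambda>i. axis i 1) ` UNIV" by (auto simp: Basis_vec_def)
  have inj: "inj (\<lambda>i :: 3. axis i (1::real))" by (auto simp: inj_on_def axis_eq_axis)
  show ?thesis unfolding eq prod.reindex[OF inj] by (simp add: o_def)
qed

lemma
  fixes f :: "3 \<Rightarrow> real \<Rightarrow> complex"
  assumes f: "\<And>i. integrable lborel (f i)"
  shows integrable_prod_R3: "integrable lborel (\<lambda>x::R3. \<Prod>i\<in>UNIV. f i (x $ i))"
    and integral_prod_R3: "(LINT x|lborel. (\<Prod>i\<in>UNIV. f i (x $ i))) = (\<Prod>i\<in>UNIV. (LINT x|lborel. f i x))"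
proof -
  define g where "g b = f (SOME i. b = axis i 1)" for b :: R3
  have g: "g (axis i 1) = f i" for i by (simp add: g_def axis_eq_axis)
  have i: "integrable lborel (g b)" for b by (simp add: g_def f)
  show "integrable lborel (\<lambda>x::R3. \<Prod>i\<in>UNIV. f i (x $ i))"
    using integrable_prod_Basis[of g, OF i] by (simp add: prod_Basis_R3 g inner_axis)
  show "(LINT x|lborel. (\<Prod>i\<in>UNIV. f i (x $ i))) = (\<Prod>i\<in>UNIV. (LINT x|lborel. f i x))"
    using integral_prod_Basis[of g, OF i] by (simp add: prod_Basis_R3 g inner_axis)
qed

lemma prod_3: "(\<Prod>i\<in>(UNIV::3 set). h i) = h 1 * h 2 * h 3"
  unfolding UNIV_3 by (simp add: mult.assoc)

text \<open>The exponent 6 is twice the dimension: the function is dominated by the product of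
\<open>1 / (1 + x\<^sub>i\<^sup>2)\<close> over the three coordinates.\<close>

lemma integrable_inverse_jb6: "integrable lborel (\<lambda>x::R3. 1 / (jb x) ^ 6)"
proof (rule Bochner_Integration.integrable_bound)
  show "integrable lborel (\<lambda>x::R3. \<Prod>i\<in>UNIV. of_real (inverse (1 + (x $ i)\<^sup>2)) :: complex)"
    by (intro integrable_prod_R3 integrable_of_real integrable_inverse_1_plus_square_UNIV)
  show "AE x::R3 in lborel. norm (1 / (jb x) ^ 6) \<le> norm (\<Prod>i\<in>UNIV. of_real (inverse (1 + (x $ i)\<^sup>2)) :: complex)"
  proof (rule AE_I2)
    fix x :: R3
    let ?a = "\<lambda>i. 1 + (x $ i)\<^sup>2"
    have le: "?a i \<le> (jb x)\<^sup>2" and pos: "0 < ?a i" for i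
      using power_mono[OF component_le_norm_cart[of x i], of 2] by (auto simp: jb_sq add_pos_nonneg)
    have "?a 1 * ?a 2 * ?a 3 \<le> (jb x)\<^sup>2 * (jb x)\<^sup>2 * (jb x)\<^sup>2"
      by (intro mult_mono le) auto
    also have "\<dots> = (jb x) ^ 6" by (simp flip: power_add)
    finally have le6: "1 / (jb x) ^ 6 \<le> 1 / (?a 1 * ?a 2 * ?a 3)"
      using mult_pos_pos[OF mult_pos_pos[OF pos[of 1] pos[of 2]] pos[of 3]]
      by (intro divide_left_mono) (auto intro!: mult_pos_pos)
    have n: "norm (of_real (inverse (?a i)) :: complex) = 1 / ?a i" for i
      unfolding norm_of_real using pos[of i] by (simp add: divide_inverse)
    have "norm (1 / (jb x) ^ 6) = 1 / (jb x) ^ 6" by simp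
    then show "norm (1 / (jb x) ^ 6) \<le> norm (\<Prod>i\<in>UNIV. of_real (inverse (?a i)) :: complex)"
      using le6 unfolding prod_3 norm_mult n by simp
  qed
qed measurable

text \<open>The largest of \<open>1, x\<^sub>1\<^sup>2, x\<^sub>2\<^sup>2, x\<^sub>3\<^sup>2\<close> is at least a quarter of \<open>\<langle>x\<rangle>\<^sup>2\<close>. Thus decay in every
coordinate separately gives decay in \<open>x\<close>.\<close>

lemma le_inverse_jb6:
  fixes x :: R3
  assumes "0 \<le> a" "a \<le> C" "\<And>i. \<bar>x $ i\<bar> ^ 6 * a \<le> C"
  shows "a \<le> 64 * C / (jb x) ^ 6"
proof -
  let ?y = "\<lambda>i. (x $ i)\<^sup>2"
  define m where "m = Max {1, ?y 1, ?y 2, ?y 3}"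
  have m: "1 \<le> m" "?y 1 \<le> m" "?y 2 \<le> m" "?y 3 \<le> m" by (auto simp: m_def)
  have "m \<in> {1, ?y 1, ?y 2, ?y 3}" unfolding m_def by (rule Max_in) auto
  moreover have "(?y i) ^ 3 * a \<le> C" for i
  proof -
    have "(?y i) ^ 3 = \<bar>x $ i\<bar> ^ 6" by (simp add: power_even_abs flip: power_mult)
    then show ?thesis using assms(3)[of i] by (simp only:)
  qed
  moreover have "1 ^ 3 * a \<le> C" using assms by simp
  ultimately have "m ^ 3 * a \<le> C" by blast
  have "(jb x)\<^sup>2 \<le> 4 * m" using m by (simp add: jb_sq norm_sq_R3)
  then have "((jb x)\<^sup>2) ^ 3 \<le> (4 * m) ^ 3" by (rule power_mono) simp
  moreover have "((jb x)\<^sup>2) ^ 3 = (jb x) ^ 6" by (simp flip: power_mult)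
  moreover have "(4 * m) ^ 3 = 64 * m ^ 3" by (simp add: power_mult_distrib)
  ultimately have "(jb x) ^ 6 * a \<le> (64 * m ^ 3) * a"
    using assms(1) by (simp only:) (rule mult_right_mono)
  also have "\<dots> \<le> 64 * C" using \<open>m ^ 3 * a \<le> C\<close> by simp
  finally show ?thesis by (simp add: field_simps)
qed

lemma integral_scaling:
  fixes f :: "'a::euclidean_space \<Rightarrow> 'b::{banach, second_countable_topology}"
  assumes [measurable]: "f \<in> borel_measurable borel" and "c \<noteq> 0"
  shows "(LINT x|lborel. f x) = (LINT x|lborel. \<bar>c\<bar> ^ DIM('a) *\<^sub>R f (t + c *\<^sub>R x))"
  by (subst lborel_affine[OF assms(2), of t])
    (subst integral_density, auto simp: integral_distr)

section \<open>The Gauss kernel\<close>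

lemma gaussian_fourier_1D:
  assumes "0 < s"
  shows "has_bochner_integral lborel (\<lambda>z. exp (\<i> * of_real (y * z)) * of_real (exp (- (s * z)\<^sup>2 / 2)))
     (of_real (sqrt (2 * pi) / s * exp (- (y / s)\<^sup>2 / 2)))"
proof -
  let ?f = "\<lambda>z. exp (\<i> * of_real (y / s * z)) * of_real (std_normal_density z)"
  have "integrable lborel ?f"
    by (intro Bochner_Integration.integrable_bound[OF integrable_std_normal_moment_complex[of 0]]) (auto simp: norm_mult)
  then have "has_bochner_integral lborel ?f (of_real (exp (- (y / s)\<^sup>2 / 2)))"
    using gaussian_char[of "y / s"] by (simp add: has_bochner_integral_iff)
  then have "has_bochner_integral lborel (\<lambda>z. ?f (0 + s * z)) (of_real (exp (- (y / s)\<^sup>2 / 2)) /\<^sub>R \<bar>s\<bar>)"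
    using assms by (subst (asm) lborel_has_bochner_integral_real_affine_iff[where c=s and t=0]) auto
  from has_bochner_integral_mult_right[OF this, of "of_real (sqrt (2 * pi))"]
  show ?thesis using assms
    by (simp add: std_normal_density_def scaleR_conv_of_real field_simps)
qed

definition gauss :: "real \<Rightarrow> R3 \<Rightarrow> real" where
  "gauss s k = exp (- (s\<^sup>2 * (norm k)\<^sup>2) / 2)"

text \<open>The normal density with standard deviation \<open>s\<close> in each coordinate.\<close>

definition heat :: "real \<Rightarrow> R3 \<Rightarrow> real" where
  "heat s y = gauss (1 / s) y / (sqrt (2 * pi) * s) ^ 3"

lemma gauss_fourier:
  assumes "0 < s"
  shows "has_bochner_integral lborel (\<lambda>k. wave y k * of_real (gauss s k)) (of_real ((2 * pi) ^ 3 * heat s y))"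
proof -
  let ?f = "\<lambda>i z. exp (\<i> * of_real (y $ i * z)) * of_real (exp (- (s * z)\<^sup>2 / 2)) :: complex"
  have i: "integrable lborel (?f i)" for i
    using gaussian_fourier_1D[OF assms] by (rule integrable.intros)
  have eq: "(\<Prod>i\<in>UNIV. ?f i (k $ i)) = wave y k * of_real (gauss s k)" for k
  proof -
    have "wave y k = (\<Prod>i\<in>UNIV. exp (\<i> * of_real (y $ i * k $ i)))"
      by (simp add: wave_def inner_vec_def exp_sum[symmetric] sum_distrib_left mult_ac)
    moreover have "of_real (gauss s k) = (\<Prod>i\<in>UNIV. of_real (exp (- (s * k $ i)\<^sup>2 / 2)) :: complex)"
      unfolding of_real_prod[symmetric] gauss_def norm_sq_R3
      by (simp add: prod_3 exp_add[symmetric] power2_eq_square field_simps)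
    ultimately show ?thesis by (simp only: prod.distrib)
  qed
  have "(LINT k|lborel. (\<Prod>i\<in>UNIV. ?f i (k $ i))) = (\<Prod>i\<in>UNIV. of_real (sqrt (2 * pi) / s * exp (- (y $ i / s)\<^sup>2 / 2)))"
    unfolding integral_prod_R3[OF i] has_bochner_integral_integral_eq[OF gaussian_fourier_1D[OF assms]] ..
  also have "\<dots> = of_real ((sqrt (2 * pi) / s) ^ 3 * gauss (1 / s) y)"
    unfolding of_real_prod[symmetric] gauss_def norm_sq_R3 prod.distrib
    by (simp add: prod_3 exp_add[symmetric] power2_eq_square power3_eq_cube field_simps add_divide_distrib)
  also have "(sqrt (2 * pi) / s) ^ 3 * gauss (1 / s) y = (2 * pi) ^ 3 * heat s y"
  proof -
    have "(2 * pi) ^ 3 = sqrt (2 * pi) ^ 3 * sqrt (2 * pi) ^ 3"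
      by (simp add: power_mult_distrib[symmetric] real_sqrt_mult[symmetric])
    moreover have "0 < sqrt (2 * pi) ^ 3" by simp
    ultimately show ?thesis
      unfolding heat_def power_divide power_mult_distrib[of "sqrt (2 * pi)"] using assms
      by (simp only: field_simps) simp
  qed
  finally have "(LINT k|lborel. (\<Prod>i\<in>UNIV. ?f i (k $ i))) = of_real ((2 * pi) ^ 3 * heat s y)" .
  moreover have "integrable lborel (\<lambda>k::R3. \<Prod>i\<in>UNIV. ?f i (k $ i))"
    by (rule integrable_prod_R3[OF i])
  ultimately show ?thesis unfolding eq by (simp add: has_bochner_integral_iff)
qed

lemma gauss_bounds: "0 < gauss s k" "gauss s k \<le> 1"
  by (auto simp: gauss_def)

lemma heat_nonneg: "0 < s \<Longrightarrow> 0 \<le> heat s y"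
  by (simp add: heat_def gauss_bounds less_imp_le)

lemma borel_measurable_gauss [measurable]: "gauss s \<in> borel_measurable borel"
  unfolding gauss_def[abs_def] by measurable

lemma borel_measurable_heat [measurable]: "heat s \<in> borel_measurable borel"
  unfolding heat_def[abs_def] by measurable

lemma integrable_gauss: "0 < s \<Longrightarrow> integrable lborel (\<lambda>k. of_real (gauss s k) :: complex)"
  using gauss_fourier[of s 0] by (simp add: wave_def has_bochner_integral_iff)

lemma heat_integral:
  assumes "0 < s" shows "has_bochner_integral lborel (heat s) 1"
proof -
  have "has_bochner_integral lborel (\<lambda>k. of_real (gauss (1 / s) k)) (of_real ((2 * pi) ^ 3 * heat (1 / s) 0) :: complex)"
    using gauss_fourier[of "1 / s" 0] assms by (simp add: wave_def)
  then have "has_bochner_integral lborel (gauss (1 / s)) ((2 * pi) ^ 3 * heat (1 / s) 0)"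
    by (simp add: has_bochner_integral_iff complex_of_real_integrable_eq del: of_real_mult of_real_power)
  from has_bochner_integral_divide_zero[OF this, of "(sqrt (2 * pi) * s) ^ 3"]
  have "has_bochner_integral lborel (heat s) ((2 * pi) ^ 3 * heat (1 / s) 0 / (sqrt (2 * pi) * s) ^ 3)"
    by (simp add: heat_def[abs_def])
  moreover have "(2 * pi) ^ 3 * heat (1 / s) 0 / (sqrt (2 * pi) * s) ^ 3 = 1"
  proof -
    have "(2 * pi) ^ 3 = sqrt (2 * pi) ^ 3 * sqrt (2 * pi) ^ 3"
      by (simp add: power_mult_distrib[symmetric] real_sqrt_mult[symmetric])
    then show ?thesis using assms by (simp add: heat_def gauss_def power_divide power_mult_distrib)
  qed
  ultimately show ?thesis by (simp only:)
qed

lemma tendsto_gauss: "((\<lambda>n. gauss (1 / real (Suc n)) k) \<longlongrightarrow> 1) sequentially"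
proof -
  have "(\<lambda>n. exp (- ((1 / real (Suc n))\<^sup>2 * (norm k)\<^sup>2) / 2)) \<longlonglongrightarrow> exp (- (0\<^sup>2 * (norm k)\<^sup>2) / 2)"
    by (intro tendsto_intros LIMSEQ_Suc[OF lim_1_over_n]) simp
  then show ?thesis by (simp add: gauss_def)
qed

lemma heat_scaling:
  assumes "0 < s" shows "s ^ 3 * heat s (s *\<^sub>R p) = heat 1 p"
  using assms by (simp add: heat_def gauss_def power_mult_distrib power_divide)

lemma heat_approximates_identity:
  fixes f :: "R3 \<Rightarrow> complex"
  assumes f: "continuous_on UNIV f" and M: "\<And>x. norm (f x) \<le> M"
  shows "(\<lambda>n. LINT x|lborel. of_real (heat (1 / real (Suc n)) (y - x)) * f x) \<longlonglongrightarrow> f y"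
proof -
  have [measurable]: "f \<in> borel_measurable borel" using f by (rule borel_measurable_continuous_onI)
  have eq: "(LINT x|lborel. of_real (heat s (y - x)) * f x) = (LINT p|lborel. of_real (heat 1 p) * f (y - s *\<^sub>R p))"
    if s: "0 < s" for s
  proof -
    have "(LINT x|lborel. of_real (heat s (y - x)) * f x)
       = (LINT p|lborel. \<bar>- s\<bar> ^ DIM(R3) *\<^sub>R (of_real (heat s (y - (y + (- s) *\<^sub>R p))) * f (y + (- s) *\<^sub>R p)))"
      by (rule integral_scaling[where f="\<lambda>x. of_real (heat s (y - x)) * f x"]) (use s in auto)
    also have "\<dots> = (LINT p|lborel. of_real (heat 1 p) * f (y - s *\<^sub>R p))"
      using s by (intro Bochner_Integration.integral_cong refl)
        (simp add: heat_scaling[OF s, symmetric] scaleR_conv_of_real)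
    finally show ?thesis .
  qed
  have h1: "integrable lborel (heat 1)" "(LINT p|lborel. heat 1 p) = 1"
    using heat_integral[of 1] by (auto simp: has_bochner_integral_iff)
  have "(\<lambda>n. LINT p|lborel. of_real (heat 1 p) * f (y - (1 / real (Suc n)) *\<^sub>R p))
     \<longlonglongrightarrow> (LINT p|lborel. of_real (heat 1 p) * f y)"
  proof (rule integral_dominated_convergence)
    show "integrable lborel (\<lambda>p. heat 1 p * M)" using h1 by simp
    show "AE p in lborel. (\<lambda>n. of_real (heat 1 p) * f (y - (1 / real (Suc n)) *\<^sub>R p)) \<longlonglongrightarrow> of_real (heat 1 p) * f y"
    proof (rule AE_I2)
      fix p
      have "(\<lambda>n. y - (1 / real (Suc n)) *\<^sub>R p) \<longlonglongrightarrow> y - 0 *\<^sub>R p"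
        by (intro tendsto_intros LIMSEQ_Suc[OF lim_1_over_n])
      then have "(\<lambda>n. f (y - (1 / real (Suc n)) *\<^sub>R p)) \<longlonglongrightarrow> f (y - 0 *\<^sub>R p)"
        using f by (intro continuous_on_tendsto_compose[of UNIV f]) auto
      then show "(\<lambda>n. of_real (heat 1 p) * f (y - (1 / real (Suc n)) *\<^sub>R p)) \<longlonglongrightarrow> of_real (heat 1 p) * f y"
        by (intro tendsto_intros) simp
    qed
    show "AE p in lborel. norm (of_real (heat 1 p) * f (y - (1 / real (Suc n)) *\<^sub>R p)) \<le> heat 1 p * M" for n
      using M heat_nonneg[of 1] by (intro AE_I2) (simp add: norm_mult mult_left_mono)
  qed measurable
  moreover have "(LINT p|lborel. of_real (heat 1 p) * f y) = f y"
    using h1 by (simp add: complex_of_real_integrable_eq)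
  ultimately show ?thesis by (simp only: eq of_nat_0_less_iff zero_less_Suc zero_less_divide_1_iff)
qed

section \<open>Fourier transforms of integrable functions\<close>

lemma integrable_vscale_pair:
  fixes f :: "R3 \<Rightarrow> complex" and g :: "R3 \<Rightarrow> C3"
  assumes f: "integrable lborel f" and g: "integrable lborel g"
    and m [measurable]: "(\<lambda>(x,y). m x y) \<in> borel_measurable (borel \<Otimes>\<^sub>M borel)" and m1: "\<And>x y. norm (m x y) = 1"
  shows "integrable (lborel \<Otimes>\<^sub>M lborel) (\<lambda>(x,y). (m x y * f x) *s g y)"
proof (rule lborel_pair.Fubini_integrable)
  have [measurable]: "f \<in> borel_measurable borel" "g \<in> borel_measurable borel" using f g by auto
  show "(\<lambda>(x, y). (m x y * f x) *s g y) \<in> borel_measurable (lborel \<Otimes>\<^sub>M lborel)" by measurable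
  have "(\<lambda>x. LINT y|lborel. norm ((m x y * f x) *s g y)) = (\<lambda>x. norm (f x) * (LINT y|lborel. norm (g y)))"
    by (simp add: norm_complex_vscale norm_mult m1)
  then show "integrable lborel (\<lambda>x. LINT y|lborel. norm (case (x, y) of (x, y) \<Rightarrow> (m x y * f x) *s g y))"
    using f by simp
  have "(\<lambda>y. m x y) \<in> borel_measurable lborel" for x by measurable
  then show "AE x in lborel. integrable lborel (\<lambda>y. case (x, y) of (x, y) \<Rightarrow> (m x y * f x) *s g y)"
    by (intro AE_I2) (auto intro!: integrable_vscale_bounded[OF g, where B="norm (f _)"] simp: norm_mult m1)
qed

lemma of_real_vscale: "of_real r *s (u :: C3) = r *\<^sub>R u"
  by (simp add: vec_eq_iff scaleR_conv_of_real[where 'a=complex, symmetric])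

definition ft :: "(R3 \<Rightarrow> C3) \<Rightarrow> R3 \<Rightarrow> C3" where
  "ft u k = (LINT x|lborel. wave (- x) k *s u x)"

lemma wave_swap: "wave x k = wave k x"
  by (simp add: wave_def inner_commute)

lemma wave_0 [simp]: "wave x 0 = 1"
  by (simp add: wave_def)

lemma integrable_wave_vscale: "integrable lborel u \<Longrightarrow> integrable lborel (\<lambda>x. wave (f x) (g x) *s (u x :: C3))"
  if [measurable]: "f \<in> borel_measurable borel" "g \<in> borel_measurable borel"
  by (rule integrable_vscale_bounded[where B=1]) auto

lemma borel_measurable_ft [measurable]:
  assumes "integrable lborel u" shows "ft u \<in> borel_measurable borel"
proof -
  have [measurable]: "u \<in> borel_measurable borel" using assms by auto
  show ?thesis unfolding ft_def[abs_def] by measurable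
qed

lemma norm_ft_le:
  assumes "integrable lborel u" shows "norm (ft u k) \<le> (LINT x|lborel. norm (u x))"
  unfolding ft_def
  by (rule order_trans[OF integral_norm_bound]) (simp add: norm_complex_vscale)

text \<open>Inversion with a Gaussian cutoff of the frequencies: the result is the average of \<open>u\<close> against the
Gauss kernel. Without the cutoff \<open>ft u\<close> need not be integrable.\<close>

lemma ft_gauss_inverse:
  fixes u :: "R3 \<Rightarrow> C3"
  assumes u: "integrable lborel u" and s: "0 < s"
  shows "(LINT k|lborel. (wave y k * of_real (gauss s k)) *s ft u k)
    = ((2 * pi) ^ 3) *\<^sub>R (LINT x|lborel. heat s (y - x) *\<^sub>R u x)"
proof -
  let ?f = "\<lambda>k x. (wave (y - x) k * of_real (gauss s k)) *s u x"
  have w: "wave y k * wave (- x) k = wave (y - x) k" for x k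
    using wave_add[of y "- x" k] by simp
  have "(LINT k|lborel. (wave y k * of_real (gauss s k)) *s ft u k) = (LINT k|lborel. LINT x|lborel. ?f k x)"
  proof (intro Bochner_Integration.integral_cong refl)
    fix k
    have "(LINT x|lborel. (wave y k * of_real (gauss s k)) *s (wave (- x) k *s u x)) = (wave y k * of_real (gauss s k)) *s ft u k"
      unfolding ft_def by (intro integral_vscale_right integrable_wave_vscale u) auto
    moreover have "(wave y k * of_real (gauss s k)) *s (wave (- x) k *s u x) = ?f k x" for x
      by (simp add: w[symmetric] mult_ac)
    ultimately show "(wave y k * of_real (gauss s k)) *s ft u k = (LINT x|lborel. ?f k x)" by (simp only:)
  qed
  also have "\<dots> = (LINT x|lborel. LINT k|lborel. ?f k x)"
    by (rule lborel_pair.Fubini_integral[symmetric], rule integrable_vscale_pair[OF integrable_gauss[OF s] u]) auto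
  also have "\<dots> = (LINT x|lborel. ((2 * pi) ^ 3) *\<^sub>R (heat s (y - x) *\<^sub>R u x))"
  proof (intro Bochner_Integration.integral_cong refl)
    fix x
    have "(LINT k|lborel. ?f k x) = of_real ((2 * pi) ^ 3 * heat s (y - x)) *s u x"
      using gauss_fourier[OF s, of "y - x"] by (subst integral_vscale_left) (auto simp: has_bochner_integral_iff)
    then show "(LINT k|lborel. ?f k x) = ((2 * pi) ^ 3) *\<^sub>R (heat s (y - x) *\<^sub>R u x)"
      unfolding of_real_vscale by simp
  qed
  also have "\<dots> = ((2 * pi) ^ 3) *\<^sub>R (LINT x|lborel. heat s (y - x) *\<^sub>R u x)"
    by (rule Bochner_Integration.integral_scaleR_right)
  finally show ?thesis .
qed

lemma norm_ft_gauss_inverse_le: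
  assumes u: "integrable lborel u" and M: "AE x in lborel. norm (u x) \<le> M" and s: "0 < s"
  shows "norm (LINT k|lborel. wave y k *s (of_real (gauss s k) *s ft u k)) \<le> (2 * pi) ^ 3 * M"
proof -
  have [measurable]: "u \<in> borel_measurable borel" using u by auto
  have h: "integrable lborel (\<lambda>x. heat s (y - x))" "(LINT x|lborel. heat s (y - x)) = 1"
  proof -
    have sym: "heat s (y - x) = heat s (x + - y)" for x
      by (simp add: heat_def gauss_def norm_minus_commute)
    show "integrable lborel (\<lambda>x. heat s (y - x))" "(LINT x|lborel. heat s (y - x)) = 1"
      unfolding sym using heat_integral[OF s] integrable_translation[of "heat s" "- y"] integral_translation[of "heat s" "- y"]
      by (auto simp only: has_bochner_integral_iff borel_measurable_heat)
  qed
  have "norm (LINT x|lborel. heat s (y - x) *\<^sub>R u x) \<le> (LINT x|lborel. heat s (y - x) * M)"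
  proof (rule norm_integral_le_AE)
    show "AE x in lborel. norm (heat s (y - x) *\<^sub>R u x) \<le> heat s (y - x) * M"
      using M by eventually_elim (simp add: heat_nonneg[OF s] mult_left_mono)
    show "integrable lborel (\<lambda>x. heat s (y - x) * M)" using h by simp
  qed
  also have "\<dots> = M" using h by simp
  finally show ?thesis
    using ft_gauss_inverse[OF u s, of y] by (simp add: mult_left_mono)
qed

section \<open>Schwartz functions\<close>

lemma wave_minus_swap: "wave (- x) k = wave (- k) x"
  by (simp add: wave_def inner_commute)

lemma mpd_single: "mpd (\<lambda>j. if j = i then n else 0) u = (pd i ^^ n) u"
  using exhaust_3[of i] by (auto simp: mpd_def)

lemma has_vector_derivative_axis_line:
  fixes f :: "R3 \<Rightarrow> 'b::real_normed_vector"
  assumes "f differentiable (at x)"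
  shows "((\<lambda>t. f (x + t *\<^sub>R axis i 1)) has_vector_derivative pd i f x) (at 0)"
proof -
  let ?D = "frechet_derivative f (at x)"
  have D: "(f has_derivative ?D) (at x)" using assms by (simp add: frechet_derivative_works)
  have "((\<lambda>t. x + t *\<^sub>R axis i 1) has_derivative (\<lambda>t. t *\<^sub>R axis i 1)) (at (0::real))"
    by (auto intro!: derivative_eq_intros)
  moreover have "(f has_derivative ?D) (at (x + 0 *\<^sub>R axis i 1))" using D by simp
  ultimately have "((\<lambda>t. f (x + t *\<^sub>R axis i 1)) has_derivative (\<lambda>t. ?D (t *\<^sub>R axis i 1))) (at 0)"
    using has_derivative_compose by blast
  moreover have "?D (t *\<^sub>R axis i 1) = t *\<^sub>R pd i f x" for t
    using has_derivative_bounded_linear[OF D] by (simp add: pd_def linear_simps)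
  ultimately show ?thesis by (simp add: has_vector_derivative_def)
qed

lemma differentiable_borel_measurable:
  fixes f :: "R3 \<Rightarrow> 'b::real_normed_vector"
  assumes "\<And>x. f differentiable (at x)"
  shows "continuous_on UNIV f" "f \<in> borel_measurable borel"
proof -
  show c: "continuous_on UNIV f"
    using assms by (auto simp: continuous_on_eq_continuous_at differentiable_imp_continuous_within)
  show "f \<in> borel_measurable borel" using c by (rule borel_measurable_continuous_onI)
qed

lemma smooth_pd: "smooth u \<Longrightarrow> (pd i ^^ n) u differentiable (at x)"
  unfolding smooth_def by (metis mpd_single)

lemma schwartz_pd_bound:
  assumes "schwartz \<psi>"
  obtains C where "0 \<le> C" "\<And>x. norm ((pd i ^^ n) \<psi> x) \<le> C / jb x ^ 6"
proof -
  have "bounded (range (\<lambda>x. jb x ^ 6 *\<^sub>R mpd (\<lambda>j. if j = i then n else 0) \<psi> x))"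
    using assms unfolding schwartz_def by blast
  then obtain C where C: "\<And>x. norm (jb x ^ 6 *\<^sub>R (pd i ^^ n) \<psi> x) \<le> C"
    unfolding mpd_single by (auto simp: bounded_iff)
  then have "norm ((pd i ^^ n) \<psi> x) \<le> C / jb x ^ 6" for x
    using C[of x] by (simp add: field_simps abs_of_pos)
  moreover have "0 \<le> C" using C[of 0] norm_ge_zero order_trans by blast
  ultimately show ?thesis using that by blast
qed

lemma schwartz_pd_integrable:
  assumes "schwartz \<psi>" shows "integrable lborel ((pd i ^^ n) \<psi>)"
proof -
  obtain C where C: "0 \<le> C" "\<And>x. norm ((pd i ^^ n) \<psi> x) \<le> C / jb x ^ 6"
    using schwartz_pd_bound[OF assms] by blast
  have "smooth \<psi>" using assms by (simp add: schwartz_def)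
  then have "(pd i ^^ n) \<psi> \<in> borel_measurable borel" by (intro differentiable_borel_measurable smooth_pd)
  moreover have "integrable lborel (\<lambda>x::R3. C * (1 / jb x ^ 6))" by (intro integrable_mult_right integrable_inverse_jb6)
  moreover have "norm ((pd i ^^ n) \<psi> x) \<le> norm (C * (1 / jb x ^ 6))" for x
    using C(2)[of x] C(1) by simp
  ultimately show ?thesis
    by (rule_tac Bochner_Integration.integrable_bound[of lborel "\<lambda>x::R3. C * (1 / jb x ^ 6)"]) simp_all
qed

lemma schwartz_integrable: "schwartz \<psi> \<Longrightarrow> integrable lborel \<psi>"
  and schwartz_continuous: "schwartz \<psi> \<Longrightarrow> continuous_on UNIV \<psi>"
  using schwartz_pd_integrable[where n=0] smooth_pd[where n=0]
  by (auto intro!: differentiable_borel_measurable simp: schwartz_def)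

lemma schwartz_bounded:
  assumes "schwartz \<psi>" obtains M where "0 \<le> M" "\<And>x. norm (\<psi> x) \<le> M"
proof -
  obtain C where C: "0 \<le> C" "\<And>x. norm ((pd 1 ^^ 0) \<psi> x) \<le> C / jb x ^ 6"
    using schwartz_pd_bound[OF assms] by blast
  have "C / jb x ^ 6 \<le> C / 1" for x :: R3 using C by (intro divide_left_mono) auto
  then show ?thesis using that[of C] C by (auto intro: order_trans)
qed

lemma fourier_integral_wave: "fourier_integral \<psi> x = (LINT k|lborel. wave (- x) k * \<psi> k)"
  by (simp add: fourier_integral_def wave_def)

lemma fourier_integral_pd:
  assumes d: "\<And>x. \<psi> differentiable (at x)" and "integrable lborel \<psi>" "integrable lborel (pd i \<psi>)"
  shows "fourier_integral (pd i \<psi>) x = \<i> * of_real (x $ i) * fourier_integral \<psi> x"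
proof -
  let ?u = "\<lambda>k. wave (- x) k * \<psi> k"
  let ?u' = "\<lambda>k. wave (- x) k * pd i \<psi> k - \<i> * of_real (x $ i) * (wave (- x) k * \<psi> k)"
  have D: "((\<lambda>t. ?u (k + t *\<^sub>R axis i 1)) has_vector_derivative ?u' k) (at 0)" for k
  proof -
    have "((\<lambda>t. exp (- \<i> * of_real (k \<bullet> x) - \<i> * of_real (x $ i) * of_real t)) has_vector_derivative
       exp (- \<i> * of_real (k \<bullet> x)) * (- \<i> * of_real (x $ i))) (at 0)"
      by (auto intro!: derivative_eq_intros has_vector_derivative_real_field)
    moreover have "exp (- \<i> * of_real (k \<bullet> x) - \<i> * of_real (x $ i) * of_real t) = wave (- x) (k + t *\<^sub>R axis i 1)" for t
      by (simp add: wave_def inner_add_left inner_commute[of _ x] inner_axis algebra_simps)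
    ultimately have w: "((\<lambda>t. wave (- x) (k + t *\<^sub>R axis i 1)) has_vector_derivative
       wave (- x) k * (- \<i> * of_real (x $ i))) (at 0)"
      by (simp add: wave_def)
    have "((\<lambda>t. ?u (k + t *\<^sub>R axis i 1)) has_vector_derivative
       (wave (- x) (k + 0 *\<^sub>R axis i 1) * pd i \<psi> k + (wave (- x) k * (- \<i> * of_real (x $ i))) * \<psi> (k + 0 *\<^sub>R axis i 1))) (at 0)"
      by (intro has_vector_derivative_mult w has_vector_derivative_axis_line d)
    then show ?thesis by (simp add: algebra_simps)
  qed
  have i1: "integrable lborel (\<lambda>k. wave (- x) k * \<psi> k)" "integrable lborel (\<lambda>k. wave (- x) k * pd i \<psi> k)"
    by (rule Bochner_Integration.integrable_bound[OF assms(2)], use assms in \<open>auto simp: norm_mult\<close>)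
      (rule Bochner_Integration.integrable_bound[OF assms(3)], use assms in \<open>auto simp: norm_mult\<close>)
  have i2: "integrable lborel (\<lambda>k. \<i> * of_real (x $ i) * (wave (- x) k * \<psi> k))" using i1 by (intro integrable_mult_right)
  from integral_directional_derivative_eq_0[OF D i1(1) Bochner_Integration.integrable_diff[OF i1(2) i2]]
  have "(LINT k|lborel. wave (- x) k * pd i \<psi> k) = (LINT k|lborel. \<i> * of_real (x $ i) * (wave (- x) k * \<psi> k))"
    unfolding Bochner_Integration.integral_diff[OF i1(2) i2] by simp
  then show ?thesis unfolding fourier_integral_wave by simp
qed

lemma fourier_integral_pd_power:
  assumes "schwartz \<psi>"
  shows "fourier_integral ((pd i ^^ n) \<psi>) x = (\<i> * of_real (x $ i)) ^ n * fourier_integral \<psi> x"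
proof (induction n)
  case (Suc n)
  have s: "smooth \<psi>" using assms by (simp add: schwartz_def)
  have "fourier_integral ((pd i ^^ Suc n) \<psi>) x = fourier_integral (pd i ((pd i ^^ n) \<psi>)) x" by simp
  also have "\<dots> = \<i> * of_real (x $ i) * fourier_integral ((pd i ^^ n) \<psi>) x"
    using schwartz_pd_integrable[OF assms, where i=i and n=n] schwartz_pd_integrable[OF assms, where i=i and n="Suc n"]
    by (intro fourier_integral_pd smooth_pd[OF s]) auto
  finally show ?case using Suc by simp
qed simp

lemma norm_fourier_integral_le: "norm (fourier_integral \<psi> x) \<le> (LINT k|lborel. norm (\<psi> k))"
  unfolding fourier_integral_wave
  by (rule order_trans[OF integral_norm_bound]) (simp add: norm_mult)

lemma borel_measurable_fourier_integral:
  assumes [measurable]: "\<psi> \<in> borel_measurable borel" shows "fourier_integral \<psi> \<in> borel_measurable borel"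
  unfolding fourier_integral_wave[abs_def] by measurable

text \<open>Six derivatives in each coordinate direction give decay of the transform like \<open>\<langle>x\<rangle>\<^sup>-\<^sup>6\<close>.\<close>

lemma schwartz_fourier_integrable:
  assumes "schwartz \<psi>" shows "integrable lborel (fourier_integral \<psi>)"
proof -
  define C where "C = (LINT k|lborel. norm (\<psi> k)) + (\<Sum>i\<in>UNIV. LINT k|lborel. norm ((pd i ^^ 6) \<psi> k))"
  have nn: "0 \<le> (LINT k|lborel. norm ((pd i ^^ 6) \<psi> k))" for i by simp
  have "norm (fourier_integral \<psi> x) \<le> 64 * C / jb x ^ 6" for x
  proof (rule le_inverse_jb6)
    show "norm (fourier_integral \<psi> x) \<le> C"
      unfolding C_def using norm_fourier_integral_le[of \<psi> x] nn by (intro add_increasing2 sum_nonneg) auto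
    fix i
    have "\<bar>x $ i\<bar> ^ 6 * norm (fourier_integral \<psi> x) = norm (fourier_integral ((pd i ^^ 6) \<psi>) x)"
      unfolding fourier_integral_pd_power[OF assms] by (simp add: norm_mult norm_power power_abs)
    also have "\<dots> \<le> (LINT k|lborel. norm ((pd i ^^ 6) \<psi> k))" by (rule norm_fourier_integral_le)
    also have "\<dots> \<le> (\<Sum>i\<in>UNIV. LINT k|lborel. norm ((pd i ^^ 6) \<psi> k))"
      by (rule member_le_sum) (use nn in auto)
    also have "\<dots> \<le> C" by (simp add: C_def)
    finally show "\<bar>x $ i\<bar> ^ 6 * norm (fourier_integral \<psi> x) \<le> C" .
  qed simp
  then have "norm (fourier_integral \<psi> x) \<le> norm (64 * C * (1 / jb x ^ 6))" for x
    by (rule order_trans) (simp add: divide_right_mono)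
  moreover have "integrable lborel (\<lambda>x::R3. 64 * C * (1 / jb x ^ 6))" by (intro integrable_mult_right integrable_inverse_jb6)
  moreover have "fourier_integral \<psi> \<in> borel_measurable borel"
    using schwartz_integrable[OF assms] by (intro borel_measurable_fourier_integral) auto
  ultimately show ?thesis
    by (rule_tac Bochner_Integration.integrable_bound[of lborel "\<lambda>x::R3. 64 * C * (1 / jb x ^ 6)"]) simp_all
qed

lemma schwartz_fourier_inversion:
  assumes \<psi>: "schwartz \<psi>"
  shows "(LINT x|lborel. wave y x * fourier_integral \<psi> x) = of_real ((2 * pi) ^ 3) * \<psi> y"
proof -
  \<comment> \<open>The regularised inversion formula is available for vector fields; the scalar function
    is placed in the first component.\<close>
  let ?e = "axis 1 1 :: C3"
  let ?u = "\<lambda>k. \<psi> k *s ?e"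
  have [measurable]: "\<psi> \<in> borel_measurable borel" "fourier_integral \<psi> \<in> borel_measurable borel"
    using schwartz_integrable[OF \<psi>] schwartz_fourier_integrable[OF \<psi>] by auto
  obtain M where M: "\<And>x. norm (\<psi> x) \<le> M" using schwartz_bounded[OF \<psi>] by blast
  have u: "integrable lborel ?u"
    by (rule integrable_bounded_linear[OF bounded_bilinear.bounded_linear_left[OF bounded_bilinear_vscale] schwartz_integrable[OF \<psi>]])
  have wi: "integrable lborel (\<lambda>k. wave (- x) k * \<psi> k)" for x
    using schwartz_integrable[OF \<psi>] by (rule Bochner_Integration.integrable_bound) (auto simp: norm_mult)
  have ftu: "ft ?u x = fourier_integral \<psi> x *s ?e" for x
    unfolding ft_def fourier_integral_wave integral_vscale_left[OF wi, symmetric]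
    by (simp add: wave_minus_swap[of _ x])
  have eq: "(LINT x|lborel. wave y x * of_real (gauss s x) * fourier_integral \<psi> x)
     = of_real ((2 * pi) ^ 3) * (LINT x|lborel. of_real (heat s (y - x)) * \<psi> x)" if s: "0 < s" for s
  proof -
    have 1: "integrable lborel (\<lambda>x. wave y x * of_real (gauss s x) * fourier_integral \<psi> x)"
      using schwartz_fourier_integrable[OF \<psi>] gauss_bounds[of s]
      by (rule_tac Bochner_Integration.integrable_bound) (auto simp: norm_mult mult_left_le_one_le less_imp_le)
    have 2: "integrable lborel (\<lambda>x. of_real (heat s (y - x)) * \<psi> x)"
    proof (rule Bochner_Integration.integrable_bound)
      have "integrable lborel (\<lambda>x. heat s (x + - y))"
        by (rule integrable_translation) (use heat_integral[OF s] in \<open>simp add: has_bochner_integral_iff\<close>)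
      moreover have "heat s (x + - y) = heat s (y - x)" for x by (simp add: heat_def gauss_def norm_minus_commute)
      ultimately show "integrable lborel (\<lambda>x. heat s (y - x) * M)" by simp
      show "AE x in lborel. norm (of_real (heat s (y - x)) * \<psi> x) \<le> norm (heat s (y - x) * M)"
        using M heat_nonneg[OF s] order_trans[OF norm_ge_zero M]
        by (intro AE_I2) (auto simp: norm_mult abs_mult intro!: mult_left_mono order_trans[OF M])
    qed measurable
    have "(LINT x|lborel. wave y x * of_real (gauss s x) * fourier_integral \<psi> x) *s ?e
        = (LINT x|lborel. (wave y x * of_real (gauss s x)) *s ft ?u x)"
      unfolding integral_vscale_left[OF 1, symmetric] ftu by simp
    also have "\<dots> = (2 * pi) ^ 3 *\<^sub>R (LINT x|lborel. heat s (y - x) *\<^sub>R ?u x)"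
      by (rule ft_gauss_inverse[OF u s])
    also have "\<dots> = (of_real ((2 * pi) ^ 3) * (LINT x|lborel. of_real (heat s (y - x)) * \<psi> x)) *s ?e"
      unfolding of_real_vscale[symmetric] vector_smult_assoc integral_vscale_left[OF 2] ..
    finally have "((LINT x|lborel. wave y x * of_real (gauss s x) * fourier_integral \<psi> x) *s ?e) $ 1
      = ((of_real ((2 * pi) ^ 3) * (LINT x|lborel. of_real (heat s (y - x)) * \<psi> x)) *s ?e) $ 1" by (rule arg_cong)
    then show ?thesis by (simp add: axis_def)
  qed
  have "(\<lambda>n. LINT x|lborel. wave y x * of_real (gauss (1 / real (Suc n)) x) * fourier_integral \<psi> x)
     \<longlonglongrightarrow> (LINT x|lborel. wave y x * fourier_integral \<psi> x)"
  proof (rule integral_dominated_convergence)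
    show "integrable lborel (\<lambda>x. norm (fourier_integral \<psi> x))" using schwartz_fourier_integrable[OF \<psi>] by simp
    show "AE x in lborel. (\<lambda>n. wave y x * of_real (gauss (1 / real (Suc n)) x) * fourier_integral \<psi> x)
       \<longlonglongrightarrow> wave y x * fourier_integral \<psi> x"
    proof (rule AE_I2)
      fix x
      have "(\<lambda>n. wave y x * of_real (gauss (1 / real (Suc n)) x) * fourier_integral \<psi> x)
         \<longlonglongrightarrow> wave y x * of_real 1 * fourier_integral \<psi> x"
        by (intro tendsto_intros tendsto_gauss)
      then show "(\<lambda>n. wave y x * of_real (gauss (1 / real (Suc n)) x) * fourier_integral \<psi> x)
         \<longlonglongrightarrow> wave y x * fourier_integral \<psi> x" by simp
    qed
    show "AE x in lborel. norm (wave y x * of_real (gauss (1 / real (Suc n)) x) * fourier_integral \<psi> x) \<le> norm (fourier_integral \<psi> x)" for n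
      using gauss_bounds by (intro AE_I2) (auto simp: norm_mult mult_left_le_one_le less_imp_le)
  qed measurable
  moreover have "(\<lambda>n. of_real ((2 * pi) ^ 3) * (LINT x|lborel. of_real (heat (1 / real (Suc n)) (y - x)) * \<psi> x))
     \<longlonglongrightarrow> of_real ((2 * pi) ^ 3) * \<psi> y"
    by (intro tendsto_mult tendsto_const heat_approximates_identity[OF schwartz_continuous[OF \<psi>] M])
  ultimately show ?thesis
    unfolding eq[OF zero_less_divide_1_iff[THEN iffD2, OF of_nat_0_less_iff[THEN iffD2, OF zero_less_Suc]]]
    by (rule LIMSEQ_unique)
qed

section \<open>Fourier transforms of tempered distributions\<close>

lemma integrable_vscale_bounded_right:
  fixes u :: "'a \<Rightarrow> C3" and m :: "'a \<Rightarrow> complex"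
  assumes "integrable M m" and [measurable]: "u \<in> borel_measurable M" and "\<And>x. norm (u x) \<le> B"
  shows "integrable M (\<lambda>x. m x *s u x)"
proof (rule Bochner_Integration.integrable_bound)
  show "integrable M (\<lambda>x. B * norm (m x))" using assms by simp
  show "AE x in M. norm (m x *s u x) \<le> norm (B * norm (m x))"
  proof (rule AE_I2)
    fix x
    have "norm (m x) * norm (u x) \<le> norm (m x) * B" by (intro mult_left_mono assms) auto
    then show "norm (m x *s u x) \<le> norm (B * norm (m x))"
      using order_trans[OF norm_ge_zero assms(3)] by (simp add: norm_complex_vscale abs_mult mult.commute)
  qed
  have [measurable]: "m \<in> borel_measurable M" using assms by auto
  show "(\<lambda>x. m x *s u x) \<in> borel_measurable M" by measurable
qed

lemma has_fourier_transform_ft: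
  assumes u: "integrable lborel u"
  shows "has_fourier_transform u (ft u)"
  unfolding has_fourier_transform_def
proof (intro allI impI conjI)
  fix \<psi> assume \<psi>: "schwartz \<psi>"
  note [measurable] = borel_measurable_ft[OF u]
  have [measurable]: "\<psi> \<in> borel_measurable borel" using schwartz_integrable[OF \<psi>] by auto
  show "integrable lborel (\<lambda>x. fourier_integral \<psi> x *s u x)"
    by (rule integrable_vscale_bounded[OF u _ norm_fourier_integral_le]) (use borel_measurable_fourier_integral in auto)
  show "integrable lborel (\<lambda>k. \<psi> k *s ft u k)"
    by (rule integrable_vscale_bounded_right[OF schwartz_integrable[OF \<psi>] _ norm_ft_le[OF u]]) simp
  let ?f = "\<lambda>k x. (wave (- x) k * \<psi> k) *s u x"
  have wi: "integrable lborel (\<lambda>k. wave (- x) k * \<psi> k)" for x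
    using schwartz_integrable[OF \<psi>] by (rule Bochner_Integration.integrable_bound) (auto simp: norm_mult)
  have "(LINT x|lborel. fourier_integral \<psi> x *s u x) = (LINT x|lborel. LINT k|lborel. ?f k x)"
    unfolding fourier_integral_wave integral_vscale_left[OF wi] ..
  also have "\<dots> = (LINT k|lborel. LINT x|lborel. ?f k x)"
    by (rule lborel_pair.Fubini_integral, rule integrable_vscale_pair[OF schwartz_integrable[OF \<psi>] u]) auto
  also have "\<dots> = (LINT k|lborel. \<psi> k *s ft u k)"
  proof (intro Bochner_Integration.integral_cong refl)
    fix k
    have "(LINT x|lborel. \<psi> k *s (wave (- x) k *s u x)) = \<psi> k *s ft u k"
      unfolding ft_def by (intro integral_vscale_right integrable_wave_vscale u) auto
    then show "(LINT x|lborel. ?f k x) = \<psi> k *s ft u k" by (simp add: mult.commute)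
  qed
  finally show "(LINT x|lborel. fourier_integral \<psi> x *s u x) = (LINT k|lborel. \<psi> k *s ft u k)" .
qed

text \<open>The counterpart of the preceding lemma: after Fubini's theorem a Schwartz function is transformed
twice, which is the inversion formula.\<close>

lemma has_fourier_transform_inverse:
  assumes G: "integrable lborel G"
  shows "has_fourier_transform (\<lambda>x. LINT k|lborel. wave x k *s G k) (\<lambda>k. (2 * pi) ^ 3 *\<^sub>R G k)"
  unfolding has_fourier_transform_def
proof (intro allI impI conjI)
  fix \<psi> assume \<psi>: "schwartz \<psi>"
  have [measurable]: "\<psi> \<in> borel_measurable borel" "G \<in> borel_measurable borel" "fourier_integral \<psi> \<in> borel_measurable borel"
    using schwartz_integrable[OF \<psi>] schwartz_fourier_integrable[OF \<psi>] G by auto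
  obtain M where M: "\<And>x. norm (\<psi> x) \<le> M" using schwartz_bounded[OF \<psi>] by blast
  have b: "norm (LINT k|lborel. wave x k *s G k) \<le> (LINT k|lborel. norm (G k))" for x
    by (rule order_trans[OF integral_norm_bound]) (simp add: norm_complex_vscale)
  show "integrable lborel (\<lambda>x. fourier_integral \<psi> x *s (LINT k|lborel. wave x k *s G k))"
    by (rule integrable_vscale_bounded_right[OF schwartz_fourier_integrable[OF \<psi>] _ b]) measurable
  show "integrable lborel (\<lambda>k. \<psi> k *s ((2 * pi) ^ 3 *\<^sub>R G k))"
    by (rule integrable_vscale_bounded[OF _ _ M]) (use G in auto)
  let ?f = "\<lambda>x k. (wave x k * fourier_integral \<psi> x) *s G k"
  have "(LINT x|lborel. fourier_integral \<psi> x *s (LINT k|lborel. wave x k *s G k)) = (LINT x|lborel. LINT k|lborel. ?f x k)"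
  proof (intro Bochner_Integration.integral_cong refl)
    fix x
    have "(LINT k|lborel. fourier_integral \<psi> x *s (wave x k *s G k)) = fourier_integral \<psi> x *s (LINT k|lborel. wave x k *s G k)"
      by (intro integral_vscale_right integrable_wave_vscale G) auto
    then show "fourier_integral \<psi> x *s (LINT k|lborel. wave x k *s G k) = (LINT k|lborel. ?f x k)" by (simp add: mult.commute)
  qed
  also have "\<dots> = (LINT k|lborel. LINT x|lborel. ?f x k)"
    by (rule lborel_pair.Fubini_integral[symmetric], rule integrable_vscale_pair[OF schwartz_fourier_integrable[OF \<psi>] G]) auto
  also have "\<dots> = (LINT k|lborel. \<psi> k *s ((2 * pi) ^ 3 *\<^sub>R G k))"
  proof (intro Bochner_Integration.integral_cong refl)
    fix k
    have i: "integrable lborel (\<lambda>x. wave x k * fourier_integral \<psi> x)"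
      using schwartz_fourier_integrable[OF \<psi>] by (rule Bochner_Integration.integrable_bound) (auto simp: norm_mult)
    have "(LINT x|lborel. ?f x k) = (LINT x|lborel. wave k x * fourier_integral \<psi> x) *s G k"
      unfolding integral_vscale_left[OF i] by (simp add: wave_swap)
    then show "(LINT x|lborel. ?f x k) = \<psi> k *s ((2 * pi) ^ 3 *\<^sub>R G k)"
      unfolding schwartz_fourier_inversion[OF \<psi>] of_real_vscale[symmetric] by (simp add: mult.commute)
  qed
  finally show "(LINT x|lborel. fourier_integral \<psi> x *s (LINT k|lborel. wave x k *s G k))
    = (LINT k|lborel. \<psi> k *s ((2 * pi) ^ 3 *\<^sub>R G k))" .
qed

section \<open>Smooth functions of product form\<close>

text \<open>Smooth functions of one variable together with all their derivatives, \<open>D n\<close> being the \<open>n\<close>-th one.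
Test functions in space are built as products of such functions of the coordinates, for which all
partial derivatives are explicit.\<close>

definition derivative_seq :: "(nat \<Rightarrow> real \<Rightarrow> complex) \<Rightarrow> bool" where
  "derivative_seq D \<longleftrightarrow> (\<forall>n x. (D n has_vector_derivative D (Suc n) x) (at x))"

text \<open>The derivatives of a product. The recursion \<open>(D E)' = D' E + D E'\<close> avoids the binomial coefficients
of the Leibniz formula and turns the lemmas on zeros, limits and bounds into plain inductions.\<close>

primrec prod_seq :: "nat \<Rightarrow> (nat \<Rightarrow> real \<Rightarrow> complex) \<Rightarrow> (nat \<Rightarrow> real \<Rightarrow> complex) \<Rightarrow> real \<Rightarrow> complex" where
  "prod_seq 0 D E = (\<lambda>x. D 0 x * E 0 x)"
| "prod_seq (Suc n) D E = (\<lambda>x. prod_seq n (\<lambda>m. D (Suc m)) E x + prod_seq n D (\<lambda>m. E (Suc m)) x)"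

lemma derivative_seqD: "derivative_seq D \<Longrightarrow> (D n has_vector_derivative D (Suc n) x) (at x)"
  by (simp add: derivative_seq_def)

lemma derivative_seq_shift: "derivative_seq D \<Longrightarrow> derivative_seq (\<lambda>m. D (Suc m))"
  by (simp add: derivative_seq_def)

lemma derivative_seq_prod:
  assumes "derivative_seq D" "derivative_seq E" shows "derivative_seq (\<lambda>n. prod_seq n D E)"
proof -
  have "(prod_seq n D E has_vector_derivative prod_seq (Suc n) D E x) (at x)" for n x
    using assms
  proof (induction n arbitrary: D E)
    case 0
    show ?case using has_vector_derivative_mult[OF 0[THEN derivative_seqD]] by (simp add: add.commute)
  next
    case (Suc n)
    show ?case
      using has_vector_derivative_add[OF Suc.IH[OF derivative_seq_shift[OF Suc.prems(1)] Suc.prems(2)]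
          Suc.IH[OF Suc.prems(1) derivative_seq_shift[OF Suc.prems(2)]]] by simp
  qed
  then show ?thesis by (simp add: derivative_seq_def)
qed

lemma derivative_seq_affine:
  assumes "derivative_seq D" shows "derivative_seq (\<lambda>n x. of_real c ^ n * D n (c * x + d))"
  unfolding derivative_seq_def
proof (intro allI)
  fix n x
  have "((\<lambda>x. c * x + d) has_vector_derivative c) (at x)"
    by (auto intro!: derivative_eq_intros)
  from vector_diff_chain_at[OF this derivative_seqD[OF assms]]
  have "((\<lambda>x. D n (c * x + d)) has_vector_derivative c *\<^sub>R D (Suc n) (c * x + d)) (at x)" by (simp add: o_def)
  from has_vector_derivative_mult_right[OF this, of "of_real c ^ n"]
  show "((\<lambda>x. of_real c ^ n * D n (c * x + d)) has_vector_derivative of_real c ^ Suc n * D (Suc n) (c * x + d)) (at x)"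
    by (simp add: scaleR_conv_of_real mult_ac)
qed

lemma derivative_seq_exp: "derivative_seq (\<lambda>n x. a ^ n * exp (a * of_real x))"
  unfolding derivative_seq_def
  by (auto intro!: derivative_eq_intros has_vector_derivative_real_field)

lemma prod_seq_zero: "(\<And>n. D n x = 0) \<Longrightarrow> prod_seq n D E x = 0"
  by (induction n arbitrary: D E) auto

lemma prod_seq_zero_right: "(\<And>n. E n x = 0) \<Longrightarrow> prod_seq n D E x = 0"
  by (induction n arbitrary: D E) auto

lemma prod_seq_const: "prod_seq n (\<lambda>m _. if m = 0 then a else 0) E x = a * E n x"
proof (induction n arbitrary: E)
  case (Suc n)
  then show ?case using prod_seq_zero[of "\<lambda>_ _. 0"] by simp
qed simp

lemma prod_seq_tendsto:
  assumes "\<And>m. (\<lambda>N. D N m x) \<longlonglongrightarrow> d m"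
  shows "(\<lambda>N. prod_seq n (D N) E x) \<longlonglongrightarrow> prod_seq n (\<lambda>m _. d m) E x"
  using assms
proof (induction n arbitrary: D E d)
  case 0
  then show ?case by (auto intro!: tendsto_intros)
next
  case (Suc n)
  have "(\<lambda>N. prod_seq n (\<lambda>m. D N (Suc m)) E x) \<longlonglongrightarrow> prod_seq n (\<lambda>m _. d (Suc m)) E x"
    using Suc.IH[of "\<lambda>N m. D N (Suc m)" "\<lambda>m. d (Suc m)" E] Suc.prems by simp
  moreover have "(\<lambda>N. prod_seq n (D N) (\<lambda>m. E (Suc m)) x) \<longlonglongrightarrow> prod_seq n (\<lambda>m _. d m) (\<lambda>m. E (Suc m)) x"
    using Suc.IH[of D d] Suc.prems by simp
  ultimately show ?case by (auto intro!: tendsto_add)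
qed

lemma prod_seq_bounded:
  assumes "\<And>m. \<exists>K. \<forall>N x. norm (D N m x) \<le> K" "\<And>m. \<exists>K. \<forall>x. norm (E m x) \<le> K"
  shows "\<exists>K. \<forall>N x. norm (prod_seq n (D N) E x) \<le> K"
  using assms
proof (induction n arbitrary: D E)
  case 0
  obtain K L where "\<forall>N x. norm (D N 0 x) \<le> K" "\<forall>x. norm (E 0 x) \<le> L" using 0 by metis
  then show ?case by (intro exI[of _ "K * L"]) (auto simp: norm_mult intro!: mult_mono order_trans[OF norm_ge_zero])
next
  case (Suc n)
  have "\<exists>K. \<forall>N x. norm (prod_seq n (\<lambda>m. D N (Suc m)) E x) \<le> K"
    using Suc.IH[of "\<lambda>N m. D N (Suc m)" E] Suc.prems by blast
  moreover have "\<exists>K. \<forall>N x. norm (prod_seq n (D N) (\<lambda>m. E (Suc m)) x) \<le> K"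
    using Suc.IH[of D "\<lambda>m. E (Suc m)"] Suc.prems by blast
  ultimately obtain K L where "\<forall>N x. norm (prod_seq n (\<lambda>m. D N (Suc m)) E x) \<le> K"
     "\<forall>N x. norm (prod_seq n (D N) (\<lambda>m. E (Suc m)) x) \<le> L" by blast
  then show ?case by (intro exI[of _ "K + L"]) (auto intro!: norm_triangle_le add_mono)
qed

subsection \<open>The flat function\<close>

primrec flat_poly :: "nat \<Rightarrow> real poly" where
  "flat_poly 0 = 1"
| "flat_poly (Suc n) = [:0, 0, 1:] * (flat_poly n - pderiv (flat_poly n))"

text \<open>The \<open>n\<close>-th derivative of the function \<open>e\<^sup>-\<^sup>1\<^sup>/\<^sup>t\<close>, extended by 0 to \<open>t \<le> 0\<close>. For \<open>t > 0\<close> it is a polynomial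
in \<open>1 / t\<close> times \<open>e\<^sup>-\<^sup>1\<^sup>/\<^sup>t\<close>.\<close>

definition flat :: "nat \<Rightarrow> real \<Rightarrow> real" where
  "flat n t = (if t \<le> 0 then 0 else poly (flat_poly n) (1 / t) * exp (- (1 / t)))"

lemma poly_times_exp_minus_tendsto_0: "((\<lambda>y. poly p y * exp (- y)) \<longlongrightarrow> (0::real)) at_top"
proof -
  have "((\<lambda>y. \<Sum>i\<le>degree p. coeff p i * (y ^ i / exp y)) \<longlongrightarrow> (\<Sum>i\<le>degree p. coeff p i * 0)) at_top"
    by (intro tendsto_sum tendsto_mult tendsto_const tendsto_power_div_exp_0)
  then show ?thesis by (simp add: poly_altdef sum_distrib_right exp_minus divide_inverse mult.assoc)
qed

lemma flat_derivative: "(flat n has_real_derivative flat (Suc n) t) (at t)"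
proof -
  consider "t < 0" | "0 < t" | "t = 0" by linarith
  then show ?thesis
  proof cases
    case 1
    have "((\<lambda>_. 0) has_real_derivative 0) (at t)" by simp
    then have "(flat n has_real_derivative 0) (at t)"
      by (rule has_field_derivative_transform_within_open[of _ _ _ "{..<0}"]) (use 1 in \<open>auto simp: flat_def\<close>)
    then show ?thesis using 1 by (simp add: flat_def)
  next
    case 2
    let ?p = "flat_poly n"
    have "((\<lambda>t. poly ?p (1 / t) * exp (- (1 / t))) has_real_derivative
       (poly (pderiv ?p) (1 / t) * (- (1 / t\<^sup>2))) * exp (- (1 / t)) + poly ?p (1 / t) * (exp (- (1 / t)) * (1 / t\<^sup>2))) (at t)"
      using 2 by (auto intro!: derivative_eq_intros DERIV_chain'[OF _ poly_DERIV] simp: power2_eq_square field_simps)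
    moreover have "(poly (pderiv ?p) (1 / t) * (- (1 / t\<^sup>2))) * exp (- (1 / t)) + poly ?p (1 / t) * (exp (- (1 / t)) * (1 / t\<^sup>2))
       = flat (Suc n) t"
      using 2 by (simp add: flat_def power2_eq_square field_simps)
    ultimately have "((\<lambda>t. poly ?p (1 / t) * exp (- (1 / t))) has_real_derivative flat (Suc n) t) (at t)" by simp
    then show ?thesis
      by (rule has_field_derivative_transform_within_open[of _ _ _ "{0<..}"]) (use 2 in \<open>auto simp: flat_def\<close>)
  next
    case 3
    have "((\<lambda>h. (flat n (0 + h) - flat n 0) / h) \<longlongrightarrow> 0) (at 0)"
    proof (rule filterlim_split_at)
      have "\<forall>\<^sub>F h in at_left 0. (flat n (0 + h) - flat n 0) / h = 0"
        by (auto simp: flat_def eventually_at_filter)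
      then show "((\<lambda>h. (flat n (0 + h) - flat n 0) / h) \<longlongrightarrow> 0) (at_left 0)"
        by (rule tendsto_eventually)
      have "((\<lambda>h. poly (pCons 0 (flat_poly n)) (inverse h) * exp (- inverse h)) \<longlongrightarrow> (0::real)) (at_right 0)"
        by (rule filterlim_compose[OF poly_times_exp_minus_tendsto_0 filterlim_inverse_at_top_right])
      moreover have "\<forall>\<^sub>F h in at_right 0. poly (pCons 0 (flat_poly n)) (inverse h) * exp (- inverse h) = (flat n (0 + h) - flat n 0) / h"
        by (auto simp: flat_def eventually_at_filter divide_inverse mult_ac)
      ultimately show "((\<lambda>h. (flat n (0 + h) - flat n 0) / h) \<longlongrightarrow> 0) (at_right 0)"
        by (rule Lim_transform_eventually)
    qed
    then show ?thesis using 3 by (simp add: DERIV_def flat_def)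
  qed
qed

lemma derivative_seq_flat: "derivative_seq (\<lambda>n x. of_real (flat n x))"
  unfolding derivative_seq_def
  using flat_derivative
  by (auto intro!: has_vector_derivative_of_real simp flip: has_real_derivative_iff_has_vector_derivative)

lemma flat_0: "flat 0 t = (if t \<le> 0 then 0 else exp (- (1 / t)))"
  by (simp add: flat_def)

lemma flat_nonpos: "t \<le> 0 \<Longrightarrow> flat n t = 0"
  by (simp add: flat_def)

subsection \<open>Bump functions\<close>

text \<open>The \<open>n\<close>-th derivative of \<open>flat 0 (m (x - a)) * flat 0 (m (b - x))\<close>, which is positive on the interval
from \<open>a\<close> to \<open>b\<close>. A large \<open>m\<close> makes it close to 1 there.\<close>

definition bump :: "real \<Rightarrow> real \<Rightarrow> real \<Rightarrow> nat \<Rightarrow> real \<Rightarrow> complex" where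
  "bump m a b n = prod_seq n (\<lambda>n x. of_real m ^ n * of_real (flat n (m * x + (- m * a))))
     (\<lambda>n x. of_real (- m) ^ n * of_real (flat n (- m * x + m * b)))"

lemma derivative_seq_bump: "derivative_seq (bump m a b)"
  unfolding bump_def[abs_def]
  by (intro derivative_seq_prod derivative_seq_affine derivative_seq_flat)

lemma bump_outside:
  assumes "0 < m" "x \<le> a \<or> b \<le> x" shows "bump m a b n x = 0"
proof -
  have "m * x + (- m * a) \<le> 0 \<or> - m * x + m * b \<le> 0"
    using assms by (auto simp: algebra_simps mult_left_mono)
  then show ?thesis unfolding bump_def
    by (elim disjE) (intro prod_seq_zero prod_seq_zero_right; simp add: flat_nonpos)+
qed

lemma bump_0: "bump m a b 0 x = of_real (flat 0 (m * (x - a)) * flat 0 (m * (b - x)))"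
  by (simp add: bump_def algebra_simps)

lemma flat_0_bounds: "0 \<le> flat 0 t" "flat 0 t \<le> 1"
  by (auto simp: flat_0)

lemma norm_bump_0_le: "norm (bump m a b 0 x) \<le> 1"
  using flat_0_bounds by (simp add: bump_0 norm_mult mult_le_one)

lemma bump_0_pos: "0 < m \<Longrightarrow> a < x \<Longrightarrow> x < b \<Longrightarrow> 0 < flat 0 (m * (x - a)) * flat 0 (m * (b - x))"
  by (auto simp: flat_0 mult_le_0_iff)

lemma bump_tendsto_indicator: "(\<lambda>m. bump (real (Suc m)) a b 0 x) \<longlonglongrightarrow> indicator {a<..<b} x"
proof -
  have f: "(\<lambda>m. flat 0 (real (Suc m) * c)) \<longlonglongrightarrow> (if c \<le> 0 then 0 else 1)" for c
  proof (cases "c \<le> 0")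
    case True
    then have "flat 0 (real (Suc m) * c) = 0" for m by (intro flat_nonpos mult_nonneg_nonpos) auto
    then show ?thesis using True by simp
  next
    case False
    have "(\<lambda>m. exp (- (1 / real (Suc m) * (1 / c)))) \<longlonglongrightarrow> exp (- (0 * (1 / c)))"
      by (intro tendsto_intros LIMSEQ_Suc[OF lim_1_over_n])
    moreover have "flat 0 (real (Suc m) * c) = exp (- (1 / real (Suc m) * (1 / c)))" for m
      using False by (auto simp: flat_0 mult_le_0_iff)
    ultimately show ?thesis using False by simp
  qed
  have "(\<lambda>m. of_real (flat 0 (real (Suc m) * (x - a)) * flat 0 (real (Suc m) * (b - x))) :: complex)
     \<longlonglongrightarrow> of_real ((if x - a \<le> 0 then 0 else 1) * (if b - x \<le> 0 then 0 else 1))"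
    by (intro tendsto_of_real tendsto_mult f)
  moreover have "of_real ((if x - a \<le> 0 then 0 else 1) * (if b - x \<le> 0 then 0 else 1)) = (indicator {a<..<b} x :: complex)"
    by (auto simp: indicator_def)
  ultimately show ?thesis unfolding bump_0 by simp
qed

subsection \<open>Tensor products\<close>

text \<open>The linear map \<open>L\<close> is the identity or a real or imaginary part: Schwartz functions are complex valued,
test functions real valued. The multi-index selects a derivative of each factor.\<close>

definition tensor :: "(complex \<Rightarrow> 'b::real_normed_vector) \<Rightarrow> (3 \<Rightarrow> nat \<Rightarrow> real \<Rightarrow> complex) \<Rightarrow> multiindex \<Rightarrow> R3 \<Rightarrow> 'b" where
  "tensor L B \<alpha> x = L (\<Prod>i\<in>UNIV. B i (\<alpha> i) (x $ i))"

lemma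
  assumes B: "\<forall>i. derivative_seq (B i)" and L: "bounded_linear L"
  shows tensor_differentiable: "tensor L B \<alpha> differentiable (at x)"
    and pd_tensor: "pd j (tensor L B \<alpha>) x = tensor L B (\<alpha>(j := Suc (\<alpha> j))) x"
proof -
  have F: "((\<lambda>y. B i n (y $ i)) has_derivative (\<lambda>h. (h $ i) *\<^sub>R B i (Suc n) (x $ i))) (at x)" for i n
  proof -
    have "((\<lambda>y. y $ i) has_derivative (\<lambda>h. h $ i)) (at x)" by (auto intro!: derivative_eq_intros bounded_linear_imp_has_derivative bounded_linear_vec_nth)
    moreover have "(B i n has_derivative (\<lambda>h. h *\<^sub>R B i (Suc n) (x $ i))) (at (x $ i))"
      using derivative_seqD[OF B[rule_format], of i n "x $ i"] by (simp add: has_vector_derivative_def)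
    ultimately show ?thesis using has_derivative_compose by blast
  qed
  let ?b = "\<lambda>i. B i (\<alpha> i) (x $ i)" and ?c = "\<lambda>i. B i (Suc (\<alpha> i)) (x $ i)"
  let ?D = "\<lambda>h :: R3. ?b 1 * ?b 2 * ((h $ 3) *\<^sub>R ?c 3) + (?b 1 * ((h $ 2) *\<^sub>R ?c 2) + ((h $ 1) *\<^sub>R ?c 1) * ?b 2) * ?b 3"
  have "((\<lambda>y. B 1 (\<alpha> 1) (y $ 1) * B 2 (\<alpha> 2) (y $ 2) * B 3 (\<alpha> 3) (y $ 3)) has_derivative ?D) (at x)"
    by (intro has_derivative_mult F)
  from bounded_linear.has_derivative[OF L this]
  have D: "(tensor L B \<alpha> has_derivative (\<lambda>h. L (?D h))) (at x)"
    by (simp add: tensor_def[abs_def] prod_3)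
  then show "tensor L B \<alpha> differentiable (at x)" by (auto simp: differentiable_def)
  have "pd j (tensor L B \<alpha>) x = L (?D (axis j 1))"
    unfolding pd_def frechet_derivative_at[OF D, symmetric] ..
  also have "?D (axis j 1) = (\<Prod>i\<in>UNIV. B i ((\<alpha>(j := Suc (\<alpha> j))) i) (x $ i))"
    using exhaust_3[of j] by (auto simp: prod_3 axis_def)
  finally show "pd j (tensor L B \<alpha>) x = tensor L B (\<alpha>(j := Suc (\<alpha> j))) x"
    by (simp only: tensor_def[of L B "\<alpha>(j := Suc (\<alpha> j))" x])
qed

lemma pd_power_tensor:
  assumes B: "\<forall>i. derivative_seq (B i)" and L: "bounded_linear L"
  shows "(pd j ^^ m) (tensor L B \<alpha>) = tensor L B (\<alpha>(j := \<alpha> j + m))"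
proof (induction m)
  case (Suc m)
  have "(pd j ^^ Suc m) (tensor L B \<alpha>) = pd j (tensor L B (\<alpha>(j := \<alpha> j + m)))"
    unfolding funpow.simps o_apply Suc.IH ..
  also have "\<dots> = tensor L B (\<alpha>(j := \<alpha> j + Suc m))"
    by (rule ext) (simp add: pd_tensor[OF B L])
  finally show ?case .
qed simp

lemma mpd_tensor:
  assumes B: "\<forall>i. derivative_seq (B i)" and L: "bounded_linear L"
  shows "mpd \<beta> (tensor L B (\<lambda>_. 0)) = tensor L B \<beta>"
proof -
  have "(((\<lambda>_. 0)(3 := \<beta> 3))(2 := \<beta> 2))(1 := \<beta> 1) = \<beta>"
    using exhaust_3 by (auto simp: fun_eq_iff)
  then show ?thesis unfolding mpd_def pd_power_tensor[OF B L] by simp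
qed

lemma smooth_tensor:
  assumes B: "\<forall>i. derivative_seq (B i)" and L: "bounded_linear L"
  shows "smooth (tensor L B (\<lambda>_. 0))"
  unfolding smooth_def mpd_tensor[OF B L] using tensor_differentiable[OF B L] by blast

lemma tensor_outside:
  assumes out: "\<forall>i n x. r < \<bar>x\<bar> \<longrightarrow> B i n x = 0" and L: "bounded_linear L" and x: "3 * r < norm x" and "0 \<le> r"
  shows "tensor L B \<alpha> x = 0"
proof -
  have "\<exists>i. r < \<bar>x $ i\<bar>"
  proof (rule ccontr)
    assume "\<not> ?thesis"
    then have "\<bar>x $ i\<bar> \<le> r" for i by (simp add: not_less)
    then have "(\<Sum>i\<in>UNIV. \<bar>x $ i\<bar>) \<le> 3 * r" using sum_bounded_above[of UNIV "\<lambda>i. \<bar>x $ i\<bar>" r] by simp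
    then show False using norm_le_l1_cart[of x] x by linarith
  qed
  then have "(\<Prod>i\<in>UNIV. B i (\<alpha> i) (x $ i)) = 0" using out by (auto simp: prod_zero_iff)
  then show ?thesis using linear_0[OF bounded_linear.linear[OF L]] unfolding tensor_def by (simp only:)
qed

lemma test_function_tensor:
  assumes B: "\<forall>i. derivative_seq (B i)" and L: "bounded_linear L"
    and out: "\<forall>i n x. r < \<bar>x\<bar> \<longrightarrow> B i n x = 0" and "0 \<le> r"
  shows "test_function (tensor L B (\<lambda>_. 0))"
  unfolding test_function_def using smooth_tensor[OF B L] tensor_outside[OF out L] \<open>0 \<le> r\<close>
  by (intro conjI exI[of _ "3 * r"]) auto

lemma schwartz_tensor:
  assumes B: "\<forall>i. derivative_seq (B i)" and out: "\<forall>i n x. r < \<bar>x\<bar> \<longrightarrow> B i n x = 0" and r: "0 \<le> r"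
  shows "schwartz (tensor (\<lambda>z. z) B (\<lambda>_. 0))"
  unfolding schwartz_def
proof (intro conjI allI)
  have L: "bounded_linear (\<lambda>z::complex. z)" by simp
  show "smooth (tensor (\<lambda>z. z) B (\<lambda>_. 0))" by (rule smooth_tensor[OF B L])
  fix n \<alpha>
  let ?f = "\<lambda>x. jb x ^ n *\<^sub>R tensor (\<lambda>z. z) B \<alpha> x"
  have "continuous_on UNIV (tensor (\<lambda>z. z) B \<alpha>)"
    using tensor_differentiable[OF B L] by (intro differentiable_borel_measurable)
  then have "continuous_on (cball 0 (3 * r)) ?f"
    by (intro continuous_intros continuous_on_subset[of UNIV _ "cball 0 (3 * r)"])
      (auto simp: jb_def[abs_def] intro!: continuous_intros)
  then have "bounded (?f ` cball 0 (3 * r))"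
    by (intro compact_imp_bounded compact_continuous_image) auto
  moreover have "?f x = 0" if "x \<notin> cball 0 (3 * r)" for x
    using tensor_outside[OF out L, where x=x] that r by simp
  then have "range ?f \<subseteq> insert 0 (?f ` cball 0 (3 * r))" by blast
  ultimately have "bounded (range ?f)" by (meson bounded_insert bounded_subset)
  then show "bounded (range (\<lambda>x. jb x ^ n *\<^sub>R mpd \<alpha> (tensor (\<lambda>z. z) B (\<lambda>_. 0)) x))"
    unfolding mpd_tensor[OF B L] .
qed

section \<open>Uniqueness of Fourier transforms\<close>

lemma box_R3: "box a b = {x :: R3. \<forall>i. a $ i < x $ i \<and> x $ i < b $ i}"
  by (auto simp: mem_box_cart)

definition box_bump :: "real \<Rightarrow> R3 \<Rightarrow> R3 \<Rightarrow> R3 \<Rightarrow> complex" where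
  "box_bump m a b = tensor (\<lambda>z. z) (\<lambda>i. bump m (a $ i) (b $ i)) (\<lambda>_. 0)"

lemma schwartz_box_bump:
  assumes m: "0 < m" shows "schwartz (box_bump m a b)"
  unfolding box_bump_def
proof (rule schwartz_tensor)
  show "\<forall>i. derivative_seq (bump m (a $ i) (b $ i))" by (simp add: derivative_seq_bump)
  show "\<forall>i n x. norm a + norm b < \<bar>x\<bar> \<longrightarrow> bump m (a $ i) (b $ i) n x = 0"
  proof (intro allI impI)
    fix i n x assume x: "norm a + norm b < \<bar>x\<bar>"
    have "\<bar>a $ i\<bar> \<le> norm a" "\<bar>b $ i\<bar> \<le> norm b" by (rule component_le_norm_cart)+
    then have "x \<le> a $ i \<or> b $ i \<le> x" using x by (auto simp: abs_if split: if_splits)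
    then show "bump m (a $ i) (b $ i) n x = 0" by (rule bump_outside[OF m])
  qed
qed simp

lemma box_bump_outside:
  assumes "0 < m" "x \<notin> box a b" shows "box_bump m a b x = 0"
proof -
  obtain i where "x $ i \<le> a $ i \<or> b $ i \<le> x $ i" using assms(2) by (auto simp: box_R3 not_less)
  then have "bump m (a $ i) (b $ i) 0 (x $ i) = 0" by (rule bump_outside[OF assms(1)])
  then show ?thesis unfolding box_bump_def tensor_def by (intro prod_zero) auto
qed

lemma norm_box_bump_le: "norm (box_bump m a b x) \<le> 1"
  unfolding box_bump_def tensor_def prod_norm[symmetric] by (intro prod_le_1) (auto simp: norm_bump_0_le)

lemma box_bump_nonzero:
  assumes m: "0 < m" "x \<in> box a b" shows "box_bump m a b x \<noteq> 0"
proof -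
  have "bump m (a $ i) (b $ i) 0 (x $ i) \<noteq> 0" for i
    using bump_0_pos[OF m(1), of "a $ i" "x $ i" "b $ i"] m(2) by (auto simp: bump_0 box_R3)
  then show ?thesis by (auto simp: box_bump_def tensor_def prod_3)
qed

lemma box_bump_tendsto: "(\<lambda>m. box_bump (real (Suc m)) a b x) \<longlonglongrightarrow> indicator (box a b) x"
proof -
  have "(\<lambda>m. box_bump (real (Suc m)) a b x) \<longlonglongrightarrow> (\<Prod>i\<in>UNIV. indicator {a $ i<..<b $ i} (x $ i))"
    unfolding box_bump_def tensor_def by (intro tendsto_prod bump_tendsto_indicator)
  also have "(\<Prod>i\<in>UNIV. indicator {a $ i<..<b $ i} (x $ i)) = (indicator (box a b) x :: complex)"
    by (auto simp: indicator_def box_R3 intro!: prod.neutral)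
  finally show ?thesis .
qed

text \<open>A bump on a larger box is bounded below on the box, so that \<open>g\<close> may be divided by it.\<close>

lemma integrable_on_box:
  fixes g :: "R3 \<Rightarrow> C3"
  assumes g: "\<And>\<psi>. schwartz \<psi> \<Longrightarrow> integrable lborel (\<lambda>k. \<psi> k *s g k)"
  shows "integrable lborel (\<lambda>k. indicator (box a b) k *\<^sub>R g k)"
proof -
  define c d where "c = a - 1" and "d = b + (1 :: R3)"
  let ?\<psi> = "box_bump 1 c d"
  have \<psi>: "schwartz ?\<psi>" by (rule schwartz_box_bump) simp
  have sub: "cbox a b \<subseteq> box c d" by (auto simp: mem_box_cart c_def d_def) (smt (verit))+
  have cont: "continuous_on (cbox a b) (\<lambda>k. norm (?\<psi> k))"
    by (intro continuous_on_norm continuous_on_subset[OF schwartz_continuous[OF \<psi>]]) auto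
  have "\<exists>\<delta>>0. \<forall>k\<in>cbox a b. \<delta> \<le> norm (?\<psi> k)"
  proof (cases "cbox a b = {}")
    case False
    obtain k where k: "k \<in> cbox a b" "\<forall>y\<in>cbox a b. norm (?\<psi> k) \<le> norm (?\<psi> y)"
      using continuous_attains_inf[OF compact_cbox False cont] by blast
    then show ?thesis using box_bump_nonzero[of 1 k c d] sub by (intro exI[of _ "norm (?\<psi> k)"]) auto
  qed (auto intro: exI[of _ 1])
  then obtain \<delta> where \<delta>: "0 < \<delta>" "\<And>k. k \<in> cbox a b \<Longrightarrow> \<delta> \<le> norm (?\<psi> k)" by blast
  let ?h = "\<lambda>k. if k \<in> box a b then 1 / ?\<psi> k else 0"
  have [measurable]: "?\<psi> \<in> borel_measurable borel" using schwartz_integrable[OF \<psi>] by auto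
  have "integrable lborel (\<lambda>k. ?h k *s (?\<psi> k *s g k))"
  proof (rule integrable_vscale_bounded[OF g[OF \<psi>]])
    show "norm (?h k) \<le> 1 / \<delta>" for k
    proof (cases "k \<in> box a b")
      case True
      then have "\<delta> \<le> norm (?\<psi> k)" using \<delta>(2) box_subset_cbox by blast
      then show ?thesis using True \<delta>(1) by (simp add: norm_divide frac_le)
    qed (use \<delta>(1) in simp)
  qed measurable
  moreover have "?h k *s (?\<psi> k *s g k) = indicator (box a b) k *\<^sub>R g k" for k
    using box_bump_nonzero[of 1 k c d] sub box_subset_cbox[of a b] by (auto simp: indicator_def)
  ultimately show ?thesis by simp
qed

lemma mem_centered_box:
  fixes x :: "'a::euclidean_space"
  assumes "norm x < c" shows "x \<in> box (- (c *\<^sub>R One)) (c *\<^sub>R One)"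
proof -
  have "\<bar>x \<bullet> i\<bar> < c" if "i \<in> Basis" for i
    using Basis_le_norm[OF that, of x] assms by linarith
  then show ?thesis by (auto simp: mem_box abs_less_iff minus_less_iff)
qed

text \<open>The boxes are stable under intersection and generate the Borel sets; the sets over which the
integral of \<open>w\<close> vanishes form a Dynkin system, the whole space being a limit of boxes.\<close>

lemma AE_eq_0_if_box_integrals_eq_0:
  fixes w :: "'a::euclidean_space \<Rightarrow> 'b::{banach, second_countable_topology}"
  assumes w: "integrable lborel w" and box: "\<And>a b. (LINT x:box a b|lborel. w x) = 0"
  shows "AE x in lborel. w x = 0"
proof (rule sigma_finite_measure.density_zero[OF sigma_finite_lborel w])
  have [measurable]: "w \<in> borel_measurable borel" using w by auto
  have si: "set_integrable lborel A w" if "A \<in> sets borel" for A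
    using w that by (simp add: set_integrable_def integrable_mult_indicator)
  let ?G = "range (\<lambda>(a, b). box a b :: 'a set)"
  have B: "sets (borel :: 'a measure) = sigma_sets UNIV ?G"
    by (subst borel_eq_box) (rule sets_measure_of, simp)
  have G: "Int_stable ?G" "?G \<subseteq> Pow UNIV" by (auto simp: Int_stable_def box_Int_box)
  have total: "(LINT x|lborel. w x) = 0"
  proof -
    have "(\<lambda>n. LINT x|lborel. indicator (box (- (real n *\<^sub>R One)) (real n *\<^sub>R One)) x *\<^sub>R w x) \<longlonglongrightarrow> (LINT x|lborel. w x)"
    proof (rule integral_dominated_convergence)
      show "integrable lborel (\<lambda>x. norm (w x))" using w by simp
      show "AE x in lborel. (\<lambda>n. indicator (box (- (real n *\<^sub>R One)) (real n *\<^sub>R One)) x *\<^sub>R w x) \<longlonglongrightarrow> w x"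
      proof (rule AE_I2)
        fix x :: 'a
        obtain N where N: "norm x < real N" using reals_Archimedean2 by blast
        have "indicator (box (- (real n *\<^sub>R One)) (real n *\<^sub>R One)) x *\<^sub>R w x = w x" if "N \<le> n" for n
        proof -
          have "x \<in> box (- (real n *\<^sub>R One)) (real n *\<^sub>R One)"
            using N that by (intro mem_centered_box) simp
          then show ?thesis by simp
        qed
        then show "(\<lambda>n. indicator (box (- (real n *\<^sub>R One)) (real n *\<^sub>R One)) x *\<^sub>R w x) \<longlonglongrightarrow> w x"
          by (intro tendsto_eventually) (auto simp: eventually_sequentially)
      qed
      show "AE x in lborel. norm (indicator (box (- (real n *\<^sub>R One)) (real n *\<^sub>R One)) x *\<^sub>R w x) \<le> norm (w x)" for n
        by (intro AE_I2) (auto simp: indicator_def)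
    qed measurable
    then show ?thesis using box unfolding set_lebesgue_integral_def by (simp add: LIMSEQ_const_iff)
  qed
  fix A :: "'a set" assume "A \<in> sets lborel"
  then have "A \<in> sigma_sets UNIV ?G" by (simp only: sets_lborel B)
  with G show "(LINT x:A|lborel. w x) = 0"
  proof (induction rule: sigma_sets_induct_disjoint)
    case (basic A)
    then show ?case using box by auto
  next
    case empty
    then show ?case by (simp add: set_lebesgue_integral_def)
  next
    case (compl A)
    then have A: "A \<in> sets borel" by (simp only: B)
    have "(LINT x:UNIV|lborel. w x) = (LINT x:(UNIV - A) \<union> A|lborel. w x)" by simp
    also have "\<dots> = (LINT x:UNIV - A|lborel. w x) + (LINT x:A|lborel. w x)"
      by (intro set_integral_Un si) (use A in auto)
    finally show ?case using compl total by (simp add: set_lebesgue_integral_def)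
  next
    case (union A)
    then have A: "A i \<in> sets borel" for i by (auto simp only: B)
    have "(LINT x:(\<Union>i. A i)|lborel. w x) = (\<Sum>i. (LINT x:(A i)|lborel. w x))"
      using union(1) A by (intro lebesgue_integral_countable_add si) (auto simp: disjoint_family_on_def)
    then show ?case using union by simp
  qed
qed

text \<open>Two transforms have the same integral against every bump, hence in the limit over every box.
Only their restrictions to boxes are integrable, so the argument is made on each of a sequence
of boxes that exhaust the space.\<close>

lemma has_fourier_transform_unique:
  assumes 1: "has_fourier_transform u g1" and 2: "has_fourier_transform u g2"
  shows "AE k in lborel. g1 k = g2 k"
proof -
  have i: "integrable lborel (\<lambda>k. \<psi> k *s g1 k)" "integrable lborel (\<lambda>k. \<psi> k *s g2 k)"
    "(LINT k|lborel. \<psi> k *s g1 k) = (LINT k|lborel. \<psi> k *s g2 k)" if "schwartz \<psi>" for \<psi>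
    using 1 2 that unfolding has_fourier_transform_def by metis+
  have lim: "(\<lambda>m. LINT k|lborel. box_bump (real (Suc m)) a b k *s g k) \<longlonglongrightarrow> (LINT k|lborel. indicator (box a b) k *\<^sub>R g k)"
    if g: "\<And>\<psi>. schwartz \<psi> \<Longrightarrow> integrable lborel (\<lambda>k. \<psi> k *s g k)" for g :: "R3 \<Rightarrow> C3" and a b
  proof (rule integral_dominated_convergence)
    have ib: "integrable lborel (\<lambda>k. indicator (box a b) k *\<^sub>R g k)" by (rule integrable_on_box[OF g])
    then show "integrable lborel (\<lambda>k. norm (indicator (box a b) k *\<^sub>R g k))" by (rule integrable_norm)
    show "(\<lambda>k. indicator (box a b) k *\<^sub>R g k) \<in> borel_measurable lborel" using ib by auto
    show "(\<lambda>k. box_bump (real (Suc m)) a b k *s g k) \<in> borel_measurable lborel" for m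
      by (rule borel_measurable_integrable, rule g, rule schwartz_box_bump) simp
    show "AE k in lborel. (\<lambda>m. box_bump (real (Suc m)) a b k *s g k) \<longlonglongrightarrow> indicator (box a b) k *\<^sub>R g k"
    proof (rule AE_I2)
      fix k
      have "(\<lambda>m. box_bump (real (Suc m)) a b k *s g k) \<longlonglongrightarrow> indicator (box a b) k *s g k"
        by (intro bounded_bilinear.tendsto[OF bounded_bilinear_vscale] tendsto_const box_bump_tendsto)
      moreover have "indicator (box a b) k *s g k = indicator (box a b) k *\<^sub>R g k"
        by (cases "k \<in> box a b") simp_all
      ultimately show "(\<lambda>m. box_bump (real (Suc m)) a b k *s g k) \<longlonglongrightarrow> indicator (box a b) k *\<^sub>R g k"
        by (simp only:)
    qed
    show "AE k in lborel. norm (box_bump (real (Suc m)) a b k *s g k) \<le> norm (indicator (box a b) k *\<^sub>R g k)" for m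
      using norm_box_bump_le box_bump_outside[of "real (Suc m)" _ a b]
      by (intro AE_I2) (auto simp: norm_complex_vscale indicator_def mult_left_le_one_le)
  qed
  have eq: "(LINT k|lborel. indicator (box a b) k *\<^sub>R g1 k) = (LINT k|lborel. indicator (box a b) k *\<^sub>R g2 k)" for a b
    by (rule LIMSEQ_unique[OF lim[OF i(1)]]) (auto simp only: i(3)[OF schwartz_box_bump] of_nat_0_less_iff intro!: lim[OF i(2)])
  let ?Q = "\<lambda>n. box (- (real n *\<^sub>R One)) (real n *\<^sub>R One) :: R3 set"
  have "AE k in lborel. indicator (?Q n) k *\<^sub>R (g1 k - g2 k) = 0" for n
  proof (rule AE_eq_0_if_box_integrals_eq_0)
    have ib: "integrable lborel (\<lambda>k. indicator (box a b) k *\<^sub>R g1 k)" "integrable lborel (\<lambda>k. indicator (box a b) k *\<^sub>R g2 k)" for a b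
      by (intro integrable_on_box i; assumption)+
    show "integrable lborel (\<lambda>k. indicator (?Q n) k *\<^sub>R (g1 k - g2 k))"
      unfolding scaleR_diff_right by (intro Bochner_Integration.integrable_diff ib)
    fix a b
    obtain c d where cd: "box a b \<inter> ?Q n = box c d" using box_Int_box by blast
    have "(LINT k:box a b|lborel. indicator (?Q n) k *\<^sub>R (g1 k - g2 k)) = (LINT k|lborel. indicator (box c d) k *\<^sub>R g1 k - indicator (box c d) k *\<^sub>R g2 k)"
      unfolding set_lebesgue_integral_def cd[symmetric] indicator_inter_arith by (simp add: scaleR_diff_right)
    also have "\<dots> = 0" unfolding Bochner_Integration.integral_diff[OF ib] eq by simp
    finally show "(LINT k:box a b|lborel. indicator (?Q n) k *\<^sub>R (g1 k - g2 k)) = 0" .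
  qed
  then have "AE k in lborel. \<forall>n. indicator (?Q n) k *\<^sub>R (g1 k - g2 k) = 0" unfolding AE_all_countable by blast
  then show ?thesis
  proof eventually_elim
    case (elim k)
    obtain n where n: "norm k < real n" using reals_Archimedean2 by blast
    have "k \<in> ?Q n" by (rule mem_centered_box[OF n])
    then show ?case using elim[rule_format, of n] by simp
  qed
qed

lemma has_fourier_transform_measurable:
  assumes "has_fourier_transform u g" shows "g \<in> borel_measurable borel"
proof -
  let ?Q = "\<lambda>n. box (- (real n *\<^sub>R One)) (real n *\<^sub>R One) :: R3 set"
  have "integrable lborel (\<lambda>k. indicator (?Q n) k *\<^sub>R g k)" for n
    using assms by (intro integrable_on_box) (simp add: has_fourier_transform_def)
  then have m: "(\<lambda>k. indicator (?Q n) k *\<^sub>R g k) \<in> borel_measurable borel" for n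
    by (auto dest: borel_measurable_integrable)
  show ?thesis
  proof (rule borel_measurable_LIMSEQ_metric[OF m])
    fix k :: R3
    obtain N where N: "norm k < real N" using reals_Archimedean2 by blast
    have "k \<in> ?Q n" if "N \<le> n" for n
      using N that by (intro mem_centered_box) simp
    then show "(\<lambda>n. indicator (?Q n) k *\<^sub>R g k) \<longlonglongrightarrow> g k"
      by (intro tendsto_eventually) (auto simp: eventually_sequentially intro!: exI[of _ N])
  qed
qed

lemma has_fourier_transform_fourier:
  assumes "has_fourier_transform u g" shows "has_fourier_transform u (fourier u)"
  unfolding fourier_def by (rule someI[where P="has_fourier_transform u", OF assms])

text \<open>The transform inside \<open>multiplier\<close> is an arbitrary choice; uniqueness replaces it by one that is known.\<close>

lemma multiplier_eq:
  assumes g: "has_fourier_transform u g" and [measurable]: "m \<in> borel_measurable borel"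
  shows "multiplier m u x = (1 / (2 * pi) ^ 3) *\<^sub>R (LINT k|lborel. (wave x k * m k) *s g k)"
proof -
  note h = has_fourier_transform_fourier[OF g]
  note [measurable] = has_fourier_transform_measurable[OF g] has_fourier_transform_measurable[OF h]
  have "(LINT k|lborel. (wave x k * m k) *s fourier u k) = (LINT k|lborel. (wave x k * m k) *s g k)"
  proof (rule integral_cong_AE)
    show "AE k in lborel. (wave x k * m k) *s fourier u k = (wave x k * m k) *s g k"
      using has_fourier_transform_unique[OF h g] by eventually_elim simp
  qed measurable
  then show ?thesis by (simp add: multiplier_def wave_def)
qed

section \<open>Lebesgue and Sobolev norms\<close>

lemma Lp_norm_1D:
  fixes u :: "R3 \<Rightarrow> 'b::euclidean_space"
  assumes "Lp_norm 1 u \<le> ennreal c" "0 \<le> c"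
  shows "integrable lborel u" "(LINT x|lborel. norm (u x)) \<le> c"
proof -
  have m: "u \<in> borel_measurable lborel" using assms by (auto simp: Lp_norm_def top_unique split: if_splits)
  let ?I = "\<integral>\<^sup>+ x. ennreal (norm (u x)) \<partial>lborel"
  have "Lp_norm 1 u = epowr ?I 1" using m by (simp add: Lp_norm_def)
  then have e: "epowr ?I 1 \<le> ennreal c" using assms by simp
  then have fin: "?I < \<infinity>" by (auto simp: epowr_def top_unique less_top split: if_splits)
  then have "epowr ?I 1 = ?I" by (simp add: epowr_def)
  then have I: "?I \<le> ennreal c" using e by simp
  show i: "integrable lborel u" using m fin by (simp add: integrable_iff_bounded)
  have "ennreal (LINT x|lborel. norm (u x)) = ?I" using i by (intro nn_integral_eq_integral[symmetric]) auto
  then show "(LINT x|lborel. norm (u x)) \<le> c" using I assms(2) ennreal_le_iff by metis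
qed

lemma Lp_norm_infinityD:
  fixes u :: "R3 \<Rightarrow> 'b::euclidean_space"
  assumes "Lp_norm \<infinity> u \<le> ennreal c" "0 \<le> c"
  shows "u \<in> borel_measurable lborel" "AE x in lborel. norm (u x) \<le> c"
proof -
  show m: "u \<in> borel_measurable lborel" using assms by (auto simp: Lp_norm_def top_unique split: if_splits)
  have "esssup lborel (\<lambda>x. ennreal (norm (u x))) \<le> ennreal c" using assms m by (simp add: Lp_norm_def)
  then show "AE x in lborel. norm (u x) \<le> c"
    using esssup_AE[of "\<lambda>x. ennreal (norm (u x))" lborel]
    by (auto elim!: eventually_mono dest: order_trans simp: assms(2))
qed

lemma Lp_deriv_norm_1D:
  fixes u :: "R3 \<Rightarrow> 'b::euclidean_space"
  assumes "Lp_deriv_norm 1 \<alpha> u \<le> ennreal c" "0 \<le> c"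
  obtains g where "has_weak_deriv \<alpha> u g" "integrable lborel g" "(LINT x|lborel. norm (g x)) \<le> c + 1"
proof -
  have "Lp_deriv_norm 1 \<alpha> u < ennreal (c + 1)"
    using assms by (auto intro: le_less_trans simp: ennreal_less_iff)
  then obtain g where g: "has_weak_deriv \<alpha> u g" "Lp_norm 1 g < ennreal (c + 1)"
    unfolding Lp_deriv_norm_def INF_less_iff by blast
  then show ?thesis using that[of g] Lp_norm_1D[of g "c + 1"] assms(2) by (auto simp: less_imp_le)
qed

text \<open>A nonempty open set is not a null set.\<close>

lemma continuous_AE_bound:
  fixes u :: "R3 \<Rightarrow> 'b::real_normed_vector"
  assumes c: "continuous_on UNIV u" and M: "AE x in lborel. norm (u x) \<le> M"
  shows "norm (u x) \<le> M"
proof (rule ccontr)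
  assume "\<not> ?thesis"
  then have x: "x \<in> {x. M < norm (u x)}" by simp
  have op: "open {x. M < norm (u x)}"
    by (intro open_Collect_less continuous_intros) (use c in auto)
  have "{x. M < norm (u x)} \<in> null_sets lborel"
  proof -
    have "AE x in lborel. x \<notin> {x. M < norm (u x)}" using M by eventually_elim auto
    then show ?thesis using AE_iff_null_sets[of "{x. M < norm (u x)}" lborel] op by simp
  qed
  then have "negligible {x. M < norm (u x)}"
    using null_sets_completionI by (auto simp: negligible_iff_null_sets)
  with open_not_negligible[OF op] x show False by blast
qed

section \<open>Bounds on Fourier transforms by weak derivatives\<close>

text \<open>The \<open>n\<close>-th derivative of the \<open>j\<close>-th factor of the plane wave \<open>e\<^sup>-\<^sup>i\<^sup>k\<^sup>\<bullet>\<^sup>x\<close>, cut off smoothly at distance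
\<open>N + 1\<close>. Weak derivatives can be tested against such functions, but not against the wave itself.\<close>

definition cutoff_wave :: "R3 \<Rightarrow> nat \<Rightarrow> 3 \<Rightarrow> nat \<Rightarrow> real \<Rightarrow> complex" where
  "cutoff_wave k N j n = prod_seq n (\<lambda>l x. of_real (1 / real (Suc N)) ^ l * bump 1 (- 1) 1 l (1 / real (Suc N) * x + 0))
     (\<lambda>l x. (- \<i> * of_real (k $ j)) ^ l * exp ((- \<i> * of_real (k $ j)) * of_real x))"

lemma derivative_seq_cutoff_wave: "derivative_seq (cutoff_wave k N j)"
  unfolding cutoff_wave_def[abs_def]
  by (intro derivative_seq_prod derivative_seq_affine derivative_seq_bump derivative_seq_exp)

lemma derivative_seq_continuous: "derivative_seq D \<Longrightarrow> continuous_on UNIV (D n)"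
  by (auto simp: continuous_on_eq_continuous_at derivative_seq_def intro!: has_vector_derivative_continuous)

lemma bump_bounded: "\<exists>K. \<forall>x. norm (bump 1 (- 1) 1 n x) \<le> K"
proof -
  have "bounded (bump 1 (- 1) 1 n ` {-1..1})"
    by (intro compact_imp_bounded compact_continuous_image
        continuous_on_subset[OF derivative_seq_continuous[OF derivative_seq_bump]]) auto
  then obtain K where K: "\<forall>x\<in>{-1..1}. norm (bump 1 (- 1) 1 n x) \<le> K"
    by (auto simp: bounded_iff)
  have "norm (bump 1 (- 1) 1 n x) \<le> max K 0" for x
  proof (cases "x \<in> {-1..1}")
    case True then show ?thesis using bspec[OF K True] by simp
  next
    case False
    then have "bump 1 (- 1) 1 n x = 0" by (intro bump_outside) auto
    then show ?thesis by simp
  qed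
  then show ?thesis by blast
qed

lemma cutoff_wave_bounded: "\<exists>K. \<forall>N x. norm (cutoff_wave k N j n x) \<le> K"
  unfolding cutoff_wave_def
proof (rule prod_seq_bounded)
  fix m
  obtain K where K: "\<And>x. norm (bump 1 (- 1) 1 m x) \<le> K" using bump_bounded by blast
  have "norm (of_real (1 / real (Suc N)) ^ m * bump 1 (- 1) 1 m (1 / real (Suc N) * x + 0)) \<le> 1 * K" for N x
    unfolding norm_mult norm_power norm_of_real by (intro mult_mono K) (auto simp: power_le_one)
  then show "\<exists>K. \<forall>N x. norm (of_real (1 / real (Suc N)) ^ m * bump 1 (- 1) 1 m (1 / real (Suc N) * x + 0)) \<le> K" by blast
  have "norm ((- \<i> * of_real (k $ j)) ^ m * exp ((- \<i> * of_real (k $ j)) * of_real x)) \<le> \<bar>k $ j\<bar> ^ m" for x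
    by (simp add: norm_mult norm_power)
  then show "\<exists>K. \<forall>x. norm ((- \<i> * of_real (k $ j)) ^ m * exp ((- \<i> * of_real (k $ j)) * of_real x)) \<le> K" by blast
qed

lemma cutoff_wave_outside: "real (Suc N) < \<bar>x\<bar> \<Longrightarrow> cutoff_wave k N j n x = 0"
proof -
  assume x: "real (Suc N) < \<bar>x\<bar>"
  have "1 / real (Suc N) * x + 0 \<le> -1 \<or> 1 \<le> 1 / real (Suc N) * x + 0"
    using x by (auto simp: divide_simps abs_if split: if_splits)
  then have "bump 1 (- 1) 1 l (1 / real (Suc N) * x + 0) = 0" for l by (intro bump_outside) auto
  then show ?thesis unfolding cutoff_wave_def by (intro prod_seq_zero) simp
qed

text \<open>Derivatives that fall on the cutoff vanish in the limit. The constant \<open>e\<^sup>-\<^sup>2\<close> is the value of the bump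
at its centre.\<close>

lemma cutoff_wave_tendsto:
  "(\<lambda>N. cutoff_wave k N j n x) \<longlonglongrightarrow>
     of_real (exp (- 2)) * ((- \<i> * of_real (k $ j)) ^ n * exp ((- \<i> * of_real (k $ j)) * of_real x))"
proof -
  define d where "d l = (if l = 0 then of_real (exp (- 2)) else 0 :: complex)" for l :: nat
  let ?D = "\<lambda>N l x. of_real (1 / real (Suc N)) ^ l * bump 1 (- 1) 1 l (1 / real (Suc N) * x + 0)"
  have b0: "bump 1 (- 1) 1 0 0 = of_real (exp (- 2))"
    by (simp add: bump_0 flat_0 exp_add[symmetric] flip: of_real_mult)
  have "(\<lambda>N. ?D N l x) \<longlonglongrightarrow> d l" for l
  proof -
    have "isCont (bump 1 (- 1) 1 l) 0"
      using derivative_seq_continuous[OF derivative_seq_bump] by (simp add: continuous_on_eq_continuous_at)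
    moreover have "(\<lambda>N. 1 / real (Suc N) * x + 0) \<longlonglongrightarrow> 0 * x + 0" by (intro tendsto_intros LIMSEQ_Suc[OF lim_1_over_n])
    ultimately have "(\<lambda>N. bump 1 (- 1) 1 l (1 / real (Suc N) * x + 0)) \<longlonglongrightarrow> bump 1 (- 1) 1 l 0"
      by (intro isCont_tendsto_compose[where g="bump 1 (- 1) 1 l"]) auto
    moreover have "(\<lambda>N. of_real (1 / real (Suc N)) ^ l) \<longlonglongrightarrow> (of_real 0 :: complex) ^ l"
      by (intro tendsto_intros LIMSEQ_Suc[OF lim_1_over_n])
    ultimately have "(\<lambda>N. ?D N l x) \<longlonglongrightarrow> of_real 0 ^ l * bump 1 (- 1) 1 l 0" by (rule tendsto_mult[rotated])
    moreover have "of_real 0 ^ l * bump 1 (- 1) 1 l 0 = d l" by (simp add: d_def b0 power_0_left)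
    ultimately show ?thesis by simp
  qed
  from prod_seq_tendsto[of ?D x d, OF this, of n]
  show ?thesis unfolding cutoff_wave_def d_def prod_seq_const .
qed

lemma weak_deriv_complex:
  fixes u g :: "R3 \<Rightarrow> real"
  assumes w: "has_weak_deriv \<beta> u g" and u: "integrable lborel u" and g: "integrable lborel g"
    and B: "\<forall>i. derivative_seq (B i)" and out: "\<forall>i n x. r < \<bar>x\<bar> \<longrightarrow> B i n x = 0" and r: "0 \<le> r"
    and bd: "\<And>\<alpha>. \<exists>K. \<forall>x. norm (tensor (\<lambda>z. z) B \<alpha> x) \<le> K"
  shows "(LINT x|lborel. tensor (\<lambda>z. z) B (\<lambda>_. 0) x * of_real (g x))
    = (- 1) ^ msize \<beta> * (LINT x|lborel. tensor (\<lambda>z. z) B \<beta> x * of_real (u x))"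
proof -
  let ?t = "tensor (\<lambda>z. z) B"
  have L: "bounded_linear (\<lambda>z::complex. z)" by simp
  have [measurable]: "?t \<alpha> \<in> borel_measurable borel" for \<alpha>
    using tensor_differentiable[OF B L] by (intro differentiable_borel_measurable)
  have i: "integrable lborel (\<lambda>x. ?t \<alpha> x * of_real (f x))" if f: "integrable lborel f" for \<alpha> and f :: "R3 \<Rightarrow> real"
  proof -
    have [measurable]: "f \<in> borel_measurable borel" using f by auto
    obtain K where K: "\<And>x. norm (?t \<alpha> x) \<le> K" using bd by blast
    show ?thesis
    proof (rule Bochner_Integration.integrable_bound)
      show "integrable lborel (\<lambda>x. K * norm (f x))" using f by simp
      have "norm (?t \<alpha> x) * \<bar>f x\<bar> \<le> K * \<bar>f x\<bar>" for x by (intro mult_right_mono K) auto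
      then show "AE x in lborel. norm (?t \<alpha> x * of_real (f x)) \<le> norm (K * norm (f x))"
        by (intro AE_I2) (auto simp: norm_mult intro: order_trans[OF _ abs_ge_self])
    qed measurable
  qed
  have Lt: "L (LINT x|lborel. ?t \<alpha> x * of_real (f x)) = (LINT x|lborel. tensor L B \<alpha> x *\<^sub>R f x)"
    if f: "integrable lborel f" and L: "L = Re \<or> L = Im" for L \<alpha> and f :: "R3 \<Rightarrow> real"
  proof -
    have "bounded_linear L" using L bounded_linear_Re bounded_linear_Im by auto
    from integral_bounded_linear[OF this i[OF f], of \<alpha>]
    have "L (LINT x|lborel. ?t \<alpha> x * of_real (f x)) = (LINT x|lborel. L (?t \<alpha> x * of_real (f x)))" by simp
    moreover have "L (?t \<alpha> x * of_real (f x)) = tensor L B \<alpha> x *\<^sub>R f x" for x using L by (auto simp: tensor_def)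
    ultimately show ?thesis by simp
  qed
  have eq: "L (LINT x|lborel. ?t (\<lambda>_. 0) x * of_real (g x)) = L ((- 1) ^ msize \<beta> * (LINT x|lborel. ?t \<beta> x * of_real (u x)))"
    if L: "L = Re \<or> L = Im" for L
  proof -
    have bl: "bounded_linear L" using L bounded_linear_Re bounded_linear_Im by auto
    have "test_function (tensor L B (\<lambda>_. 0))" by (rule test_function_tensor[OF B bl out r])
    then have "(LINT x|lborel. tensor L B (\<lambda>_. 0) x *\<^sub>R g x)
      = (- 1) ^ msize \<beta> *\<^sub>R (LINT x|lborel. mpd \<beta> (tensor L B (\<lambda>_. 0)) x *\<^sub>R u x)"
      using w unfolding has_weak_deriv_def by blast
    also have "\<dots> = (- 1) ^ msize \<beta> *\<^sub>R L (LINT x|lborel. ?t \<beta> x * of_real (u x))"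
      unfolding mpd_tensor[OF B bl] Lt[OF u L] ..
    also have "\<dots> = L ((- 1) ^ msize \<beta> * (LINT x|lborel. ?t \<beta> x * of_real (u x)))"
      using L by (cases "even (msize \<beta>)") auto
    finally show ?thesis unfolding Lt[OF g L] .
  qed
  show ?thesis by (rule complex_eqI) (use eq in blast)+
qed

text \<open>For a weak derivative \<open>g = \<partial>\<^sub>i\<^sup>6 u\<close> the transform of \<open>g\<close> is \<open>(i k\<^sub>i)\<^sup>6\<close> times that of \<open>u\<close>. This follows
from the definition with a cut off plane wave as the test function, by dominated convergence.\<close>

lemma fourier_integral_weak_deriv:
  fixes u g :: "R3 \<Rightarrow> real"
  assumes w: "has_weak_deriv (\<lambda>j. if j = i then 6 else 0) u g" and u: "integrable lborel u" and g: "integrable lborel g"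
  shows "\<bar>k $ i\<bar> ^ 6 * norm (fourier_integral (\<lambda>x. of_real (u x)) k) \<le> (LINT x|lborel. norm (g x))"
proof -
  let ?\<beta> = "\<lambda>j. if j = i then 6 else (0::nat)"
  let ?t = "\<lambda>N. tensor (\<lambda>z. z) (cutoff_wave k N)"
  let ?c = "of_real (exp (- 2)) ^ 3 :: complex"
  have msize: "msize ?\<beta> = 6" by (simp add: msize_def)
  have bd: "\<exists>K. \<forall>N x. norm (?t N \<alpha> x) \<le> K" for \<alpha>
  proof -
    have "\<forall>j. \<exists>K. \<forall>N x. norm (cutoff_wave k N j (\<alpha> j) x) \<le> K" using cutoff_wave_bounded by blast
    then obtain K where K: "\<forall>j N x. norm (cutoff_wave k N j (\<alpha> j) x) \<le> K j" by metis
    have "norm (?t N \<alpha> x) \<le> (\<Prod>j\<in>UNIV. K j)" for N x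
      unfolding tensor_def prod_norm[symmetric] by (intro prod_mono) (auto simp: K)
    then show ?thesis by blast
  qed
  have lim: "(\<lambda>N. ?t N \<alpha> x) \<longlonglongrightarrow> ?c * ((\<Prod>j\<in>UNIV. (- \<i> * of_real (k $ j)) ^ \<alpha> j) * wave (- x) k)" for \<alpha> x
  proof -
    have "(\<lambda>N. ?t N \<alpha> x) \<longlonglongrightarrow>
       (\<Prod>j\<in>UNIV. of_real (exp (- 2)) * ((- \<i> * of_real (k $ j)) ^ \<alpha> j * exp ((- \<i> * of_real (k $ j)) * of_real (x $ j))))"
      unfolding tensor_def by (intro tendsto_prod cutoff_wave_tendsto)
    moreover have "(\<Prod>j\<in>UNIV. exp ((- \<i> * of_real (k $ j)) * of_real (x $ j))) = wave (- x) k"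
      unfolding exp_sum[OF finite, symmetric]
      by (simp add: wave_def inner_vec_def sum_negf sum_distrib_left mult.assoc)
    ultimately show ?thesis unfolding prod.distrib by simp
  qed
  have lim_int: "(\<lambda>N. LINT x|lborel. ?t N \<alpha> x * of_real (f x)) \<longlonglongrightarrow>
     (LINT x|lborel. ?c * ((\<Prod>j\<in>UNIV. (- \<i> * of_real (k $ j)) ^ \<alpha> j) * wave (- x) k) * of_real (f x))"
    if f: "integrable lborel f" for f :: "R3 \<Rightarrow> real" and \<alpha>
  proof -
    have [measurable]: "f \<in> borel_measurable borel" using f by auto
    obtain K where K: "\<And>N x. norm (?t N \<alpha> x) \<le> K" using bd by blast
    have [measurable]: "?t N \<alpha> \<in> borel_measurable borel" for N
      by (intro differentiable_borel_measurable tensor_differentiable) (auto simp: derivative_seq_cutoff_wave)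
    show ?thesis
    proof (rule integral_dominated_convergence)
      show "integrable lborel (\<lambda>x. K * norm (f x))" using f by simp
      show "AE x in lborel. (\<lambda>N. ?t N \<alpha> x * of_real (f x)) \<longlonglongrightarrow> ?c * ((\<Prod>j\<in>UNIV. (- \<i> * of_real (k $ j)) ^ \<alpha> j) * wave (- x) k) * of_real (f x)"
        by (intro AE_I2 tendsto_mult tendsto_const lim)
      show "AE x in lborel. norm (?t N \<alpha> x * of_real (f x)) \<le> K * norm (f x)" for N
        by (intro AE_I2) (simp add: norm_mult mult_right_mono K)
    qed measurable
  qed
  have "(LINT x|lborel. ?t N (\<lambda>_. 0) x * of_real (g x)) = (- 1) ^ msize ?\<beta> * (LINT x|lborel. ?t N ?\<beta> x * of_real (u x))" for N
  proof (rule weak_deriv_complex[OF w u g, where r="real (Suc N)"])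
    show "\<exists>K. \<forall>x. norm (?t N \<alpha> x) \<le> K" for \<alpha> using bd[of \<alpha>] by blast
  qed (auto simp: derivative_seq_cutoff_wave cutoff_wave_outside)
  then have "(\<lambda>N. LINT x|lborel. ?t N (\<lambda>_. 0) x * of_real (g x)) \<longlonglongrightarrow>
     (LINT x|lborel. ?c * ((\<Prod>j\<in>UNIV. (- \<i> * of_real (k $ j)) ^ ?\<beta> j) * wave (- x) k) * of_real (u x))"
    unfolding msize using lim_int[OF u, of ?\<beta>] by simp
  from LIMSEQ_unique[OF this lim_int[OF g]]
  have "(LINT x|lborel. ?c * ((\<Prod>j\<in>UNIV. (- \<i> * of_real (k $ j)) ^ ?\<beta> j) * wave (- x) k) * of_real (u x))
    = (LINT x|lborel. ?c * ((\<Prod>j\<in>UNIV. (- \<i> * of_real (k $ j)) ^ 0) * wave (- x) k) * of_real (g x))" .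
  moreover have "(\<Prod>j\<in>UNIV. (- \<i> * of_real (k $ j)) ^ ?\<beta> j) = (- \<i> * of_real (k $ i)) ^ 6"
    by (subst prod.remove[of _ i]) (auto intro!: prod.neutral)
  ultimately have "?c * ((- \<i> * of_real (k $ i)) ^ 6 * (LINT x|lborel. wave (- x) k * of_real (u x)))
    = ?c * (LINT x|lborel. wave (- x) k * of_real (g x))" by (simp add: mult.assoc)
  then have eq: "(- \<i> * of_real (k $ i)) ^ 6 * fourier_integral (\<lambda>x. of_real (u x)) k = (LINT x|lborel. wave (- x) k * of_real (g x))"
    unfolding fourier_integral_wave wave_minus_swap[of k] by simp
  have "\<bar>k $ i\<bar> ^ 6 * norm (fourier_integral (\<lambda>x. of_real (u x)) k) = norm (LINT x|lborel. wave (- x) k * of_real (g x))"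
    unfolding eq[symmetric] by (simp add: norm_mult norm_power)
  also have "\<dots> \<le> (LINT x|lborel. norm (g x))"
    by (rule order_trans[OF integral_norm_bound]) (simp add: norm_mult)
  finally show ?thesis .
qed

section \<open>Fourier transforms of gradients\<close>

lemma norm_cvec [simp]: "norm (cvec u) = norm u"
  by (simp add: cvec_def norm_vec_def)

lemma bounded_linear_cvec: "bounded_linear cvec"
  by (rule bounded_linear_intro[where K=1]) (auto simp: cvec_def vec_eq_iff scaleR_conv_of_real[where 'a=complex] simp flip: norm_cvec)

lemma borel_measurable_cvec [measurable]: "cvec \<in> borel_measurable borel"
  by (intro borel_measurable_continuous_onI linear_continuous_on bounded_linear_cvec)

lemma pd_of_real:
  fixes u :: "R3 \<Rightarrow> real"
  assumes "u differentiable (at x)"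
  shows "(\<lambda>x. of_real (u x) :: complex) differentiable (at x)" "pd i (\<lambda>x. of_real (u x) :: complex) x = of_real (pd i u x)"
proof -
  have D: "((\<lambda>x. of_real (u x) :: complex) has_derivative (\<lambda>h. of_real (frechet_derivative u (at x) h))) (at x)"
    using assms by (intro has_derivative_of_real) (simp add: frechet_derivative_works)
  then show "(\<lambda>x. of_real (u x) :: complex) differentiable (at x)" by (auto simp: differentiable_def)
  show "pd i (\<lambda>x. of_real (u x) :: complex) x = of_real (pd i u x)"
    unfolding pd_def frechet_derivative_at[OF D, symmetric] ..
qed

lemma ft_gradient:
  fixes S :: "R3 \<Rightarrow> real"
  assumes d: "\<And>x. S differentiable (at x)" and S: "integrable lborel S" and gS: "integrable lborel (grad S)"
  shows "ft (\<lambda>y. cvec (grad S y)) k = (\<i> * fourier_integral (\<lambda>x. of_real (S x)) k) *s cvec k"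
proof (subst vec_eq_iff, intro allI)
  fix i
  let ?\<psi> = "\<lambda>x. of_real (S x) :: complex"
  have c: "integrable lborel (\<lambda>y. cvec (grad S y))" by (rule integrable_bounded_linear[OF bounded_linear_cvec gS])
  have comp: "integrable lborel (\<lambda>y. grad S y $ i)" by (rule integrable_bounded_linear[OF bounded_linear_vec_nth gS])
  then have "integrable lborel (\<lambda>y. pd i S y)" by (simp add: grad_def)
  then have pdi: "integrable lborel (pd i ?\<psi>)" unfolding pd_of_real(2)[OF d, abs_def] by simp
  have "ft (\<lambda>y. cvec (grad S y)) k $ i = (LINT y|lborel. (wave (- y) k *s cvec (grad S y)) $ i)"
    unfolding ft_def by (intro integral_bounded_linear[OF bounded_linear_vec_nth, symmetric] integrable_wave_vscale c) auto
  also have "\<dots> = fourier_integral (pd i ?\<psi>) k"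
    unfolding fourier_integral_wave pd_of_real(2)[OF d] by (simp add: cvec_def grad_def wave_minus_swap[of k])
  also have "\<dots> = \<i> * of_real (k $ i) * fourier_integral ?\<psi> k"
    using S by (intro fourier_integral_pd pd_of_real d pdi) auto
  finally show "ft (\<lambda>y. cvec (grad S y)) k $ i = ((\<i> * fourier_integral ?\<psi> k) *s cvec k) $ i"
    by (simp add: cvec_def)
qed

text \<open>The transform of the gradient is \<open>i k\<close> times that of \<open>S\<close>, which costs one of the six powers.\<close>

lemma norm_ft_gradient_le:
  fixes S :: "R3 \<Rightarrow> real"
  assumes d: "\<And>x. S differentiable (at x)" and S: "integrable lborel S" "(LINT x|lborel. norm (S x)) \<le> c" and gS: "integrable lborel (grad S)"
    and w: "\<And>i. \<exists>g. has_weak_deriv (\<lambda>j. if j = i then 6 else 0) S g \<and> integrable lborel g \<and> (LINT x|lborel. norm (g x)) \<le> c"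
  shows "norm (ft (\<lambda>y. cvec (grad S y)) k) \<le> 64 * c / jb k ^ 5"
proof -
  let ?F = "fourier_integral (\<lambda>x. of_real (S x)) k"
  have "norm ?F \<le> 64 * c / jb k ^ 6"
  proof (rule le_inverse_jb6)
    show "norm ?F \<le> c" using norm_fourier_integral_le[of "\<lambda>x. of_real (S x)" k] S(2) by simp
    fix i
    obtain g where g: "has_weak_deriv (\<lambda>j. if j = i then 6 else 0) S g" "integrable lborel g" "(LINT x|lborel. norm (g x)) \<le> c"
      using w by blast
    show "\<bar>k $ i\<bar> ^ 6 * norm ?F \<le> c" using fourier_integral_weak_deriv[OF g(1) S(1) g(2), of k] g(3) by linarith
  qed simp
  then have "norm ?F * norm k \<le> 64 * c / jb k ^ 6 * jb k"
    using norm_less_jb[of k] by (intro mult_mono) (auto intro: order_trans[OF norm_ge_zero])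
  also have "\<dots> = 64 * c / jb k ^ 5" by (simp add: eval_nat_numeral)
  finally show ?thesis unfolding ft_gradient[OF d S(1) gS] by (simp add: norm_complex_vscale norm_mult)
qed

text \<open>The definition of \<open>Linf_multiplier\<close> asks for an integrable \<open>ft u\<close>. A Gaussian cutoff provides this
without increasing the bound of \<open>u\<close>, and it is removed by dominated convergence, the product
\<open>m k *s ft u k\<close> being integrable.\<close>

lemma Linf_multiplier_ft_bound:
  fixes u :: "R3 \<Rightarrow> C3"
  assumes m: "Linf_multiplier B m" and u: "integrable lborel u" and M: "AE x in lborel. norm (u x) \<le> M"
    and mu: "integrable lborel (\<lambda>k. m k *s ft u k)"
  shows "norm (LINT k|lborel. (wave x k * m k) *s ft u k) \<le> B * ((2 * pi) ^ 3 * M)"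
proof -
  note [measurable] = borel_measurable_ft[OF u] Linf_multiplierD(1)[OF m]
  let ?s = "\<lambda>n. 1 / real (Suc n)"
  let ?f = "\<lambda>n k. (wave x k * m k) *s (of_real (gauss (?s n) k) *s ft u k)"
  have le: "norm (LINT k|lborel. ?f n k) \<le> B * ((2 * pi) ^ 3 * M)" for n
  proof (rule Linf_multiplierD(3)[OF m])
    show "integrable lborel (\<lambda>k. of_real (gauss (?s n) k) *s ft u k)"
      by (rule integrable_vscale_bounded_right[OF integrable_gauss _ norm_ft_le[OF u]]) auto
    show "norm (LINT k|lborel. wave y k *s (of_real (gauss (?s n) k) *s ft u k)) \<le> (2 * pi) ^ 3 * M" for y
      by (rule norm_ft_gauss_inverse_le[OF u M]) simp
  qed
  have "(\<lambda>n. LINT k|lborel. ?f n k) \<longlonglongrightarrow> (LINT k|lborel. (wave x k * m k) *s ft u k)"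
  proof (rule integral_dominated_convergence)
    show "integrable lborel (\<lambda>k. norm (m k *s ft u k))" by (rule integrable_norm[OF mu])
    show "AE k in lborel. (\<lambda>n. ?f n k) \<longlonglongrightarrow> (wave x k * m k) *s ft u k"
    proof (rule AE_I2)
      fix k
      have "(\<lambda>n. ?f n k) \<longlonglongrightarrow> (wave x k * m k) *s (of_real 1 *s ft u k)"
        by (intro bounded_bilinear.tendsto[OF bounded_bilinear_vscale] tendsto_const tendsto_of_real tendsto_gauss)
      then show "(\<lambda>n. ?f n k) \<longlonglongrightarrow> (wave x k * m k) *s ft u k" by simp
    qed
    show "AE k in lborel. norm (?f n k) \<le> norm (m k *s ft u k)" for n
    proof (rule AE_I2)
      fix k
      have "norm (m k) * (\<bar>gauss (?s n) k\<bar> * norm (ft u k)) \<le> norm (m k) * (1 * norm (ft u k))"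
        using gauss_bounds[of "?s n" k] by (intro mult_left_mono mult_right_mono) auto
      then show "norm (?f n k) \<le> norm (m k *s ft u k)" by (simp add: norm_complex_vscale norm_mult)
    qed
  qed measurable
  then show ?thesis using le by (intro Lim_bounded[OF tendsto_norm]) auto
qed

section \<open>Inverse Fourier integrals\<close>

lemma norm_wave_remainder_le:
  "norm (wave h k - 1 - \<i> * of_real (k \<bullet> h)) \<le> 2 * (norm k * norm h)"
  "norm (wave h k - 1 - \<i> * of_real (k \<bullet> h)) \<le> (norm k * norm h)\<^sup>2"
proof -
  let ?t = "k \<bullet> h"
  have t: "\<bar>?t\<bar> \<le> norm k * norm h" by (rule Cauchy_Schwarz_ineq2)
  have 0: "norm (wave h k - 1) \<le> \<bar>?t\<bar>"
    using iexp_approx1[of ?t 0] by (simp add: wave_def)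
  have "norm (wave h k - 1 - \<i> * of_real ?t) \<le> norm (wave h k - 1) + norm (\<i> * of_real ?t)" by (rule norm_triangle_ineq4)
  also have "\<dots> \<le> \<bar>?t\<bar> + \<bar>?t\<bar>" using 0 by (simp add: norm_mult)
  finally show "norm (wave h k - 1 - \<i> * of_real ?t) \<le> 2 * (norm k * norm h)" using t by simp
  have "norm (wave h k - 1 - \<i> * of_real ?t) \<le> ?t\<^sup>2 / 2"
    using iexp_approx1[of ?t 1] by (simp add: wave_def power2_eq_square diff_diff_eq)
  also have "\<dots> \<le> (norm k * norm h)\<^sup>2"
  proof -
    have "?t\<^sup>2 \<le> (norm k * norm h)\<^sup>2" using t by (metis abs_ge_zero power2_abs power_mono)
    then show ?thesis using zero_le_power2[of "norm k * norm h"] by linarith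
  qed
  finally show "norm (wave h k - 1 - \<i> * of_real ?t) \<le> (norm k * norm h)\<^sup>2" .
qed

lemma inverse_ft_continuous:
  fixes H :: "R3 \<Rightarrow> C3"
  assumes H: "integrable lborel H"
  shows "continuous_on UNIV (\<lambda>x. LINT k|lborel. wave x k *s H k)"
  unfolding continuous_on_sequentially
proof (intro allI ballI impI, elim conjE)
  have [measurable]: "H \<in> borel_measurable borel" using H by auto
  fix X :: "nat \<Rightarrow> R3" and x assume X: "X \<longlonglongrightarrow> x"
  have "(\<lambda>n. LINT k|lborel. wave (X n) k *s H k) \<longlonglongrightarrow> (LINT k|lborel. wave x k *s H k)"
  proof (rule integral_dominated_convergence)
    show "integrable lborel (\<lambda>k. norm (H k))" using H by simp
    show "AE k in lborel. (\<lambda>n. wave (X n) k *s H k) \<longlonglongrightarrow> wave x k *s H k"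
      unfolding wave_def
      by (intro AE_I2 bounded_bilinear.tendsto[OF bounded_bilinear_vscale] tendsto_intros X)
    show "AE k in lborel. norm (wave (X n) k *s H k) \<le> norm (H k)" for n
      by (simp add: norm_complex_vscale)
  qed measurable
  then show "((\<lambda>x. LINT k|lborel. wave x k *s H k) \<circ> X) \<longlonglongrightarrow> (LINT k|lborel. wave x k *s H k)"
    by (simp add: o_def)
qed

lemma inverse_ft_has_derivative:
  fixes H :: "R3 \<Rightarrow> C3"
  assumes H: "integrable lborel H" and kH: "integrable lborel (\<lambda>k. norm k * norm (H k))"
  shows "((\<lambda>x. LINT k|lborel. wave x k *s H k) has_derivative (\<lambda>h. LINT k|lborel. (wave x k * (\<i> * of_real (k \<bullet> h))) *s H k)) (at x)"
  unfolding has_derivative_at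
proof (intro conjI)
  have [measurable]: "H \<in> borel_measurable borel" using H by auto
  let ?f = "\<lambda>x k. wave x k *s H k" and ?d = "\<lambda>h k. (wave x k * (\<i> * of_real (k \<bullet> h))) *s H k"
  have fi: "integrable lborel (?f x)" for x by (rule integrable_wave_vscale[OF _ _ H]) auto
  have dn: "norm (?d h k) \<le> norm h * (norm k * norm (H k))" for h k
    using mult_right_mono[OF Cauchy_Schwarz_ineq2[of k h], of "norm (H k)"]
    by (simp add: norm_complex_vscale norm_mult mult_ac)
  have di: "integrable lborel (?d h)" for h
    by (rule Bochner_Integration.integrable_bound[OF integrable_mult_right[OF kH, of "norm h"]])
      (use dn in \<open>auto simp: abs_mult\<close>)
  show "bounded_linear (\<lambda>h. LINT k|lborel. ?d h k)"
  proof (rule bounded_linear_intro[where K="LINT k|lborel. norm k * norm (H k)"])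
    fix h h' and r :: real
    have "?d (h + h') k = ?d h k + ?d h' k" for k
      by (simp add: inner_add_right distrib_left vector_sadd_rdistrib)
    then show "(LINT k|lborel. ?d (h + h') k) = (LINT k|lborel. ?d h k) + (LINT k|lborel. ?d h' k)"
      using di by simp
    have "?d (r *\<^sub>R h) k = r *\<^sub>R ?d h k" for k
      by (simp add: of_real_vscale[symmetric] mult_ac)
    then show "(LINT k|lborel. ?d (r *\<^sub>R h) k) = r *\<^sub>R (LINT k|lborel. ?d h k)" by simp
    have "norm (LINT k|lborel. ?d h k) \<le> (LINT k|lborel. norm h * (norm k * norm (H k)))"
      by (rule norm_integral_le_AE) (use kH dn in auto)
    then show "norm (LINT k|lborel. ?d h k) \<le> norm h * (LINT k|lborel. norm k * norm (H k))" by simp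
  qed
  show "((\<lambda>h. norm ((LINT k|lborel. ?f (x + h) k) - (LINT k|lborel. ?f x k) - (LINT k|lborel. ?d h k)) / norm h) \<longlongrightarrow> 0) (at 0)"
    unfolding tendsto_at_iff_sequentially
  proof (intro allI impI)
    fix Y :: "nat \<Rightarrow> R3" assume Y0: "\<forall>i. Y i \<in> UNIV - {0}" and Y: "Y \<longlonglongrightarrow> 0"
    let ?r = "\<lambda>n k. (1 / norm (Y n)) *\<^sub>R ((wave x k * (wave (Y n) k - 1 - \<i> * of_real (k \<bullet> Y n))) *s H k)"
    have r: "?r n k = (1 / norm (Y n)) *\<^sub>R (?f (x + Y n) k - ?f x k - ?d (Y n) k)" for n k
      by (simp add: wave_add algebra_simps vector_sub_rdistrib)
    have "(\<lambda>n. LINT k|lborel. ?r n k) \<longlonglongrightarrow> integral\<^sup>L lborel (\<lambda>k::R3. 0)"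
    proof (rule integral_dominated_convergence)
      show "integrable lborel (\<lambda>k. 2 * (norm k * norm (H k)))" using kH by simp
      have nr: "norm (?r n k) = norm (wave (Y n) k - 1 - \<i> * of_real (k \<bullet> Y n)) / norm (Y n) * norm (H k)" for n k
        by (simp add: norm_complex_vscale norm_mult)
      have Yp: "0 < norm (Y n)" for n using Y0 by auto
      show "AE k in lborel. norm (?r n k) \<le> 2 * (norm k * norm (H k))" for n
      proof (rule AE_I2)
        fix k
        have "norm (wave (Y n) k - 1 - \<i> * of_real (k \<bullet> Y n)) / norm (Y n) \<le> 2 * norm k"
          using norm_wave_remainder_le(1)[of "Y n" k] Yp[of n] by (simp add: field_simps)
        from mult_right_mono[OF this, of "norm (H k)"]
        show "norm (?r n k) \<le> 2 * (norm k * norm (H k))" unfolding nr by simp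
      qed
      show "AE k in lborel. (\<lambda>n. ?r n k) \<longlonglongrightarrow> 0"
      proof (rule AE_I2)
        fix k
        show "(\<lambda>n. ?r n k) \<longlonglongrightarrow> 0"
        proof (rule Lim_null_comparison)
          have "norm (?r n k) \<le> (norm k)\<^sup>2 * norm (Y n) * norm (H k)" for n
          proof -
            have "norm (wave (Y n) k - 1 - \<i> * of_real (k \<bullet> Y n)) / norm (Y n) \<le> (norm k)\<^sup>2 * norm (Y n)"
              using norm_wave_remainder_le(2)[of "Y n" k] Yp[of n] by (simp add: field_simps power2_eq_square)
            from mult_right_mono[OF this, of "norm (H k)"] show ?thesis unfolding nr by simp
          qed
          then show "\<forall>\<^sub>F n in sequentially. norm (?r n k) \<le> (norm k)\<^sup>2 * norm (Y n) * norm (H k)" by simp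
          have "(\<lambda>n. (norm k)\<^sup>2 * norm (Y n) * norm (H k)) \<longlonglongrightarrow> (norm k)\<^sup>2 * norm (0::R3) * norm (H k)"
            by (intro tendsto_intros Y)
          then show "(\<lambda>n. (norm k)\<^sup>2 * norm (Y n) * norm (H k)) \<longlonglongrightarrow> 0" by simp
        qed
      qed
    qed measurable
    then have "(\<lambda>n. norm (LINT k|lborel. ?r n k)) \<longlonglongrightarrow> 0"
      unfolding Bochner_Integration.integral_zero by (rule tendsto_norm_zero)
    moreover have "norm (LINT k|lborel. ?r n k) = norm ((LINT k|lborel. ?f (x + Y n) k) - (LINT k|lborel. ?f x k) - (LINT k|lborel. ?d (Y n) k)) / norm (Y n)" for n
      unfolding r integral_scaleR_right using fi di
      by (simp add: Bochner_Integration.integral_diff Bochner_Integration.integrable_diff)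
    ultimately show "((\<lambda>h. norm ((LINT k|lborel. ?f (x + h) k) - (LINT k|lborel. ?f x k) - (LINT k|lborel. ?d h k)) / norm h) \<circ> Y) \<longlonglongrightarrow> 0"
      unfolding o_def by (simp only:)
  qed
qed

section \<open>Relativistic velocities\<close>

text \<open>The matrix \<open>\<nabla>\<^sub>v vhat v\<close>, applied to \<open>h\<close>.\<close>

definition vhat_deriv :: "R3 \<Rightarrow> R3 \<Rightarrow> R3" where
  "vhat_deriv v h = (1 / jb v) *\<^sub>R h - ((v \<bullet> h) / jb v ^ 3) *\<^sub>R v"

lemma vhat_has_derivative: "(vhat has_derivative vhat_deriv v) (at v)"
proof -
  have 1: "((\<lambda>v :: R3. 1 + v \<bullet> v) has_derivative (\<lambda>h. 2 * (v \<bullet> h))) (at v)"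
    by (auto intro!: derivative_eq_intros simp: inner_commute)
  have 2: "(sqrt has_derivative (\<lambda>h. (inverse (sqrt (1 + v \<bullet> v)) / 2) * h)) (at (1 + v \<bullet> v))"
    using DERIV_real_sqrt[of "1 + v \<bullet> v"] unfolding has_field_derivative_def by (simp only: add_pos_nonneg zero_less_one inner_ge_zero)
  have 3: "jb = (\<lambda>v :: R3. sqrt (1 + v \<bullet> v))"
    by (simp add: jb_def[abs_def] power2_norm_eq_inner)
  have 4: "(inverse (sqrt (1 + v \<bullet> v)) / 2) * (2 * (v \<bullet> h)) = (v \<bullet> h) / jb v" for h
    unfolding 3 by (simp add: field_simps)
  have J: "(jb has_derivative (\<lambda>h. (v \<bullet> h) / jb v)) (at v)"
    using has_derivative_compose[OF 1 2] unfolding 4 unfolding 3 .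
  have "((\<lambda>v. inverse (jb v) *\<^sub>R v) has_derivative
     (\<lambda>h. inverse (jb v) *\<^sub>R h + (- (inverse (jb v) * ((v \<bullet> h) / jb v) * inverse (jb v))) *\<^sub>R v)) (at v)"
    by (rule has_derivative_scaleR[OF Deriv.has_derivative_inverse[OF jb_nonzero J] has_derivative_ident])
  moreover have "inverse (jb v) * ((v \<bullet> h) / jb v) * inverse (jb v) = (v \<bullet> h) / jb v ^ 3" for h
    by (simp add: inverse_eq_divide power3_eq_cube)
  ultimately show ?thesis
    unfolding vhat_deriv_def[abs_def] vhat_def[abs_def] inverse_eq_divide by (simp only: scaleR_minus_left add_uminus_conv_diff)
qed

lemma frechet_derivative_vhat: "frechet_derivative vhat (at v) = vhat_deriv v"
  using frechet_derivative_at[OF vhat_has_derivative] by simp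

lemma norm_vhat_deriv_le: "norm (vhat_deriv v h) \<le> 2 * norm h"
proof -
  have "norm (vhat_deriv v h) \<le> norm ((1 / jb v) *\<^sub>R h) + norm (((v \<bullet> h) / jb v ^ 3) *\<^sub>R v)"
    unfolding vhat_deriv_def by (rule norm_triangle_ineq4)
  also have "norm ((1 / jb v) *\<^sub>R h) \<le> 1 * norm h"
    using mult_left_mono[OF jb_ge_1[of v], of "norm h"] by (simp add: divide_le_eq abs_of_pos)
  also have "norm (((v \<bullet> h) / jb v ^ 3) *\<^sub>R v) \<le> 1 * norm h"
  proof -
    have "\<bar>v \<bullet> h\<bar> * norm v \<le> (jb v * norm h) * jb v"
      using norm_less_jb[of v] Cauchy_Schwarz_ineq2[of v h]
      by (intro mult_mono order_trans[OF Cauchy_Schwarz_ineq2] mult_right_mono) (auto simp: less_imp_le)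
    also have "\<dots> \<le> jb v ^ 3 * norm h"
      using mult_right_mono[of 1 "jb v" "jb v * jb v * norm h"] by (simp add: power3_eq_cube mult_ac less_imp_le)
    finally show ?thesis by (simp add: divide_le_eq abs_of_pos mult_ac)
  qed
  finally show ?thesis by simp
qed

lemma borel_measurable_vhat [measurable]: "vhat \<in> borel_measurable borel"
  unfolding vhat_def[abs_def] by measurable

lemma borel_measurable_vhat_deriv [measurable (raw)]:
  assumes [measurable]: "v \<in> borel_measurable M" "h \<in> borel_measurable M"
  shows "(\<lambda>x. vhat_deriv (v x) (h x)) \<in> borel_measurable M"
  unfolding vhat_deriv_def by measurable

lemma resolvent_denominator_nonzero:
  assumes "\<sigma> \<in> {1, -1}" shows "lam \<sigma> k + \<i> * of_real (k \<bullet> vhat v) \<noteq> 0"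
proof -
  have b: "norm (\<sigma> *\<^sub>R vhat v) < 1" using assms norm_vhat_less_1 by auto
  have "0 < jb k + k \<bullet> (\<sigma> *\<^sub>R vhat v)" using inner_abs_less_jb[OF b, of k] by linarith
  moreover have "lam \<sigma> k + \<i> * of_real (k \<bullet> vhat v) = \<i> * of_real \<sigma> * of_real (jb k + k \<bullet> (\<sigma> *\<^sub>R vhat v))"
    using assms by (auto simp: lam_def algebra_simps)
  ultimately show ?thesis using assms by (auto simp del: of_real_add)
qed

lemma phi_symbol_has_vector_derivative:
  assumes \<sigma>: "\<sigma> \<in> {1, -1}" and V: "(V has_vector_derivative e) (at s within A)"
  shows "((\<lambda>s. phi_symbol \<sigma> 1 (V s) k) has_vector_derivative
     (- (\<i> * of_real (k \<bullet> vhat_deriv (V s) e) * phi_symbol \<sigma> 2 (V s) k))) (at s within A)"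
proof -
  let ?u = "\<lambda>s. lam \<sigma> k + \<i> * of_real (k \<bullet> vhat (V s))"
  have "((vhat \<circ> V) has_vector_derivative vhat_deriv (V s) e) (at s within A)"
    using vector_derivative_diff_chain_within[OF V has_derivative_at_withinI[OF vhat_has_derivative]] .
  then have "((\<lambda>s. k \<bullet> vhat (V s)) has_vector_derivative k \<bullet> vhat_deriv (V s) e) (at s within A)"
    using bounded_linear.has_vector_derivative[OF bounded_linear_inner_right, of "vhat \<circ> V"] by (simp add: o_def)
  then have "((\<lambda>s. of_real (k \<bullet> vhat (V s)) :: complex) has_vector_derivative of_real (k \<bullet> vhat_deriv (V s) e)) (at s within A)"
    using bounded_linear.has_vector_derivative[OF bounded_linear_of_real] by blast
  then have u: "(?u has_vector_derivative \<i> * of_real (k \<bullet> vhat_deriv (V s) e)) (at s within A)"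
    using has_vector_derivative_add[OF has_vector_derivative_const has_vector_derivative_mult_right] by fastforce
  have "((\<lambda>z. inverse z) has_field_derivative - (inverse (?u s) ^ Suc (Suc 0))) (at (?u s) within ?u ` A)"
    by (rule DERIV_inverse[OF resolvent_denominator_nonzero[OF \<sigma>]])
  from field_vector_diff_chain_within[OF u this]
  show ?thesis by (simp add: o_def phi_symbol_def inverse_eq_divide power2_eq_square)
qed

section \<open>Integration by parts along a characteristic\<close>

lemma FTC_Lebesgue:
  fixes F :: "real \<Rightarrow> 'a::euclidean_space"
  assumes ab: "a \<le> b" and F: "\<And>x. x \<in> {a..b} \<Longrightarrow> (F has_vector_derivative F' x) (at x within {a..b})"
    and i: "set_integrable lborel {a..b} F'"
  shows "(LINT x:{a..b}|lborel. F' x) = F b - F a"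
  using set_borel_integral_eq_integral(2)[OF i] fundamental_theorem_of_calculus[OF ab F]
  by (simp add: integral_unique)

lemma set_integrable_bounded:
  fixes F :: "real \<Rightarrow> 'b::{banach, second_countable_topology}"
  assumes [measurable]: "F \<in> borel_measurable borel" and "\<And>x. x \<in> {a..b} \<Longrightarrow> norm (F x) \<le> M"
  shows "set_integrable lborel {a..b} F"
  unfolding set_integrable_def
proof (rule Bochner_Integration.integrable_bound)
  show "integrable lborel (\<lambda>x. indicator {a..b} x *\<^sub>R M)"
    by (intro integrable_scaleR_left integrable_real_indicator) (auto simp: emeasure_lborel_Icc_eq)
  show "AE x in lborel. norm (indicator {a..b} x *\<^sub>R F x) \<le> norm (indicator {a..b} x *\<^sub>R M)"
    using assms(2) by (intro AE_I2) (force simp: indicator_def)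
qed measurable

text \<open>The function \<open>h\<close> is an integral of a merely bounded and measurable \<open>q\<close> and need not be differentiable,
so that the product rule is not available. Instead, the integral of
\<open>\<Phi>'\<close> against \<open>h - h a\<close> is a double integral over the triangle \<open>a \<le> r \<le> x \<le> b\<close>, and Fubini's theorem
exchanges the order.\<close>

lemma integration_by_parts_vscale:
  fixes \<Phi> \<Phi>' :: "real \<Rightarrow> complex" and q :: "real \<Rightarrow> C3"
  assumes ab: "a \<le> b" and D: "\<And>x. x \<in> {a..b} \<Longrightarrow> (\<Phi> has_vector_derivative \<Phi>' x) (at x within {a..b})"
    and [measurable]: "\<Phi>' \<in> borel_measurable borel" "\<Phi> \<in> borel_measurable borel" "q \<in> borel_measurable borel"
    and M: "\<And>x. x \<in> {a..b} \<Longrightarrow> norm (\<Phi>' x) \<le> M" "\<And>x. x \<in> {a..b} \<Longrightarrow> norm (q x) \<le> N" "\<And>x. x \<in> {a..b} \<Longrightarrow> norm (\<Phi> x) \<le> L"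
    and h: "\<And>x. x \<in> {a..b} \<Longrightarrow> h x = h a + (LINT r:{a..x}|lborel. q r)"
  shows "(LINT x:{a..b}|lborel. \<Phi>' x *s h x + \<Phi> x *s q x) = \<Phi> b *s h b - \<Phi> a *s h a"
proof -
  let ?I = "\<lambda>x. indicator {a..b} x :: real"
  have i\<Phi>: "set_integrable lborel {r..b} \<Phi>'" if "r \<in> {a..b}" for r
    by (rule set_integrable_bounded[where M=M]) (use that M in auto)
  let ?F = "\<lambda>x r. (if a \<le> r \<and> r \<le> x \<and> x \<le> b then \<Phi>' x else 0) *s q r"
  have int: "integrable (lborel \<Otimes>\<^sub>M lborel) (case_prod ?F)"
  proof (rule Bochner_Integration.integrable_bound)
    show "integrable (lborel \<Otimes>\<^sub>M lborel) (\<lambda>x. indicator ({a..b} \<times> {a..b}) x *\<^sub>R (M * N))"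
      using ab by (intro integrable_scaleR_left integrable_real_indicator) (auto simp: lborel.emeasure_pair_measure_Times ennreal_mult_less_top emeasure_lborel_Icc_eq)
    show "AE p in lborel \<Otimes>\<^sub>M lborel. norm (case p of (x, r) \<Rightarrow> ?F x r) \<le> norm (indicator ({a..b} \<times> {a..b}) p *\<^sub>R (M * N))"
    proof (rule AE_I2)
      fix p :: "real \<times> real"
      obtain x r where p: "p = (x, r)" by fastforce
      show "norm (case p of (x, r) \<Rightarrow> ?F x r) \<le> norm (indicator ({a..b} \<times> {a..b}) p *\<^sub>R (M * N))"
      proof (cases "x \<in> {a..b} \<and> r \<in> {a..b}")
        case True
        have "norm (\<Phi>' x) * norm (q r) \<le> M * N"
          using True M by (intro mult_mono) (auto intro: order_trans[OF norm_ge_zero])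
        then show ?thesis using True
          by (auto simp: p norm_complex_vscale norm_mult indicator_def intro: order_trans[OF _ abs_ge_self] order_trans[OF mult_nonneg_nonneg])
      qed (auto simp: p)
    qed
    have "(\<lambda>p. ?F (fst p) (snd p)) \<in> borel_measurable (lborel \<Otimes>\<^sub>M lborel)" by measurable
    then show "case_prod ?F \<in> borel_measurable (lborel \<Otimes>\<^sub>M lborel)" by (simp add: case_prod_beta')
  qed
  have q: "integrable lborel (\<lambda>r. ?I r *\<^sub>R q r)"
    using set_integrable_bounded[of q a b N] M by (simp add: set_integrable_def)
  have qx: "set_integrable lborel {a..x} q" if "x \<in> {a..b}" for x
    by (rule set_integrable_bounded[where M=N]) (use that M in auto)
  have step1: "(LINT r|lborel. ?F x r) = ?I x *\<^sub>R (\<Phi>' x *s (h x - h a))" for x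
  proof (cases "x \<in> {a..b}")
    case True
    have "(LINT r|lborel. ?F x r) = (LINT r|lborel. \<Phi>' x *s (indicator {a..x} r *\<^sub>R q r))"
      using True by (intro Bochner_Integration.integral_cong refl) (auto simp: indicator_def)
    also have "\<dots> = \<Phi>' x *s (h x - h a)"
      using qx[OF True] by (subst integral_vscale_right) (auto simp: set_integrable_def set_lebesgue_integral_def h[OF True])
    finally show ?thesis using True by simp
  next
    case False
    then have "(\<lambda>r. ?F x r) = (\<lambda>r. 0)" by (auto simp: fun_eq_iff)
    then have "(LINT r|lborel. ?F x r) = 0" by (simp only: Bochner_Integration.integral_zero)
    then show ?thesis using False by simp
  qed
  have step2: "(LINT x|lborel. ?F x r) = ?I r *\<^sub>R ((\<Phi> b - \<Phi> r) *s q r)" for r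
  proof (cases "r \<in> {a..b}")
    case True
    have "(LINT x|lborel. ?F x r) = (LINT x|lborel. (indicator {r..b} x *\<^sub>R \<Phi>' x) *s q r)"
      using True by (intro Bochner_Integration.integral_cong refl) (auto simp: indicator_def)
    also have "\<dots> = (LINT x:{r..b}|lborel. \<Phi>' x) *s q r"
      using i\<Phi>[OF True] by (subst integral_vscale_left) (auto simp: set_integrable_def set_lebesgue_integral_def)
    also have "(LINT x:{r..b}|lborel. \<Phi>' x) = \<Phi> b - \<Phi> r"
      using True by (intro FTC_Lebesgue i\<Phi> has_vector_derivative_within_subset[OF D]) auto
    finally show ?thesis using True by simp
  next
    case False
    then have "(\<lambda>x. ?F x r) = (\<lambda>x. 0)" by (auto simp: fun_eq_iff)
    then have "(LINT x|lborel. ?F x r) = 0" by (simp only: Bochner_Integration.integral_zero)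
    then show ?thesis using False by simp
  qed
  have fub: "(LINT x|lborel. ?I x *\<^sub>R (\<Phi>' x *s (h x - h a))) = (LINT r|lborel. ?I r *\<^sub>R ((\<Phi> b - \<Phi> r) *s q r))"
    using lborel_pair.Fubini_integral[OF int] unfolding step1 step2 by simp
  have i1: "integrable lborel (\<lambda>x. ?I x *\<^sub>R (\<Phi>' x *s (h x - h a)))"
    using lborel_pair.integrable_fst[OF int] unfolding step1 by simp
  have i2: "integrable lborel (\<lambda>x. ?I x *\<^sub>R (\<Phi> x *s q x))"
  proof -
    have "norm (\<Phi> x *s q x) \<le> L * N" if "x \<in> {a..b}" for x
      unfolding norm_complex_vscale using that M by (intro mult_mono) (auto intro: order_trans[OF norm_ge_zero])
    then show ?thesis using set_integrable_bounded[of "\<lambda>x. \<Phi> x *s q x" a b "L * N"] by (simp add: set_integrable_def)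
  qed
  have i3: "integrable lborel (\<lambda>x. ?I x *\<^sub>R \<Phi>' x)" using i\<Phi>[of a] ab by (simp add: set_integrable_def)
  have i3': "integrable lborel (\<lambda>x. (?I x *\<^sub>R \<Phi>' x) *s h a)"
    by (rule integrable_bounded_linear[OF bounded_bilinear.bounded_linear_left[OF bounded_bilinear_vscale] i3])
  have i4: "integrable lborel (\<lambda>r. \<Phi> b *s (?I r *\<^sub>R q r))"
    by (rule integrable_bounded_linear[OF bounded_bilinear.bounded_linear_right[OF bounded_bilinear_vscale] q])
  have J3: "(LINT x|lborel. (?I x *\<^sub>R \<Phi>' x) *s h a) = (\<Phi> b - \<Phi> a) *s h a"
    using integral_vscale_left[OF i3, of "h a"] FTC_Lebesgue[OF ab D i\<Phi>[of a]] ab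
    by (simp add: set_lebesgue_integral_def)
  have J4: "(LINT r|lborel. \<Phi> b *s (?I r *\<^sub>R q r)) = \<Phi> b *s (h b - h a)"
    using integral_vscale_right[OF q, of "\<Phi> b"] h[of b] ab by (simp add: set_lebesgue_integral_def)
  have "(LINT x:{a..b}|lborel. \<Phi>' x *s h x + \<Phi> x *s q x)
     = (LINT x|lborel. (?I x *\<^sub>R \<Phi>' x) *s h a + ?I x *\<^sub>R (\<Phi>' x *s (h x - h a)) + ?I x *\<^sub>R (\<Phi> x *s q x))"
    unfolding set_lebesgue_integral_def
    by (intro Bochner_Integration.integral_cong refl) (simp add: vector_ssub_ldistrib indicator_def)
  also have "\<dots> = (\<Phi> b - \<Phi> a) *s h a + (LINT r|lborel. ?I r *\<^sub>R ((\<Phi> b - \<Phi> r) *s q r)) + (LINT x|lborel. ?I x *\<^sub>R (\<Phi> x *s q x))"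
    unfolding Bochner_Integration.integral_add[OF Bochner_Integration.integrable_add[OF i3' i1] i2]
      Bochner_Integration.integral_add[OF i3' i1] J3 fub ..
  also have "(\<lambda>r. ?I r *\<^sub>R ((\<Phi> b - \<Phi> r) *s q r)) = (\<lambda>r. \<Phi> b *s (?I r *\<^sub>R q r) - ?I r *\<^sub>R (\<Phi> r *s q r))"
    by (auto simp: fun_eq_iff vector_sub_rdistrib indicator_def)
  also have "(LINT r|lborel. \<Phi> b *s (?I r *\<^sub>R q r) - ?I r *\<^sub>R (\<Phi> r *s q r)) = \<Phi> b *s (h b - h a) - (LINT x|lborel. ?I x *\<^sub>R (\<Phi> x *s q x))"
    unfolding Bochner_Integration.integral_diff[OF i4 i2] J4 ..
  finally show ?thesis by (simp add: vector_ssub_ldistrib vector_sub_rdistrib)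
qed

section \<open>Collective fields along characteristics\<close>

lemma borel_measurable_lam [measurable]: "lam \<sigma> \<in> borel_measurable borel"
  unfolding lam_def[abs_def] by measurable

lemma borel_measurable_osc_a [measurable]: "osc_a \<sigma> \<in> borel_measurable borel"
  unfolding osc_a_def[abs_def] by measurable

lemma borel_measurable_phi_symbol [measurable (raw)]:
  assumes [measurable]: "v \<in> borel_measurable M" "k \<in> borel_measurable M"
  shows "(\<lambda>x. phi_symbol \<sigma> j (v x) (k x)) \<in> borel_measurable M"
  unfolding phi_symbol_def by measurable

lemma Re_lam [simp]: "Re (lam \<sigma> k) = 0"
  by (simp add: lam_def)

lemma norm_exp_lam [simp]: "norm (exp (lam \<sigma> k * of_real t)) = 1"
  by (simp add: lam_def)

text \<open>The equation \<open>\<partial>\<^sub>t G = \<lambda>\<^sub>\<plusminus> G + f\<close>, \<open>G 0 = g0\<close>, for each frequency. This is the equation of \<open>E\<^sup>o\<^sup>s\<^sup>c\<^sub>\<plusminus>\<close> on the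
Fourier side. The bound on \<open>f\<close> is uniform in time and integrable in \<open>k\<close>.\<close>

locale oscillatory_source =
  fixes \<sigma> :: real and g0 :: "R3 \<Rightarrow> C3" and f :: "real \<Rightarrow> R3 \<Rightarrow> C3" and K :: real
  assumes sign: "\<sigma> \<in> {1, -1}"
    and g0: "integrable lborel g0"
    and f_measurable: "(\<lambda>(s, k). f s k) \<in> borel_measurable (borel \<Otimes>\<^sub>M borel)"
    and f_bound: "norm (f s k) \<le> K / jb k ^ 6"
begin

definition q :: "real \<Rightarrow> R3 \<Rightarrow> C3" where
  "q r k = exp (lam \<sigma> k * of_real (- r)) *s f r k"

text \<open>The profile \<open>e\<^sup>-\<^sup>\<lambda>\<^sup>t G\<close>, which changes only through the source.\<close>

definition h :: "real \<Rightarrow> R3 \<Rightarrow> C3" where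
  "h t k = g0 k + (LINT r:{0..t}|lborel. q r k)"

definition G :: "real \<Rightarrow> R3 \<Rightarrow> C3" where
  "G t k = exp (lam \<sigma> k * of_real t) *s h t k"

lemma g0_measurable [measurable]: "g0 \<in> borel_measurable borel"
  using g0 by auto

lemma f_measurable' [measurable (raw)]:
  assumes "s \<in> borel_measurable M" "k \<in> borel_measurable M"
  shows "(\<lambda>x. f (s x) (k x)) \<in> borel_measurable M"
  using measurable_compose[OF measurable_Pair[OF assms] f_measurable] by simp

lemma q_measurable [measurable (raw)]:
  assumes [measurable]: "s \<in> borel_measurable M" "k \<in> borel_measurable M"
  shows "(\<lambda>x. q (s x) (k x)) \<in> borel_measurable M"
  unfolding q_def by measurable

lemma q_bound: "norm (q r k) \<le> K / jb k ^ 6"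
  unfolding q_def norm_complex_vscale norm_exp_lam using f_bound by simp

lemma K_nonneg: "0 \<le> K"
  using order_trans[OF norm_ge_zero f_bound[of 0 0]] by (simp add: zero_le_divide_iff)

lemma h_measurable [measurable (raw)]:
  assumes [measurable]: "t \<in> borel_measurable M" "k \<in> borel_measurable M"
  shows "(\<lambda>x. h (t x) (k x)) \<in> borel_measurable M"
proof -
  have "(\<lambda>p. LINT r|lborel. (if 0 \<le> r \<and> r \<le> fst p then 1 else 0) *\<^sub>R q r (snd p)) \<in> borel_measurable (borel \<Otimes>\<^sub>M borel)"
    by measurable
  from measurable_compose[OF measurable_Pair[OF assms] this]
  have "(\<lambda>x. LINT r|lborel. (if 0 \<le> r \<and> r \<le> t x then 1 else 0) *\<^sub>R q r (k x)) \<in> borel_measurable M" by simp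
  moreover have "(if 0 \<le> r \<and> r \<le> t x then 1 else 0) = indicat_real {0..t x} r" for r x by auto
  ultimately show ?thesis unfolding h_def set_lebesgue_integral_def by simp
qed

lemma G_measurable [measurable (raw)]:
  assumes [measurable]: "t \<in> borel_measurable M" "k \<in> borel_measurable M"
  shows "(\<lambda>x. G (t x) (k x)) \<in> borel_measurable M"
  unfolding G_def by measurable

lemma h_bound:
  assumes "0 \<le> t" shows "norm (h t k) \<le> norm (g0 k) + t * K * (1 / jb k ^ 6)"
proof -
  have i: "integrable lborel (\<lambda>r. indicator {0..t} r * (K / jb k ^ 6))"
    by (intro integrable_mult_left integrable_real_indicator) (auto simp: emeasure_lborel_Icc_eq)
  have "norm (LINT r:{0..t}|lborel. q r k) \<le> (LINT r|lborel. indicator {0..t} r * (K / jb k ^ 6))"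
    unfolding set_lebesgue_integral_def
    by (rule norm_integral_le_AE[OF i]) (auto simp: indicator_def q_bound intro!: AE_I2)
  also have "\<dots> = t * K * (1 / jb k ^ 6)" using assms by simp
  finally show ?thesis unfolding h_def by (intro norm_triangle_le) simp
qed

lemma norm_G: "norm (G t k) = norm (h t k)"
  by (simp add: G_def norm_complex_vscale)

lemma integrable_majorant: "integrable lborel (\<lambda>k. norm (g0 k) + t * K * (1 / jb k ^ 6))"
  using g0 by (intro Bochner_Integration.integrable_add integrable_mult_right integrable_inverse_jb6) auto

lemma G_integrable:
  assumes "0 \<le> t" shows "integrable lborel (G t)"
proof (rule Bochner_Integration.integrable_bound[OF integrable_majorant[of t]])
  show "AE k in lborel. norm (G t k) \<le> norm (norm (g0 k) + t * K * (1 / jb k ^ 6))"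
    using h_bound[OF assms] by (intro AE_I2) (auto simp: norm_G intro: order_trans[OF _ abs_ge_self])
qed measurable

lemma f_integrable: "integrable lborel (f s)"
proof (rule Bochner_Integration.integrable_bound)
  show "integrable lborel (\<lambda>k::R3. K * (1 / jb k ^ 6))" by (intro integrable_mult_right integrable_inverse_jb6)
  show "AE k in lborel. norm (f s k) \<le> norm (K * (1 / jb k ^ 6))"
    using f_bound K_nonneg by (intro AE_I2) simp
qed measurable

text \<open>Every exchange of the integrals over time and frequency is justified by this majorant.\<close>

lemma integrable_time_frequency:
  fixes F :: "real \<Rightarrow> R3 \<Rightarrow> C3"
  assumes m: "(\<lambda>p. F (fst p) (snd p)) \<in> borel_measurable (borel \<Otimes>\<^sub>M borel)" and H: "integrable lborel H"
    and le: "\<And>\<tau> k. \<tau> \<in> {a..b} \<Longrightarrow> norm (F \<tau> k) \<le> H k"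
  shows "integrable (lborel \<Otimes>\<^sub>M lborel) (\<lambda>(\<tau>, k). indicator {a..b} \<tau> *\<^sub>R F \<tau> k)"
proof (rule lborel_pair.Fubini_integrable)
  have m' [measurable]: "(\<lambda>p. F (fst p) (snd p)) \<in> borel_measurable (lborel \<Otimes>\<^sub>M lborel)"
    using m by (simp cong: measurable_cong_sets)
  have Fk [measurable]: "F \<tau> \<in> borel_measurable lborel" for \<tau>
    using measurable_compose[OF measurable_Pair1' m, of \<tau> ] by (simp cong: measurable_cong_sets)
  show "(\<lambda>(\<tau>, k). indicator {a..b} \<tau> *\<^sub>R F \<tau> k) \<in> borel_measurable (lborel \<Otimes>\<^sub>M lborel)"
    unfolding case_prod_beta' by measurable
  have Hm [measurable]: "H \<in> borel_measurable lborel" using H by auto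
  have i: "integrable lborel (\<lambda>k. indicator {a..b} \<tau> *\<^sub>R F \<tau> k)" for \<tau>
  proof (cases "\<tau> \<in> {a..b}")
    case True
    have "integrable lborel (F \<tau>)"
      by (rule Bochner_Integration.integrable_bound[OF H Fk])
        (use le[OF True] in \<open>auto intro!: AE_I2 intro: order_trans[OF _ abs_ge_self]\<close>)
    then show ?thesis by simp
  qed simp
  then show "AE \<tau> in lborel. integrable lborel (\<lambda>k. case (\<tau>, k) of (\<tau>, k) \<Rightarrow> indicator {a..b} \<tau> *\<^sub>R F \<tau> k)" by simp
  show "integrable lborel (\<lambda>\<tau>. LINT k|lborel. norm (case (\<tau>, k) of (\<tau>, k) \<Rightarrow> indicator {a..b} \<tau> *\<^sub>R F \<tau> k))"
  proof (rule Bochner_Integration.integrable_bound)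
    show "integrable lborel (\<lambda>\<tau>. indicator {a..b} \<tau> * (LINT k|lborel. H k))"
      by (intro integrable_mult_left integrable_real_indicator) (auto simp: emeasure_lborel_Icc_eq)
    have "(LINT k|lborel. norm (indicator {a..b} \<tau> *\<^sub>R F \<tau> k)) \<le> indicator {a..b} \<tau> * (LINT k|lborel. H k)" for \<tau>
    proof (cases "\<tau> \<in> {a..b}")
      case True
      then show ?thesis using integral_mono[OF integrable_norm[OF i[of \<tau>]] H] le[OF True] by simp
    qed simp
    then show "AE \<tau> in lborel. norm (LINT k|lborel. norm (case (\<tau>, k) of (\<tau>, k) \<Rightarrow> indicator {a..b} \<tau> *\<^sub>R F \<tau> k))
       \<le> norm (indicator {a..b} \<tau> * (LINT k|lborel. H k))"
      by (intro AE_I2) (auto simp del: norm_scaleR intro: order_trans[OF _ abs_ge_self])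
    have "(\<lambda>\<tau>. LINT k|lborel. norm (indicator {a..b} \<tau> *\<^sub>R F (fst (\<tau>, k)) (snd (\<tau>, k)))) \<in> borel_measurable lborel"
      by measurable
    then show "(\<lambda>\<tau>. LINT k|lborel. norm (case (\<tau>, k) of (\<tau>, k) \<Rightarrow> indicator {a..b} \<tau> *\<^sub>R F \<tau> k)) \<in> borel_measurable lborel"
      by simp
  qed
qed

text \<open>The frequencies \<open>G\<close> contain the integral over time; Fubini's theorem moves it outside the integral
over \<open>k\<close>, where it is the convolution in time of the definition of \<open>E\<^sup>o\<^sup>s\<^sup>c\<^sub>\<plusminus>\<close>.\<close>

lemma Duhamel:
  assumes t: "0 \<le> t"
  shows "(LINT k|lborel. wave x k *s G t k) = (LINT k|lborel. (wave x k * exp (lam \<sigma> k * of_real t)) *s g0 k)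
     + (LINT s:{0..t}|lborel. LINT k|lborel. (wave x k * exp (lam \<sigma> k * of_real (t - s))) *s f s k)"
proof -
  let ?F = "\<lambda>s k. (wave x k * exp (lam \<sigma> k * of_real (t - s))) *s f s k"
  have int: "integrable (lborel \<Otimes>\<^sub>M lborel) (case_prod (\<lambda>s k. indicator {0..t} s *\<^sub>R ?F s k))"
  proof (rule integrable_time_frequency)
    show "integrable lborel (\<lambda>k::R3. K * (1 / jb k ^ 6))" by (intro integrable_mult_right integrable_inverse_jb6)
    show "norm (?F s k) \<le> K * (1 / jb k ^ 6)" for s k
      unfolding norm_complex_vscale norm_mult norm_wave norm_exp_lam using f_bound[of s k] by simp
  qed measurable
  have ig: "integrable lborel (\<lambda>k. (wave x k * exp (lam \<sigma> k * of_real t)) *s g0 k)"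
    by (rule integrable_vscale_bounded[OF g0, where B=1]) (auto simp: norm_mult)
  have qi: "integrable lborel (\<lambda>r. indicator {0..t} r *\<^sub>R q r k)" for k
    using set_integrable_bounded[of "\<lambda>r. q r k" 0 t "K / jb k ^ 6"] q_bound by (simp add: set_integrable_def)
  have eq: "wave x k *s G t k = (wave x k * exp (lam \<sigma> k * of_real t)) *s g0 k + (LINT s|lborel. indicator {0..t} s *\<^sub>R ?F s k)" for k
  proof -
    have e: "exp (lam \<sigma> k * of_real t) * exp (lam \<sigma> k * of_real (- s)) = exp (lam \<sigma> k * of_real (t - s))" for s
      by (simp add: exp_add[symmetric] algebra_simps)
    have "(wave x k * exp (lam \<sigma> k * of_real t)) *s (LINT s|lborel. indicator {0..t} s *\<^sub>R q s k)
      = (LINT s|lborel. (wave x k * exp (lam \<sigma> k * of_real t)) *s (indicator {0..t} s *\<^sub>R q s k))"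
      by (rule integral_vscale_right[OF qi, symmetric])
    also have "(\<lambda>s. (wave x k * exp (lam \<sigma> k * of_real t)) *s (indicator {0..t} s *\<^sub>R q s k)) = (\<lambda>s. indicator {0..t} s *\<^sub>R ?F s k)"
    proof (rule ext)
      fix s
      have "(wave x k * exp (lam \<sigma> k * of_real t)) *s q s k = ?F s k"
        unfolding q_def vector_smult_assoc mult.assoc e ..
      then show "(wave x k * exp (lam \<sigma> k * of_real t)) *s (indicator {0..t} s *\<^sub>R q s k) = indicator {0..t} s *\<^sub>R ?F s k"
        by (cases "s \<in> {0..t}") simp_all
    qed
    finally show ?thesis by (simp add: G_def h_def set_lebesgue_integral_def vector_add_ldistrib)
  qed
  have i2: "integrable lborel (\<lambda>k. LINT s|lborel. indicator {0..t} s *\<^sub>R ?F s k)"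
    using lborel_pair.integrable_snd[OF int] by simp
  show ?thesis
    unfolding eq Bochner_Integration.integral_add[OF ig i2] lborel_pair.Fubini_integral[OF int]
    by (simp add: set_lebesgue_integral_def)
qed

text \<open>The field with symbol \<open>(\<lambda>\<^sub>\<plusminus> + i k \<bullet> vhat v)\<^sup>-\<^sup>1\<close> along a curve with \<open>X' = vhat V\<close> and \<open>V' = e\<close>. Write its
frequency \<open>k\<close> as \<open>\<Phi> h\<close>, with the profile \<open>h\<close> and all oscillations in \<open>\<Phi>\<close>. In \<open>\<Phi>'\<close> the derivatives of
\<open>e\<^sup>\<lambda>\<^sup>\<tau>\<close> and of \<open>e\<^sup>i\<^sup>k\<^sup>\<bullet>\<^sup>X\<close> together cancel the denominator; the term with \<open>phi_symbol\<close> of order 2 is the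
derivative of the denominator. The integral over \<open>k\<close> is taken last.\<close>

lemma characteristic_identity:
  fixes X V e :: "real \<Rightarrow> R3"
  assumes ab: "0 \<le> a" "a \<le> b"
    and [measurable]: "X \<in> borel_measurable borel" "V \<in> borel_measurable borel" "e \<in> borel_measurable borel"
    and X: "\<And>\<tau>. \<tau> \<in> {a..b} \<Longrightarrow> (X has_vector_derivative vhat (V \<tau>)) (at \<tau> within {a..b})"
    and V: "\<And>\<tau>. \<tau> \<in> {a..b} \<Longrightarrow> (V has_vector_derivative e \<tau>) (at \<tau> within {a..b})"
    and e: "\<And>\<tau>. \<tau> \<in> {a..b} \<Longrightarrow> norm (e \<tau>) \<le> M"
    and R: "\<And>\<tau>. \<tau> \<in> {a..b} \<Longrightarrow> (jb (V \<tau>))\<^sup>2 \<le> R"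
  defines "W \<equiv> \<lambda>\<tau>. LINT k|lborel. (wave (X \<tau>) k * phi_symbol \<sigma> 1 (V \<tau>) k) *s G \<tau> k"
    and "I \<equiv> \<lambda>\<tau>. (LINT k|lborel. wave (X \<tau>) k *s G \<tau> k)
      - (LINT k|lborel. (wave (X \<tau>) k * (\<i> * of_real (k \<bullet> vhat_deriv (V \<tau>) (e \<tau>)) * phi_symbol \<sigma> 2 (V \<tau>) k)) *s G \<tau> k)
      + (LINT k|lborel. (wave (X \<tau>) k * phi_symbol \<sigma> 1 (V \<tau>) k) *s f \<tau> k)"
  shows "set_integrable lborel {a..b} I" "W b - W a = (LINT \<tau>:{a..b}|lborel. I \<tau>)"
proof -
  let ?w = "\<lambda>\<tau>. vhat_deriv (V \<tau>) (e \<tau>)"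
  let ?d = "\<lambda>\<tau> k. \<i> * of_real (k \<bullet> ?w \<tau>) * phi_symbol \<sigma> 2 (V \<tau>) k"
  define \<Phi> where "\<Phi> \<tau> k = exp (lam \<sigma> k * of_real \<tau>) * (wave (X \<tau>) k * phi_symbol \<sigma> 1 (V \<tau>) k)" for \<tau> k
  define \<Phi>' where "\<Phi>' \<tau> k = exp (lam \<sigma> k * of_real \<tau>) * (wave (X \<tau>) k * (1 - ?d \<tau> k))" for \<tau> k
  have [measurable (raw)]: "(\<lambda>x. \<Phi> (s x) (k x)) \<in> borel_measurable N" "(\<lambda>x. \<Phi>' (s x) (k x)) \<in> borel_measurable N"
    if [measurable]: "s \<in> borel_measurable N" "k \<in> borel_measurable N" for s k and N :: "'z measure"
    unfolding \<Phi>_def \<Phi>'_def by measurable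
  have R0: "0 \<le> R" using R[of a] ab zero_le_power2[of "jb (V a)"] by (intro order_trans[OF _ R]) auto
  have M0: "0 \<le> M" using e[of a] ab norm_ge_zero[of "e a"] by (intro order_trans[OF _ e]) auto
  have phi_le: "norm (phi_symbol \<sigma> j (V \<tau>) k) \<le> (2 * R / jb k) ^ j" if "\<tau> \<in> {a..b}" for \<tau> k j
    by (rule order_trans[OF norm_phi_symbol_le[OF sign] power_mono])
      (use R[OF that] in \<open>auto intro!: divide_right_mono simp: less_imp_le\<close>)
  have phi1_le: "norm (phi_symbol \<sigma> 1 (V \<tau>) k) \<le> 2 * R" if "\<tau> \<in> {a..b}" for \<tau> k
  proof -
    have "2 * R / jb k \<le> 2 * R / 1" using R0 by (intro divide_left_mono) auto
    then show ?thesis using phi_le[OF that, of 1 k] by simp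
  qed
  have d_le: "norm (?d \<tau> k) \<le> 8 * M * R\<^sup>2" if "\<tau> \<in> {a..b}" for \<tau> k
  proof -
    have "norm (?d \<tau> k) = \<bar>k \<bullet> ?w \<tau>\<bar> * norm (phi_symbol \<sigma> 2 (V \<tau>) k)" by (simp add: norm_mult)
    also have "\<dots> \<le> (jb k * (2 * M)) * (2 * R / jb k) ^ 2"
    proof (intro mult_mono phi_le that)
      have "\<bar>k \<bullet> ?w \<tau>\<bar> \<le> norm k * norm (?w \<tau>)" by (rule Cauchy_Schwarz_ineq2)
      also have "\<dots> \<le> jb k * (2 * M)"
        using norm_vhat_deriv_le[of "V \<tau>" "e \<tau>"] e[OF that] norm_less_jb[of k]
        by (intro mult_mono) (auto simp: less_imp_le)
      finally show "\<bar>k \<bullet> ?w \<tau>\<bar> \<le> jb k * (2 * M)" .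
    qed (use M0 in \<open>auto simp: less_imp_le\<close>)
    also have "\<dots> = 8 * M * R\<^sup>2 / jb k" by (simp add: power2_eq_square)
    also have "\<dots> \<le> 8 * M * R\<^sup>2 / 1" using M0 by (intro divide_left_mono) auto
    finally show ?thesis by simp
  qed
  have \<Phi>_le: "norm (\<Phi> \<tau> k) \<le> 2 * R" if "\<tau> \<in> {a..b}" for \<tau> k
    using phi1_le[OF that] by (simp add: \<Phi>_def norm_mult)
  have \<Phi>'_le: "norm (\<Phi>' \<tau> k) \<le> 1 + 8 * M * R\<^sup>2" if "\<tau> \<in> {a..b}" for \<tau> k
  proof -
    have "norm (\<Phi>' \<tau> k) = norm (1 - ?d \<tau> k)" by (simp only: \<Phi>'_def norm_mult norm_exp_lam norm_wave mult_1)
    also have "\<dots> \<le> norm (1::complex) + norm (?d \<tau> k)" by (rule norm_triangle_ineq4)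
    finally show ?thesis using d_le[OF that, of k] by simp
  qed
  have D: "((\<lambda>\<tau>. \<Phi> \<tau> k) has_vector_derivative \<Phi>' \<tau> k) (at \<tau> within {a..b})" if \<tau>: "\<tau> \<in> {a..b}" for \<tau> k
  proof -
    have 1: "((\<lambda>\<tau>. exp (lam \<sigma> k * of_real \<tau>)) has_vector_derivative lam \<sigma> k * exp (lam \<sigma> k * of_real \<tau>)) (at \<tau> within {a..b})"
      by (auto intro!: derivative_eq_intros has_vector_derivative_real_field)
    have "((\<lambda>\<tau>. k \<bullet> X \<tau>) has_vector_derivative k \<bullet> vhat (V \<tau>)) (at \<tau> within {a..b})"
      by (rule bounded_linear.has_vector_derivative[OF bounded_linear_inner_right X[OF \<tau>]])
    from bounded_linear.has_vector_derivative[OF bounded_linear_of_real this]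
    have "((\<lambda>\<tau>. \<i> * of_real (k \<bullet> X \<tau>)) has_vector_derivative \<i> * of_real (k \<bullet> vhat (V \<tau>))) (at \<tau> within {a..b})"
      by (rule has_vector_derivative_mult_right)
    from field_vector_diff_chain_within[OF this DERIV_exp[THEN has_field_derivative_at_within]]
    have 2: "((\<lambda>\<tau>. wave (X \<tau>) k) has_vector_derivative \<i> * of_real (k \<bullet> vhat (V \<tau>)) * wave (X \<tau>) k) (at \<tau> within {a..b})"
      by (simp add: o_def wave_def)
    note 3 = phi_symbol_has_vector_derivative[OF sign V[OF \<tau>], of k]
    have "(lam \<sigma> k + \<i> * of_real (k \<bullet> vhat (V \<tau>))) * phi_symbol \<sigma> 1 (V \<tau>) k = 1"
      using resolvent_denominator_nonzero[OF sign, of k "V \<tau>"] by (simp add: phi_symbol_def)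
    then have "exp (lam \<sigma> k * of_real \<tau>) * (wave (X \<tau>) k * (- ?d \<tau> k) + \<i> * of_real (k \<bullet> vhat (V \<tau>)) * wave (X \<tau>) k * phi_symbol \<sigma> 1 (V \<tau>) k)
        + lam \<sigma> k * exp (lam \<sigma> k * of_real \<tau>) * (wave (X \<tau>) k * phi_symbol \<sigma> 1 (V \<tau>) k) = \<Phi>' \<tau> k"
      unfolding \<Phi>'_def by algebra
    then show ?thesis
      using has_vector_derivative_mult[OF 1 has_vector_derivative_mult[OF 2 3]] unfolding \<Phi>_def by (simp only:)
  qed
  have qi: "set_integrable lborel {c..d} (\<lambda>r. q r k)" for c d k
    by (rule set_integrable_bounded[OF _ q_bound]) measurable
  have hsplit: "h \<tau> k = h a k + (LINT r:{a..\<tau>}|lborel. q r k)" if "\<tau> \<in> {a..b}" for \<tau> k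
  proof (cases "\<tau> = a")
    case False
    then have at: "a < \<tau>" using that by auto
    have "(LINT r:{0..\<tau>}|lborel. q r k) = (LINT r:{0..a} \<union> {a..\<tau>}|lborel. q r k)"
      using ab at by (simp add: ivl_disj_un_two_touch)
    also have "\<dots> = (LINT r:{0..a}|lborel. q r k) + (LINT r:{a..\<tau>}|lborel. q r k)"
    proof (rule set_integral_Un_AE)
      show "AE x in lborel. \<not> (x \<in> {0..a} \<and> x \<in> {a..\<tau>})"
        using AE_lborel_singleton[of a] by eventually_elim auto
    qed (use qi in auto)
    finally show ?thesis by (simp add: h_def)
  next
    case True
    have "(LINT r:{a..a}|lborel. q r k) = 0"
      unfolding set_lebesgue_integral_def
    proof (rule integral_eq_zero_AE)
      show "AE r in lborel. indicat_real {a..a} r *\<^sub>R q r k = 0"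
        using AE_lborel_singleton[of a] by eventually_elim (auto simp: indicator_def)
    qed
    then show ?thesis using True by simp
  qed
  let ?J = "\<lambda>\<tau> k. \<Phi>' \<tau> k *s h \<tau> k + \<Phi> \<tau> k *s q \<tau> k"
  have parts: "\<Phi> b k *s h b k - \<Phi> a k *s h a k = (LINT \<tau>:{a..b}|lborel. ?J \<tau> k)" for k
  proof (rule integration_by_parts_vscale[symmetric])
    show "norm (q \<tau> k) \<le> K / jb k ^ 6" for \<tau> by (rule q_bound)
    show "h \<tau> k = h a k + (LINT r:{a..\<tau>}|lborel. q r k)" if "\<tau> \<in> {a..b}" for \<tau> by (rule hsplit[OF that])
    show "norm (\<Phi>' \<tau> k) \<le> 1 + 8 * M * R\<^sup>2" "norm (\<Phi> \<tau> k) \<le> 2 * R" if "\<tau> \<in> {a..b}" for \<tau>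
      using \<Phi>'_le[OF that] \<Phi>_le[OF that] by auto
  qed (use ab D in auto)
  let ?H = "\<lambda>k. (1 + 8 * M * R\<^sup>2) * (norm (g0 k) + b * K * (1 / jb k ^ 6)) + 2 * R * (K * (1 / jb k ^ 6))"
  have Hi: "integrable lborel ?H"
    by (intro Bochner_Integration.integrable_add integrable_mult_right integrable_majorant integrable_inverse_jb6)
  have int: "integrable (lborel \<Otimes>\<^sub>M lborel) (case_prod (\<lambda>\<tau> k. indicator {a..b} \<tau> *\<^sub>R ?J \<tau> k))"
  proof (rule integrable_time_frequency[OF _ Hi])
    fix \<tau> k assume \<tau>: "\<tau> \<in> {a..b}"
    have "norm (h \<tau> k) \<le> norm (g0 k) + b * K * (1 / jb k ^ 6)"
      using \<tau> ab K_nonneg by (intro order_trans[OF h_bound] add_left_mono mult_right_mono) (auto simp: less_imp_le)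
    then have A: "norm (\<Phi>' \<tau> k *s h \<tau> k) \<le> (1 + 8 * M * R\<^sup>2) * (norm (g0 k) + b * K * (1 / jb k ^ 6))"
      unfolding norm_complex_vscale using \<Phi>'_le[OF \<tau>, of k] M0 by (intro mult_mono) auto
    have "norm (q \<tau> k) \<le> K * (1 / jb k ^ 6)" using q_bound[of \<tau> k] by simp
    then have B: "norm (\<Phi> \<tau> k *s q \<tau> k) \<le> 2 * R * (K * (1 / jb k ^ 6))"
      unfolding norm_complex_vscale using \<Phi>_le[OF \<tau>, of k] R0 by (intro mult_mono) auto
    show "norm (?J \<tau> k) \<le> ?H k" by (rule norm_triangle_le[OF add_mono[OF A B]])
  qed measurable
  have JI: "(LINT k|lborel. ?J \<tau> k) = I \<tau>" if \<tau>: "\<tau> \<in> {a..b}" for \<tau>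
  proof -
    have Gi: "integrable lborel (G \<tau>)" using \<tau> ab by (intro G_integrable) auto
    have i1: "integrable lborel (\<lambda>k. wave (X \<tau>) k *s G \<tau> k)" by (rule integrable_wave_vscale[OF _ _ Gi]) auto
    have i2: "integrable lborel (\<lambda>k. (wave (X \<tau>) k * ?d \<tau> k) *s G \<tau> k)"
    proof (rule integrable_vscale_bounded[OF Gi])
      show "norm (wave (X \<tau>) k * ?d \<tau> k) \<le> 8 * M * R\<^sup>2" for k
        using d_le[OF \<tau>, of k] by (simp only: norm_mult norm_wave mult_1)
    qed measurable
    have i3: "integrable lborel (\<lambda>k. (wave (X \<tau>) k * phi_symbol \<sigma> 1 (V \<tau>) k) *s f \<tau> k)"
    proof (rule integrable_vscale_bounded[OF f_integrable])
      show "norm (wave (X \<tau>) k * phi_symbol \<sigma> 1 (V \<tau>) k) \<le> 2 * R" for k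
        using phi1_le[OF \<tau>, of k] by (simp only: norm_mult norm_wave mult_1)
    qed measurable
    have e1: "exp (lam \<sigma> k * of_real \<tau>) * exp (lam \<sigma> k * of_real (- \<tau>)) = 1" for k
      by (simp add: exp_add[symmetric])
    have "?J \<tau> k = wave (X \<tau>) k *s G \<tau> k - (wave (X \<tau>) k * ?d \<tau> k) *s G \<tau> k + (wave (X \<tau>) k * phi_symbol \<sigma> 1 (V \<tau>) k) *s f \<tau> k" for k
    proof -
      have "\<Phi> \<tau> k *s q \<tau> k = (exp (lam \<sigma> k * of_real \<tau>) * exp (lam \<sigma> k * of_real (- \<tau>)) * (wave (X \<tau>) k * phi_symbol \<sigma> 1 (V \<tau>) k)) *s f \<tau> k"
        by (simp add: \<Phi>_def q_def mult_ac)
      moreover have "\<Phi>' \<tau> k *s h \<tau> k = wave (X \<tau>) k *s G \<tau> k - (wave (X \<tau>) k * ?d \<tau> k) *s G \<tau> k"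
        unfolding \<Phi>'_def G_def vector_smult_assoc vector_sub_rdistrib[symmetric]
        by (rule arg_cong[where f="\<lambda>c. c *s h \<tau> k"]) (simp add: algebra_simps)
      ultimately show ?thesis unfolding e1 by simp
    qed
    then show ?thesis
      unfolding I_def using Bochner_Integration.integral_add[OF Bochner_Integration.integrable_diff[OF i1 i2] i3]
        Bochner_Integration.integral_diff[OF i1 i2] by simp
  qed
  have eqI: "(\<lambda>\<tau>. LINT k|lborel. indicator {a..b} \<tau> *\<^sub>R ?J \<tau> k) = (\<lambda>\<tau>. indicator {a..b} \<tau> *\<^sub>R I \<tau>)"
    using JI by (auto simp: fun_eq_iff indicator_def)
  show "set_integrable lborel {a..b} I"
    using lborel_pair.integrable_fst[OF int] unfolding set_integrable_def eqI[symmetric] by simp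
  have W\<Phi>: "W \<tau> = (LINT k|lborel. \<Phi> \<tau> k *s h \<tau> k)" for \<tau>
    unfolding W_def by (intro Bochner_Integration.integral_cong refl) (simp add: \<Phi>_def G_def mult_ac)
  have \<Phi>hi: "integrable lborel (\<lambda>k. \<Phi> \<tau> k *s h \<tau> k)" if \<tau>: "\<tau> \<in> {a..b}" for \<tau>
  proof -
    have "integrable lborel (\<lambda>k. (wave (X \<tau>) k * phi_symbol \<sigma> 1 (V \<tau>) k) *s G \<tau> k)"
    proof (rule integrable_vscale_bounded[OF G_integrable])
      show "norm (wave (X \<tau>) k * phi_symbol \<sigma> 1 (V \<tau>) k) \<le> 2 * R" for k
        using phi1_le[OF \<tau>, of k] by (simp only: norm_mult norm_wave mult_1)
    qed (use \<tau> ab in auto)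
    then show ?thesis by (simp add: \<Phi>_def G_def mult_ac)
  qed
  have "W b - W a = (LINT k|lborel. \<Phi> b k *s h b k - \<Phi> a k *s h a k)"
    unfolding W\<Phi> using \<Phi>hi[of a] \<Phi>hi[of b] ab by simp
  also have "\<dots> = (LINT k|lborel. LINT \<tau>|lborel. indicator {a..b} \<tau> *\<^sub>R ?J \<tau> k)"
    unfolding parts set_lebesgue_integral_def ..
  also have "\<dots> = (LINT \<tau>|lborel. LINT k|lborel. indicator {a..b} \<tau> *\<^sub>R ?J \<tau> k)"
    by (rule lborel_pair.Fubini_integral[OF int])
  also have "\<dots> = (LINT \<tau>:{a..b}|lborel. I \<tau>)" unfolding eqI set_lebesgue_integral_def ..
  finally show "W b - W a = (LINT \<tau>:{a..b}|lborel. I \<tau>)" .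
qed

end

section \<open>Measurability\<close>

lemma continuous_clamp:
  fixes V :: "real \<Rightarrow> 'a::topological_space"
  assumes "continuous_on {0..t} V" "0 \<le> t"
  shows "continuous_on UNIV (\<lambda>\<tau>. V (max 0 (min t \<tau>)))"
  using assms by (intro continuous_on_compose2[OF assms(1)] continuous_intros) auto

text \<open>A derivative is a limit of difference quotients of a continuous function. This makes the force along
a trajectory measurable, although the field is given for each time separately.\<close>

lemma derivative_measurable:
  fixes V e :: "real \<Rightarrow> R3"
  assumes t: "0 \<le> t" and V: "\<And>\<tau>. \<tau> \<in> {0..t} \<Longrightarrow> (V has_vector_derivative e \<tau>) (at \<tau> within {0..t})"
  shows "(\<lambda>\<tau>. indicator {0..t} \<tau> *\<^sub>R e \<tau>) \<in> borel_measurable borel"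
proof -
  let ?V = "\<lambda>\<tau>. V (max 0 (min t \<tau>))"
  have "continuous_on {0..t} V"
    unfolding continuous_on_eq_continuous_within using has_vector_derivative_continuous[OF V] by blast
  from continuous_clamp[OF this t] have [measurable]: "?V \<in> borel_measurable borel"
    by (rule borel_measurable_continuous_onI)
  have "(\<lambda>\<tau>. indicator {0..<t} \<tau> *\<^sub>R e \<tau>) \<in> borel_measurable borel"
  proof (rule borel_measurable_LIMSEQ_metric)
    show "(\<lambda>\<tau>. indicator {0..<t} \<tau> *\<^sub>R (real (Suc n) *\<^sub>R (?V (\<tau> + 1 / real (Suc n)) - ?V \<tau>))) \<in> borel_measurable borel" for n
      by measurable
    fix \<tau> :: real
    show "(\<lambda>n. indicator {0..<t} \<tau> *\<^sub>R (real (Suc n) *\<^sub>R (?V (\<tau> + 1 / real (Suc n)) - ?V \<tau>))) \<longlonglongrightarrow> indicator {0..<t} \<tau> *\<^sub>R e \<tau>"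
    proof (cases "\<tau> \<in> {0..<t}")
      case True
      let ?y = "\<lambda>n. \<tau> + 1 / real (Suc n)"
      have y: "?y \<longlonglongrightarrow> \<tau>" using tendsto_add[OF tendsto_const LIMSEQ_Suc[OF lim_1_over_n], of \<tau>] by simp
      then have "\<forall>\<^sub>F n in sequentially. ?y n < t" using True by (intro order_tendstoD) auto
      then have ev: "\<forall>\<^sub>F n in sequentially. ?y n \<in> {0..t} \<and> ?y n \<noteq> \<tau>"
        by eventually_elim (use True in \<open>auto simp: add_nonneg_nonneg\<close>)
      have "filterlim ?y (at \<tau> within {0..t}) sequentially"
        unfolding filterlim_at using ev y by simp
      moreover have "((\<lambda>y. (1 / norm (y - \<tau>)) *\<^sub>R (V y - (V \<tau> + (y - \<tau>) *\<^sub>R e \<tau>))) \<longlongrightarrow> 0) (at \<tau> within {0..t})"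
        using V[of \<tau>] True by (simp add: has_vector_derivative_def has_derivative_within)
      ultimately have "(\<lambda>n. (1 / norm (?y n - \<tau>)) *\<^sub>R (V (?y n) - (V \<tau> + (?y n - \<tau>) *\<^sub>R e \<tau>))) \<longlonglongrightarrow> 0"
        by (rule filterlim_compose[rotated])
      from tendsto_add[OF this tendsto_const[of "e \<tau>"]]
      have lim: "(\<lambda>n. (1 / norm (?y n - \<tau>)) *\<^sub>R (V (?y n) - (V \<tau> + (?y n - \<tau>) *\<^sub>R e \<tau>)) + e \<tau>) \<longlonglongrightarrow> e \<tau>" by simp
      have "\<forall>\<^sub>F n in sequentially. (1 / norm (?y n - \<tau>)) *\<^sub>R (V (?y n) - (V \<tau> + (?y n - \<tau>) *\<^sub>R e \<tau>)) + e \<tau>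
         = indicator {0..<t} \<tau> *\<^sub>R (real (Suc n) *\<^sub>R (?V (?y n) - ?V \<tau>))"
        using ev
      proof eventually_elim
        case (elim n)
        have "real (Suc n) *\<^sub>R ((1 / real (Suc n)) *\<^sub>R e \<tau>) = e \<tau>" by simp
        then show ?case using elim True by (simp add: max_def min_def scaleR_diff_right scaleR_add_right del: of_nat_Suc)
      qed
      from Lim_transform_eventually[OF lim this] True show ?thesis by simp
    qed simp
  qed
  moreover have "(\<lambda>\<tau>. indicator {t} \<tau> *\<^sub>R e t) \<in> borel_measurable borel" by measurable
  ultimately have "(\<lambda>\<tau>. indicator {0..<t} \<tau> *\<^sub>R e \<tau> + indicator {t} \<tau> *\<^sub>R e t) \<in> borel_measurable borel" by measurable
  moreover have "indicator {0..<t} \<tau> *\<^sub>R e \<tau> + indicator {t} \<tau> *\<^sub>R e t = indicator {0..t} \<tau> *\<^sub>R e \<tau>" for \<tau>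
    using t by (auto simp: indicator_def)
  ultimately show ?thesis by simp
qed

lemma pd_tendsto:
  fixes u :: "R3 \<Rightarrow> real"
  assumes "u differentiable (at x)"
  shows "(\<lambda>n. real (Suc n) * (u (x + (1 / real (Suc n)) *\<^sub>R axis i 1) - u x)) \<longlonglongrightarrow> pd i u x"
proof -
  have "((\<lambda>t. u (x + t *\<^sub>R axis i 1)) has_real_derivative pd i u x) (at 0)"
    using has_vector_derivative_axis_line[OF assms] by (simp add: has_real_derivative_iff_has_vector_derivative)
  then have "((\<lambda>h. (u (x + h *\<^sub>R axis i 1) - u x) / h) \<longlongrightarrow> pd i u x) (at 0)"
    by (simp add: DERIV_def)
  moreover have "filterlim (\<lambda>n. 1 / real (Suc n)) (at 0) sequentially"
    unfolding filterlim_at using LIMSEQ_Suc[OF lim_1_over_n] by simp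
  ultimately have "(\<lambda>n. (u (x + (1 / real (Suc n)) *\<^sub>R axis i 1) - u x) / (1 / real (Suc n))) \<longlonglongrightarrow> pd i u x"
    by (rule filterlim_compose)
  then show ?thesis by (simp add: mult.commute)
qed

lemma gradient_measurable:
  fixes S :: "real \<Rightarrow> R3 \<Rightarrow> real"
  assumes m: "set_borel_measurable borel (A \<times> UNIV) (\<lambda>(t, x). S t x)"
    and d: "\<And>t x. t \<in> A \<Longrightarrow> S t differentiable (at x)"
  shows "(\<lambda>(t, x). indicator A t *\<^sub>R grad (S t) x) \<in> borel_measurable (borel \<Otimes>\<^sub>M borel)"
proof -
  let ?S = "\<lambda>p :: real \<times> R3. indicator A (fst p) * S (fst p) (snd p)"
  have "(\<lambda>p. indicator (A \<times> UNIV) p *\<^sub>R (case p of (t, x) \<Rightarrow> S t x)) \<in> borel_measurable borel"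
    using m by (simp add: set_borel_measurable_def)
  moreover have "(\<lambda>p. indicator (A \<times> UNIV) p *\<^sub>R (case p of (t, x) \<Rightarrow> S t x)) = ?S"
    by (auto simp: fun_eq_iff indicator_def)
  ultimately have S: "?S \<in> borel_measurable (borel \<Otimes>\<^sub>M borel)" unfolding borel_prod by simp
  have pdm: "(\<lambda>p. indicator A (fst p) * pd i (S (fst p)) (snd p)) \<in> borel_measurable (borel \<Otimes>\<^sub>M borel)" for i
  proof (rule borel_measurable_LIMSEQ_metric)
    fix n
    have shift: "(\<lambda>p :: real \<times> R3. (fst p, snd p + (1 / real (Suc n)) *\<^sub>R axis i 1)) \<in> borel \<Otimes>\<^sub>M borel \<rightarrow>\<^sub>M borel \<Otimes>\<^sub>M borel"
      by measurable
    have S': "(\<lambda>p. indicator A (fst p) * S (fst p) (snd p + (1 / real (Suc n)) *\<^sub>R axis i 1)) \<in> borel_measurable (borel \<Otimes>\<^sub>M borel)"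
      using measurable_compose[OF shift S] by simp
    show "(\<lambda>p. real (Suc n) * (indicator A (fst p) * S (fst p) (snd p + (1 / real (Suc n)) *\<^sub>R axis i 1) - ?S p)) \<in> borel_measurable (borel \<Otimes>\<^sub>M borel)"
      by (rule borel_measurable_times[OF borel_measurable_const borel_measurable_diff[OF S' S]])
  next
    fix p :: "real \<times> R3"
    show "(\<lambda>n. real (Suc n) * (indicator A (fst p) * S (fst p) (snd p + (1 / real (Suc n)) *\<^sub>R axis i 1) - ?S p)) \<longlonglongrightarrow> indicator A (fst p) * pd i (S (fst p)) (snd p)"
    proof (cases "fst p \<in> A")
      case True then show ?thesis using pd_tendsto[OF d[OF True]] by simp
    qed simp
  qed
  have "(\<lambda>p. \<Sum>i\<in>UNIV. (indicator A (fst p) * pd i (S (fst p)) (snd p)) *\<^sub>R axis i (1::real)) \<in> borel_measurable (borel \<Otimes>\<^sub>M borel)"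
    by (intro borel_measurable_sum borel_measurable_scaleR pdm) auto
  moreover have "(\<Sum>i\<in>UNIV. (indicator A (fst p) * pd i (S (fst p)) (snd p)) *\<^sub>R axis i (1::real))
     = indicator A (fst p) *\<^sub>R grad (S (fst p)) (snd p)" for p
  proof -
    have "(\<Sum>i\<in>UNIV. (pd i (S (fst p)) (snd p)) *\<^sub>R axis i (1::real)) = grad (S (fst p)) (snd p)"
      using basis_expansion[of "grad (S (fst p)) (snd p)"] by (simp add: grad_def scalar_mult_eq_scaleR)
    then show ?thesis by (simp add: scaleR_sum_right flip: scaleR_scaleR)
  qed
  ultimately show ?thesis by (simp add: case_prod_beta')
qed

section \<open>Decay in time\<close>

lemma FTC_continuous:
  fixes F f :: "real \<Rightarrow> real"
  assumes ab: "a \<le> b" and F: "\<And>x. x \<in> {a..b} \<Longrightarrow> (F has_real_derivative f x) (at x)" and c: "continuous_on {a..b} f"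
  shows "set_integrable lborel {a..b} f" "(LINT x:{a..b}|lborel. f x) = F b - F a"
proof -
  show i: "set_integrable lborel {a..b} f" unfolding set_integrable_def by (rule borel_integrable_compact) (use c in auto)
  show "(LINT x:{a..b}|lborel. f x) = F b - F a"
    by (rule FTC_Lebesgue[OF ab _ i])
      (use F in \<open>auto simp: has_real_derivative_iff_has_vector_derivative intro: has_vector_derivative_at_within\<close>)
qed

lemma jb_real: "jb (\<tau> :: real) = sqrt (1 + \<tau>\<^sup>2)"
  by (simp add: jb_def)

lemma continuous_on_jb_powr: "continuous_on A (\<lambda>\<tau> :: real. jb \<tau> powr p)"
  unfolding jb_real by (intro continuous_intros) (auto simp: add_pos_nonneg less_imp_neq[THEN not_sym])

text \<open>A primitive of \<open>\<langle>\<tau>\<rangle>\<^sup>-\<^sup>3\<close> is \<open>\<tau> / \<langle>\<tau>\<rangle>\<close>, and \<open>1 - s / \<langle>s\<rangle> = 1 / (\<langle>s\<rangle> (\<langle>s\<rangle> + s)) \<le> \<langle>s\<rangle>\<^sup>-\<^sup>2\<close>.\<close>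

lemma integral_jb_powr_minus_3:
  fixes s t :: real
  assumes "0 \<le> s" "s \<le> t"
  shows "set_integrable lborel {s..t} (\<lambda>\<tau>. jb \<tau> powr (- 3))" "(LINT \<tau>:{s..t}|lborel. jb \<tau> powr (- 3)) \<le> jb s powr (- 2)"
proof -
  let ?F = "\<lambda>\<tau> :: real. \<tau> / sqrt (1 + \<tau>\<^sup>2)"
  have p3: "jb \<tau> powr (- 3) = 1 / jb \<tau> ^ 3" for \<tau> :: real using powr_realpow[OF jb_pos, of \<tau> 3] by (simp add: powr_minus_divide)
  have D: "(?F has_real_derivative jb \<tau> powr (- 3)) (at \<tau>)" for \<tau>
  proof -
    define r where "r = sqrt (1 + \<tau>\<^sup>2)"
    have r: "0 < r" "r\<^sup>2 = 1 + \<tau>\<^sup>2" by (auto simp: r_def add_pos_nonneg)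
    have s: "((\<lambda>\<tau>. sqrt (1 + \<tau>\<^sup>2)) has_real_derivative \<tau> / r) (at \<tau>)"
      using r by (auto intro!: derivative_eq_intros simp: r_def field_simps)
    have "(?F has_real_derivative (1 * sqrt (1 + \<tau>\<^sup>2) - \<tau> * (\<tau> / r)) / (sqrt (1 + \<tau>\<^sup>2) * sqrt (1 + \<tau>\<^sup>2))) (at \<tau>)"
      by (intro DERIV_divide DERIV_ident s) (use r in \<open>simp add: r_def\<close>)
    moreover have "(1 * r - \<tau> * (\<tau> / r)) / (r * r) = 1 / r ^ 3"
    proof -
      have "1 * r - \<tau> * (\<tau> / r) = (r\<^sup>2 - \<tau>\<^sup>2) / r" using r(1) by (simp add: field_simps power2_eq_square)
      then show ?thesis using r by (simp add: power3_eq_cube)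
    qed
    ultimately show ?thesis unfolding p3 unfolding jb_real r_def[symmetric] by simp
  qed
  show "set_integrable lborel {s..t} (\<lambda>\<tau>. jb \<tau> powr (- 3))"
    by (rule FTC_continuous(1)[OF assms(2) D continuous_on_jb_powr])
  have "(LINT \<tau>:{s..t}|lborel. jb \<tau> powr (- 3)) = ?F t - ?F s"
    by (rule FTC_continuous(2)[OF assms(2) D continuous_on_jb_powr])
  also have "\<dots> \<le> 1 - ?F s"
  proof -
    have "t \<le> sqrt (1 + t\<^sup>2)" by (rule real_le_rsqrt) simp
    then show ?thesis by (simp add: divide_le_eq add_pos_nonneg)
  qed
  also have "\<dots> \<le> 1 / (1 + s\<^sup>2)"
  proof -
    define r where "r = sqrt (1 + s\<^sup>2)"
    have r: "1 \<le> r" "r\<^sup>2 = 1 + s\<^sup>2" "s \<le> r" by (auto simp: r_def intro: real_le_rsqrt)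
    have "(r - s) * r \<le> (r - s) * (r + s)" using r assms by (intro mult_left_mono) auto
    also have "\<dots> = 1" using r(2) by (simp add: algebra_simps power2_eq_square)
    finally have "(r - s) * r \<le> 1" .
    then have "((r - s) * r) / r\<^sup>2 \<le> 1 / r\<^sup>2" by (intro divide_right_mono) auto
    moreover have "((r - s) * r) / r\<^sup>2 = 1 - s / r" using r(1) by (simp add: power2_eq_square diff_divide_distrib)
    ultimately have "1 - s / r \<le> 1 / r\<^sup>2" by (simp only:)
    then show ?thesis using r(2) by (simp add: r_def)
  qed
  also have "\<dots> = jb s powr (- 2)"
  proof -
    have "jb s powr (- 2) = 1 / (jb s)\<^sup>2" using powr_realpow[OF jb_pos, of s 2] by (simp add: powr_minus_divide)
    then show ?thesis by (simp add: jb_sq)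
  qed
  finally show "(LINT \<tau>:{s..t}|lborel. jb \<tau> powr (- 3)) \<le> jb s powr (- 2)" .
qed

text \<open>The bracket is at least \<open>(1 + \<tau>) / \<surd>2\<close>, and \<open>(1 + \<tau>)\<^sup>-\<^sup>3\<^sup>/\<^sup>2\<close> has an elementary primitive.\<close>

lemma integral_jb_powr_minus_3_2:
  fixes s t :: real
  assumes "0 \<le> s" "s \<le> t"
  shows "set_integrable lborel {s..t} (\<lambda>\<tau>. jb \<tau> powr (- 3/2))" "(LINT \<tau>:{s..t}|lborel. jb \<tau> powr (- 3/2)) \<le> 4"
proof -
  show i: "set_integrable lborel {s..t} (\<lambda>\<tau>. jb \<tau> powr (- 3/2))"
    unfolding set_integrable_def by (rule borel_integrable_compact) (auto intro: continuous_on_jb_powr)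
  have F: "((\<lambda>\<tau>. - 4 * (1 + \<tau>) powr (- 1/2)) has_real_derivative 2 * (1 + \<tau>) powr (- 3/2)) (at \<tau>)" if "\<tau> \<in> {s..t}" for \<tau>
  proof -
    have "((\<lambda>\<tau>. - 4 * (1 + \<tau>) powr (- 1/2)) has_real_derivative - 4 * ((- 1/2) * (1 + \<tau>) powr (- 1/2 - 1))) (at \<tau>)"
      using that assms by (auto intro!: derivative_eq_intros)
    then show ?thesis by simp
  qed
  have c: "continuous_on {s..t} (\<lambda>\<tau>. 2 * (1 + \<tau>) powr (- 3/2))" using assms by (intro continuous_intros) auto
  note I = FTC_continuous[OF assms(2) F c]
  have le: "jb \<tau> powr (- 3/2) \<le> 2 * (1 + \<tau>) powr (- 3/2)" if "\<tau> \<in> {s..t}" for \<tau>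
  proof -
    have \<tau>: "0 \<le> \<tau>" using that assms by auto
    have "((1 + \<tau>) / sqrt 2)\<^sup>2 \<le> (jb \<tau>)\<^sup>2"
      unfolding jb_sq using sum_squares_bound[of 1 \<tau>] by (simp add: power_divide power2_eq_square algebra_simps)
    then have "(1 + \<tau>) / sqrt 2 \<le> jb \<tau>" by (rule power2_le_imp_le) (simp add: less_imp_le)
    then have "jb \<tau> powr (- 3/2) \<le> ((1 + \<tau>) / sqrt 2) powr (- 3/2)" using \<tau> by (intro powr_mono2') auto
    also have "\<dots> = (1 + \<tau>) powr (- 3/2) * sqrt 2 powr (3/2)" using \<tau> by (simp add: powr_divide powr_minus_divide)
    also have "\<dots> \<le> (1 + \<tau>) powr (- 3/2) * 2"
    proof (rule mult_left_mono)
      have "sqrt 2 powr (3/2) \<le> sqrt 2 powr 2" by (intro powr_mono) auto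
      then show "sqrt 2 powr (3/2) \<le> 2" by simp
    qed simp
    finally show ?thesis by simp
  qed
  have "(LINT \<tau>:{s..t}|lborel. jb \<tau> powr (- 3/2)) \<le> (LINT \<tau>:{s..t}|lborel. 2 * (1 + \<tau>) powr (- 3/2))"
    by (rule set_integral_mono[OF i I(1) le])
  also have "\<dots> = - 4 * (1 + t) powr (- 1/2) - - 4 * (1 + s) powr (- 1/2)" by (rule I(2))
  also have "\<dots> \<le> 4 * (1 + s) powr (- 1/2)" by simp
  also have "(1 + s) powr (- 1/2) \<le> 1" using assms ge_one_powr_ge_zero[of "1 + s" "1/2"] by (simp add: powr_minus_divide divide_le_eq)
  finally show "(LINT \<tau>:{s..t}|lborel. jb \<tau> powr (- 3/2)) \<le> 4" by simp
qed

section \<open>Fields satisfying the bootstrap assumptions\<close>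

text \<open>The differentiability of \<open>E\<close> comes from the equation, \<open>E\<close> being the gradient of a twice
differentiable potential; it is what makes \<open>E\<^sup>r\<close> continuous. With \<open>\<epsilon> \<le> 1\<close> products of two fields are
of size \<open>\<epsilon>\<close>.\<close>

locale bootstrap_field =
  fixes T :: real and \<alpha>0 :: nat and \<epsilon> :: real and S0 :: "R3 \<Rightarrow> real" and S :: "real \<Rightarrow> R3 \<Rightarrow> real"
    and Er E :: "real \<Rightarrow> R3 \<Rightarrow> R3"
  assumes \<alpha>0: "8 \<le> \<alpha>0" and eps: "0 < \<epsilon>" "\<epsilon> \<le> 1"
    and boot: "bootstrap T \<alpha>0 \<epsilon> S0 S Er E"
    and E_differentiable: "t \<in> {0..T} \<Longrightarrow> E t differentiable (at x)"
begin

text \<open>The parts of the assumptions that are used, as statements about functions. The weak derivatives of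
order 6 are the pure ones, of order at most \<open>\<alpha>\<^sub>0 - 1\<close>. Their bound may depend on \<open>T\<close>, since it serves
only for the convergence of integrals; the summand 1 is there because the infimum in
\<open>Lp_deriv_norm\<close> need not be attained.\<close>

lemma
  assumes t: "t \<in> {0..T}"
  shows S_differentiable: "S t differentiable (at x)"
    and E_split: "cvec (E t x) = (\<Sum>\<sigma>\<in>{1, -1}. Eosc S0 S \<sigma> t x) + cvec (Er t x)"
    and S_L1: "integrable lborel (S t)" "(LINT x|lborel. norm (S t x)) \<le> \<epsilon>"
    and gradS_L1: "integrable lborel (grad (S t))"
    and gradS_Linf: "AE x in lborel. norm (grad (S t) x) \<le> \<epsilon> * jb t powr (- 3)"
    and Er_Linf: "AE x in lborel. norm (Er t x) \<le> \<epsilon> * jb t powr (- 3)"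
    and Eosc_Linf: "\<sigma> \<in> {1, -1} \<Longrightarrow> AE x in lborel. norm (Eosc S0 S \<sigma> t x) \<le> \<epsilon> * jb t powr (- 3/2)"
    and S_weak_deriv: "\<exists>g. has_weak_deriv (\<lambda>j. if j = i then 6 else 0) (S t) g \<and> integrable lborel g \<and>
      (LINT x|lborel. norm (g x)) \<le> \<epsilon> * jb T powr (6 / (real \<alpha>0 - 1)) + 1"
proof -
  note B = bspec[OF boot[unfolded bootstrap_def, THEN conjunct2, THEN conjunct2, THEN conjunct2] t]
  show "S t differentiable (at x)" using B by blast
  show "cvec (E t x) = (\<Sum>\<sigma>\<in>{1, -1}. Eosc S0 S \<sigma> t x) + cvec (Er t x)" using B[THEN conjunct2, THEN conjunct2, THEN conjunct1] by blast
  have i: "Lp_norm p (S t) + Lp_norm p (grad (S t)) \<le> ennreal (\<epsilon> * jb t powr (- 3 * (1 - enn2real (1 / p))))" if "1 \<le> p" for p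
    using B[THEN conjunct2, THEN conjunct2, THEN conjunct2, THEN conjunct1] that by blast
  have ii: "Lp_norm p (Er t) \<le> ennreal (\<epsilon> * jb t powr (- 3 * (1 - enn2real (1 / p))))" if "1 \<le> p" for p
    using B[THEN conjunct2, THEN conjunct2, THEN conjunct2, THEN conjunct2, THEN conjunct1] that by blast
  have iii: "Lp_norm p (Eosc S0 S \<sigma> t) \<le> ennreal (\<epsilon> * jb t powr (- 3 * (1/2 - enn2real (1 / p))))" if "\<sigma> \<in> {1, -1}" "2 \<le> p" for p \<sigma>
    using B[THEN conjunct2, THEN conjunct2, THEN conjunct2, THEN conjunct2, THEN conjunct2, THEN conjunct1] that by blast
  have iv: "\<forall>p\<ge>1. Lp_deriv_norm p \<alpha> (S t) + Lp_deriv_norm p \<alpha> (Er t)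
      \<le> ennreal (\<epsilon> * jb t powr (- 3 * (1 - enn2real (1 / p)) + real (msize \<alpha>) / (real \<alpha>0 - 1)))" if "1 \<le> msize \<alpha>" "msize \<alpha> \<le> \<alpha>0 - 1" for \<alpha>
    using B[THEN conjunct2, THEN conjunct2, THEN conjunct2, THEN conjunct2, THEN conjunct2, THEN conjunct2, THEN conjunct1] that by blast
  have one: "Lp_norm 1 (S t) + Lp_norm 1 (grad (S t)) \<le> ennreal \<epsilon>" using i[of 1] by simp
  have le_sum: "a \<le> a + b" "b \<le> a + b" for a b :: ennreal by (auto simp: add_increasing add_increasing2)
  show "integrable lborel (S t)" "(LINT x|lborel. norm (S t x)) \<le> \<epsilon>" "integrable lborel (grad (S t))"
    using Lp_norm_1D[OF order_trans[OF le_sum(1) one]] Lp_norm_1D(1)[OF order_trans[OF le_sum(2) one]] eps by auto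
  have inf: "1 \<le> (\<infinity>::ennreal)" "2 \<le> (\<infinity>::ennreal)" by auto
  have "Lp_norm \<infinity> (S t) + Lp_norm \<infinity> (grad (S t)) \<le> ennreal (\<epsilon> * jb t powr (- 3))" using i[OF inf(1)] by simp
  from Lp_norm_infinityD(2)[OF order_trans[OF le_sum(2) this]]
  show "AE x in lborel. norm (grad (S t) x) \<le> \<epsilon> * jb t powr (- 3)" using eps by simp
  have "Lp_norm \<infinity> (Er t) \<le> ennreal (\<epsilon> * jb t powr (- 3))" using ii[OF inf(1)] by simp
  from Lp_norm_infinityD(2)[OF this]
  show "AE x in lborel. norm (Er t x) \<le> \<epsilon> * jb t powr (- 3)" using eps by simp
  show "AE x in lborel. norm (Eosc S0 S \<sigma> t x) \<le> \<epsilon> * jb t powr (- 3/2)" if \<sigma>: "\<sigma> \<in> {1, -1}"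
  proof -
    have "Lp_norm \<infinity> (Eosc S0 S \<sigma> t) \<le> ennreal (\<epsilon> * jb t powr (- 3/2))" using iii[OF \<sigma> inf(2)] by simp
    from Lp_norm_infinityD(2)[OF this] show ?thesis using eps by simp
  qed
  let ?\<alpha> = "\<lambda>j. if j = i then 6 else (0::nat)"
  have m6: "msize ?\<alpha> = 6" by (simp add: msize_def)
  have "Lp_deriv_norm 1 ?\<alpha> (S t) + Lp_deriv_norm 1 ?\<alpha> (Er t) \<le> ennreal (\<epsilon> * jb t powr (6 / (real \<alpha>0 - 1)))"
  proof -
    have "1 \<le> msize ?\<alpha>" "msize ?\<alpha> \<le> \<alpha>0 - 1" using m6 \<alpha>0 by auto
    from iv[OF this, THEN spec, of 1] show ?thesis by (simp add: m6)
  qed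
  also have "\<dots> \<le> ennreal (\<epsilon> * jb T powr (6 / (real \<alpha>0 - 1)))"
  proof (intro ennreal_leI mult_left_mono powr_mono2)
    show "jb t \<le> jb T" using t unfolding jb_real by (simp add: power_mono)
  qed (use eps \<alpha>0 in \<open>auto simp: less_imp_le\<close>)
  finally have "Lp_deriv_norm 1 ?\<alpha> (S t) \<le> ennreal (\<epsilon> * jb T powr (6 / (real \<alpha>0 - 1)))"
    using le_sum(1) order_trans by blast
  from Lp_deriv_norm_1D[OF this] eps
  show "\<exists>g. has_weak_deriv ?\<alpha> (S t) g \<and> integrable lborel g \<and> (LINT x|lborel. norm (g x)) \<le> \<epsilon> * jb T powr (6 / (real \<alpha>0 - 1)) + 1"
    by (metis less_imp_le mult_nonneg_nonneg powr_ge_zero)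
qed

definition F :: "real \<Rightarrow> R3 \<Rightarrow> C3" where
  "F t x = cvec (grad (S t) x)"

lemma F_L1: "t \<in> {0..T} \<Longrightarrow> integrable lborel (F t)"
  unfolding F_def by (rule integrable_bounded_linear[OF bounded_linear_cvec gradS_L1])

text \<open>A common bound for the \<open>L\<^sup>1\<close> norms of \<open>\<S>\<close> and of its pure weak derivatives of order 6 on the whole time
interval.\<close>

definition decay_const :: real where
  "decay_const = \<epsilon> + \<epsilon> * jb T powr (6 / (real \<alpha>0 - 1)) + 1"

lemma norm_ft_F_le:
  assumes t: "t \<in> {0..T}" shows "norm (ft (F t) k) \<le> 64 * decay_const / jb k ^ 5"
  unfolding F_def
proof (rule norm_ft_gradient_le)
  have nn: "0 \<le> \<epsilon> * jb T powr (6 / (real \<alpha>0 - 1))" using eps by simp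
  show "(LINT x|lborel. norm (S t x)) \<le> decay_const" using S_L1(2)[OF t] nn by (simp add: decay_const_def)
  show "\<exists>g. has_weak_deriv (\<lambda>j. if j = i then 6 else 0) (S t) g \<and> integrable lborel g \<and> (LINT x|lborel. norm (g x)) \<le> decay_const" for i
    using S_weak_deriv[OF t, of i] eps unfolding decay_const_def by (smt (verit))
qed (use t S_differentiable S_L1 gradS_L1 in auto)

text \<open>The convergence of the multiplier for \<open>F\<^sub>0\<close> is assumed for each sign with a transform of its own.\<close>

definition F0_hat :: "real \<Rightarrow> R3 \<Rightarrow> C3" where
  "F0_hat \<sigma> = (SOME g. has_fourier_transform (\<lambda>y. cvec (grad S0 y)) g \<and> integrable lborel (\<lambda>k. osc_a \<sigma> k *s g k))"

lemma F0_hat: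
  assumes "\<sigma> \<in> {1, -1}"
  shows "has_fourier_transform (\<lambda>y. cvec (grad S0 y)) (F0_hat \<sigma>)" "integrable lborel (\<lambda>k. osc_a \<sigma> k *s F0_hat \<sigma> k)"
proof -
  have "multiplier_converges (osc_a \<sigma>) (\<lambda>y. cvec (grad S0 y))"
    using boot[unfolded bootstrap_def, THEN conjunct2, THEN conjunct1] assms by blast
  then have "\<exists>g. has_fourier_transform (\<lambda>y. cvec (grad S0 y)) g \<and> integrable lborel (\<lambda>k. osc_a \<sigma> k *s g k)"
    by (simp add: multiplier_converges_def)
  from someI_ex[OF this]
  show "has_fourier_transform (\<lambda>y. cvec (grad S0 y)) (F0_hat \<sigma>)" "integrable lborel (\<lambda>k. osc_a \<sigma> k *s F0_hat \<sigma> k)"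
    unfolding F0_hat_def by blast+
qed

text \<open>The Fourier transforms of the data and of the source of \<open>E\<^sup>o\<^sup>s\<^sup>c\<^sub>\<plusminus>\<close>, including the factor \<open>a\<^sub>\<plusminus>\<close> and the
constant of the inversion formula. The source is extended by 0 outside the time interval, to be
measurable on the whole line.\<close>

definition g0 :: "real \<Rightarrow> R3 \<Rightarrow> C3" where
  "g0 \<sigma> k = (1 / (2 * pi) ^ 3) *\<^sub>R (osc_a \<sigma> k *s F0_hat \<sigma> k)"

definition src :: "real \<Rightarrow> real \<Rightarrow> R3 \<Rightarrow> C3" where
  "src \<sigma> s k = (1 / (2 * pi) ^ 3) *\<^sub>R (osc_a \<sigma> k *s ft (\<lambda>x. indicator {0..T} s *\<^sub>R F s x) k)"

lemma src_eq: "s \<in> {0..T} \<Longrightarrow> src \<sigma> s k = (1 / (2 * pi) ^ 3) *\<^sub>R (osc_a \<sigma> k *s ft (F s) k)"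
  by (simp add: src_def)

definition K :: real where
  "K = (1 / (2 * pi) ^ 3) * (32 * decay_const)"

lemma decay_const_nonneg: "0 \<le> decay_const"
  using eps by (simp add: decay_const_def)

lemma source:
  assumes \<sigma>: "\<sigma> \<in> {1, -1}" shows "oscillatory_source \<sigma> (g0 \<sigma>) (src \<sigma>) K"
proof
  show "\<sigma> \<in> {1, -1}" by (rule \<sigma>)
  show "integrable lborel (g0 \<sigma>)" unfolding g0_def by (intro integrable_scaleR_right F0_hat[OF \<sigma>])
  have "set_borel_measurable borel ({0..T} \<times> UNIV) (\<lambda>(t, x). S t x)"
    using boot[unfolded bootstrap_def, THEN conjunct2, THEN conjunct2, THEN conjunct1] .
  from gradient_measurable[OF this S_differentiable]
  have gm: "(\<lambda>p. indicator {0..T} (fst p) *\<^sub>R grad (S (fst p)) (snd p)) \<in> borel_measurable (borel \<Otimes>\<^sub>M borel)"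
    by (simp add: case_prod_beta')
  have Fm: "(\<lambda>p. indicator {0..T} (fst p) *\<^sub>R F (fst p) (snd p)) \<in> borel_measurable (borel \<Otimes>\<^sub>M borel)"
    using measurable_compose[OF gm borel_measurable_cvec]
    by (simp add: F_def linear_cmul[OF bounded_linear.linear[OF bounded_linear_cvec]])
  have [measurable (raw)]: "(\<lambda>x. indicator {0..T} (s x) *\<^sub>R F (s x) (y x)) \<in> borel_measurable N"
    if "s \<in> borel_measurable N" "y \<in> borel_measurable N" for s y and N :: "'z measure"
    using measurable_compose[OF measurable_Pair[OF that] Fm] by simp
  have "(\<lambda>p. LINT x|lborel. wave (- x) (snd p) *s (indicator {0..T} (fst p) *\<^sub>R F (fst p) x)) \<in> borel_measurable (borel \<Otimes>\<^sub>M borel)"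
    by measurable
  then show "(\<lambda>(s, k). src \<sigma> s k) \<in> borel_measurable (borel \<Otimes>\<^sub>M borel)"
    unfolding src_def ft_def case_prod_beta' by measurable
  fix s k
  show "norm (src \<sigma> s k) \<le> K / jb k ^ 6"
  proof (cases "s \<in> {0..T}")
    case True
    have "norm (src \<sigma> s k) = (1 / (2 * pi) ^ 3) * (1 / (2 * jb k) * norm (ft (F s) k))"
      unfolding src_eq[OF True] by (simp add: norm_complex_vscale norm_osc_a[OF \<sigma>])
    also have "\<dots> \<le> (1 / (2 * pi) ^ 3) * (1 / (2 * jb k) * (64 * decay_const / jb k ^ 5))"
      using norm_ft_F_le[OF True, of k] by (intro mult_left_mono) (auto simp: less_imp_le)
    also have "\<dots> = K / jb k ^ 6" by (simp add: K_def eval_nat_numeral)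
    finally show ?thesis .
  next
    case False
    then show ?thesis using decay_const_nonneg by (simp add: src_def ft_def K_def less_imp_le)
  qed
qed

text \<open>The Fourier transform of \<open>E\<^sup>o\<^sup>s\<^sup>c\<^sub>\<plusminus>\<close>, divided by \<open>(2\<pi>)\<^sup>3\<close>.\<close>

abbreviation osc_hat :: "real \<Rightarrow> real \<Rightarrow> R3 \<Rightarrow> C3" where
  "osc_hat \<sigma> \<equiv> oscillatory_source.G \<sigma> (g0 \<sigma>) (src \<sigma>)"

lemma osc_hat_integrable: "\<sigma> \<in> {1, -1} \<Longrightarrow> 0 \<le> t \<Longrightarrow> integrable lborel (osc_hat \<sigma> t)"
  by (rule oscillatory_source.G_integrable[OF source])

text \<open>Both multipliers are computed from explicit transforms, and Duhamel's formula puts them under one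
absolutely convergent integral.\<close>

lemma Eosc_eq:
  assumes \<sigma>: "\<sigma> \<in> {1, -1}" and t: "t \<in> {0..T}"
  shows "Eosc S0 S \<sigma> t x = (LINT k|lborel. wave x k *s osc_hat \<sigma> t k)"
proof -
  interpret oscillatory_source \<sigma> "g0 \<sigma>" "src \<sigma>" K by (rule source[OF \<sigma>])
  let ?c = "1 / (2 * pi) ^ 3"
  have "multiplier (\<lambda>k. exp (lam \<sigma> k * of_real t) * osc_a \<sigma> k) (\<lambda>y. cvec (grad S0 y)) x
      = ?c *\<^sub>R (LINT k|lborel. (wave x k * (exp (lam \<sigma> k * of_real t) * osc_a \<sigma> k)) *s F0_hat \<sigma> k)"
    by (rule multiplier_eq[OF F0_hat(1)[OF \<sigma>]]) measurable
  also have "\<dots> = (LINT k|lborel. ?c *\<^sub>R ((wave x k * (exp (lam \<sigma> k * of_real t) * osc_a \<sigma> k)) *s F0_hat \<sigma> k))"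
    by (rule Bochner_Integration.integral_scaleR_right[symmetric])
  also have "\<dots> = (LINT k|lborel. (wave x k * exp (lam \<sigma> k * of_real t)) *s g0 \<sigma> k)"
    by (simp add: g0_def of_real_vscale[symmetric] mult_ac)
  finally have 1: "multiplier (\<lambda>k. exp (lam \<sigma> k * of_real t) * osc_a \<sigma> k) (\<lambda>y. cvec (grad S0 y)) x
     = (LINT k|lborel. (wave x k * exp (lam \<sigma> k * of_real t)) *s g0 \<sigma> k)" .
  have 2: "multiplier (\<lambda>k. exp (lam \<sigma> k * of_real (t - s)) * osc_a \<sigma> k) (\<lambda>y. cvec (grad (S s) y)) x
     = (LINT k|lborel. (wave x k * exp (lam \<sigma> k * of_real (t - s))) *s src \<sigma> s k)" if s: "s \<in> {0..T}" for s
  proof -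
    have "multiplier (\<lambda>k. exp (lam \<sigma> k * of_real (t - s)) * osc_a \<sigma> k) (F s) x
        = ?c *\<^sub>R (LINT k|lborel. (wave x k * (exp (lam \<sigma> k * of_real (t - s)) * osc_a \<sigma> k)) *s ft (F s) k)"
      by (rule multiplier_eq[OF has_fourier_transform_ft[OF F_L1[OF s]]]) measurable
    also have "\<dots> = (LINT k|lborel. ?c *\<^sub>R ((wave x k * (exp (lam \<sigma> k * of_real (t - s)) * osc_a \<sigma> k)) *s ft (F s) k))"
      by (rule Bochner_Integration.integral_scaleR_right[symmetric])
    also have "\<dots> = (LINT k|lborel. (wave x k * exp (lam \<sigma> k * of_real (t - s))) *s src \<sigma> s k)"
      unfolding src_eq[OF s] of_real_vscale[symmetric] vector_smult_assoc
      by (intro Bochner_Integration.integral_cong refl arg_cong2[where f="(*s)"]) (simp add: mult_ac)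
    finally show ?thesis unfolding F_def[abs_def] .
  qed
  have 3: "(LINT s:{0..t}|lborel. multiplier (\<lambda>k. exp (lam \<sigma> k * of_real (t - s)) * osc_a \<sigma> k) (\<lambda>y. cvec (grad (S s) y)) x)
     = (LINT s:{0..t}|lborel. LINT k|lborel. (wave x k * exp (lam \<sigma> k * of_real (t - s))) *s src \<sigma> s k)"
    by (rule set_lebesgue_integral_cong) (use 2 t in auto)
  show ?thesis unfolding Eosc_def 1 3 using Duhamel[of t x] t by simp
qed

lemma Eosc_fourier:
  assumes \<sigma>: "\<sigma> \<in> {1, -1}" and t: "t \<in> {0..T}"
  shows "has_fourier_transform (Eosc S0 S \<sigma> t) (\<lambda>k. (2 * pi) ^ 3 *\<^sub>R osc_hat \<sigma> t k)"
  using has_fourier_transform_inverse[OF osc_hat_integrable[OF \<sigma>, of t]] t by (simp add: Eosc_eq[OF \<sigma> t, abs_def])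

lemma Eoscj_eq:
  assumes \<sigma>: "\<sigma> \<in> {1, -1}" and t: "t \<in> {0..T}"
  shows "Eoscj S0 S \<sigma> j t x v = (LINT k|lborel. (wave x k * phi_symbol \<sigma> j v k) *s osc_hat \<sigma> t k)"
proof -
  have "Eoscj S0 S \<sigma> j t x v = (1 / (2 * pi) ^ 3) *\<^sub>R (LINT k|lborel. (wave x k * phi_symbol \<sigma> j v k) *s ((2 * pi) ^ 3 *\<^sub>R osc_hat \<sigma> t k))"
    unfolding Eoscj_def by (rule multiplier_eq[OF Eosc_fourier[OF \<sigma> t]]) measurable
  also have "\<dots> = (LINT k|lborel. (1 / (2 * pi) ^ 3) *\<^sub>R ((wave x k * phi_symbol \<sigma> j v k) *s ((2 * pi) ^ 3 *\<^sub>R osc_hat \<sigma> t k)))"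
    by (rule Bochner_Integration.integral_scaleR_right[symmetric])
  also have "\<dots> = (LINT k|lborel. (wave x k * phi_symbol \<sigma> j v k) *s osc_hat \<sigma> t k)"
  proof (intro Bochner_Integration.integral_cong refl)
    fix k
    have "(1 / (2 * pi) ^ 3) *\<^sub>R (c *s ((2 * pi) ^ 3 *\<^sub>R u)) = c *s u" for c :: complex and u :: C3
      by (simp add: vec_eq_iff)
    then show "(1 / (2 * pi) ^ 3) *\<^sub>R ((wave x k * phi_symbol \<sigma> j v k) *s ((2 * pi) ^ 3 *\<^sub>R osc_hat \<sigma> t k)) = (wave x k * phi_symbol \<sigma> j v k) *s osc_hat \<sigma> t k" .
  qed
  finally show ?thesis .
qed

lemma
  assumes \<sigma>: "\<sigma> \<in> {1, -1}" and t: "t \<in> {0..T}"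
  shows Eosc_continuous: "continuous_on UNIV (Eosc S0 S \<sigma> t)"
    and norm_Eosc_le: "norm (Eosc S0 S \<sigma> t x) \<le> \<epsilon> * jb t powr (- 3/2)"
proof -
  show c: "continuous_on UNIV (Eosc S0 S \<sigma> t)"
    unfolding Eosc_eq[OF \<sigma> t, abs_def] using t by (intro inverse_ft_continuous osc_hat_integrable \<sigma>) auto
  show "norm (Eosc S0 S \<sigma> t x) \<le> \<epsilon> * jb t powr (- 3/2)"
    by (rule continuous_AE_bound[OF c Eosc_Linf[OF t \<sigma>]])
qed

text \<open>The transfer of decay: \<open>E\<^sup>o\<^sup>s\<^sup>c\<^sub>\<plusminus>\<close> is itself the inverse Fourier integral of \<open>osc_hat\<close>, and its pointwise
bound is the hypothesis in the definition of \<open>Linf_multiplier\<close>.\<close>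

lemma Eosc_Linf_multiplier:
  assumes \<sigma>: "\<sigma> \<in> {1, -1}" and t: "t \<in> {0..T}" and m: "Linf_multiplier B m"
  shows "norm (LINT k|lborel. (wave x k * m k) *s osc_hat \<sigma> t k) \<le> B * (\<epsilon> * jb t powr (- 3/2))"
  using norm_Eosc_le[OF \<sigma> t] t
  by (intro Linf_multiplierD(3)[OF m osc_hat_integrable[OF \<sigma>]]) (auto simp: Eosc_eq[OF \<sigma> t])

lemma norm_Eoscj_1_le:
  assumes \<sigma>: "\<sigma> \<in> {1, -1}" and t: "t \<in> {0..T}"
  shows "norm (Eoscj S0 S \<sigma> 1 t x v) \<le> (jb v)\<^sup>2 * (\<epsilon> * jb t powr (- 3/2))"
  unfolding Eoscj_eq[OF \<sigma> t] by (rule Eosc_Linf_multiplier[OF \<sigma> t Linf_multiplier_phi_symbol[OF \<sigma>]])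

text \<open>One derivative in space is compensated by the second order of the symbol, which decays like \<open>\<langle>k\<rangle>\<^sup>-\<^sup>2\<close>;
this justifies differentiation under the integral. The bound is that of the multiplier
\<open>(k \<bullet> w) (\<lambda>\<^sub>\<plusminus> + i k \<bullet> vhat v)\<^sup>-\<^sup>2\<close>.\<close>

lemma
  assumes \<sigma>: "\<sigma> \<in> {1, -1}" and t: "t \<in> {0..T}"
  shows Eoscj_2_derivative: "frechet_derivative (\<lambda>y. Eoscj S0 S \<sigma> 2 t y v) (at x) w
      = (LINT k|lborel. (wave x k * (\<i> * of_real (k \<bullet> w) * phi_symbol \<sigma> 2 v k)) *s osc_hat \<sigma> t k)"
    and norm_Eoscj_2_derivative_le: "norm (frechet_derivative (\<lambda>y. Eoscj S0 S \<sigma> 2 t y v) (at x) w)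
      \<le> 9 * pi * norm w * jb v ^ 6 * (\<epsilon> * jb t powr (- 3/2))"
proof -
  let ?H = "\<lambda>k. phi_symbol \<sigma> 2 v k *s osc_hat \<sigma> t k"
  have Gi: "integrable lborel (osc_hat \<sigma> t)" using t by (intro osc_hat_integrable \<sigma>) auto
  have p2: "norm (phi_symbol \<sigma> 2 v k) \<le> 4 * (jb v) ^ 4 / jb k" "norm k * norm (phi_symbol \<sigma> 2 v k) \<le> 4 * (jb v) ^ 4" for k
  proof -
    have "norm (phi_symbol \<sigma> 2 v k) \<le> (2 * (jb v)\<^sup>2 / jb k) ^ 2" by (rule norm_phi_symbol_le[OF \<sigma>])
    also have "\<dots> = 4 * (jb v) ^ 4 / (jb k * jb k)" by (simp add: power_divide power_mult_distrib eval_nat_numeral)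
    finally have le: "norm (phi_symbol \<sigma> 2 v k) \<le> 4 * (jb v) ^ 4 / (jb k * jb k)" .
    also have "\<dots> \<le> 4 * (jb v) ^ 4 / jb k"
      using mult_left_mono[OF jb_ge_1[of k], of "jb k"] by (intro divide_left_mono) (auto simp: less_imp_le)
    finally show "norm (phi_symbol \<sigma> 2 v k) \<le> 4 * (jb v) ^ 4 / jb k" .
    then have "norm k * norm (phi_symbol \<sigma> 2 v k) \<le> jb k * (4 * (jb v) ^ 4 / jb k)"
      using norm_less_jb[of k] by (intro mult_mono) (auto simp: less_imp_le)
    then show "norm k * norm (phi_symbol \<sigma> 2 v k) \<le> 4 * (jb v) ^ 4" by simp
  qed
  have "4 * (jb v) ^ 4 / jb k \<le> 4 * (jb v) ^ 4 / 1" for k :: R3 by (intro divide_left_mono) (auto simp: less_imp_le)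
  then have p2': "norm (phi_symbol \<sigma> 2 v k) \<le> 4 * (jb v) ^ 4" for k using order_trans[OF p2(1)[of k]] by simp
  have Hi: "integrable lborel ?H" by (rule integrable_vscale_bounded[OF Gi _ p2']) measurable
  have kHi: "integrable lborel (\<lambda>k. norm k * norm (?H k))"
  proof -
    have "integrable lborel (\<lambda>k. (of_real (norm k) * phi_symbol \<sigma> 2 v k) *s osc_hat \<sigma> t k)"
      by (rule integrable_vscale_bounded[OF Gi, where B="4 * (jb v) ^ 4"]) (use p2(2) in \<open>auto simp: norm_mult\<close>)
    from integrable_norm[OF this] show ?thesis by (simp add: norm_complex_vscale norm_mult mult_ac)
  qed
  have "((\<lambda>y. Eoscj S0 S \<sigma> 2 t y v) has_derivative (\<lambda>h. LINT k|lborel. (wave x k * (\<i> * of_real (k \<bullet> h))) *s ?H k)) (at x)"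
    using inverse_ft_has_derivative[OF Hi kHi, of x] by (simp add: Eoscj_eq[OF \<sigma> t])
  from frechet_derivative_at[OF this]
  have "frechet_derivative (\<lambda>y. Eoscj S0 S \<sigma> 2 t y v) (at x) w = (LINT k|lborel. (wave x k * (\<i> * of_real (k \<bullet> w))) *s ?H k)"
    by (metis (no_types, lifting))
  then show eq: "frechet_derivative (\<lambda>y. Eoscj S0 S \<sigma> 2 t y v) (at x) w
      = (LINT k|lborel. (wave x k * (\<i> * of_real (k \<bullet> w) * phi_symbol \<sigma> 2 v k)) *s osc_hat \<sigma> t k)"
    by (simp add: mult.assoc)
  have "Linf_multiplier (norm \<i> * (9 * pi * norm w * jb v ^ 6)) (\<lambda>k. \<i> * (of_real (k \<bullet> w) * phi_symbol \<sigma> 2 v k))"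
    by (intro Linf_multiplier_mult Linf_multiplier_const Linf_multiplier_phi_symbol_deriv \<sigma>)
  from Eosc_Linf_multiplier[OF \<sigma> t this, of x]
  show "norm (frechet_derivative (\<lambda>y. Eoscj S0 S \<sigma> 2 t y v) (at x) w) \<le> 9 * pi * norm w * jb v ^ 6 * (\<epsilon> * jb t powr (- 3/2))"
    unfolding eq by (simp add: mult.assoc)
qed

text \<open>\<open>E\<^sup>r\<close> is the difference of \<open>E\<close> and the oscillatory fields, all of which are continuous, so that its
bound almost everywhere holds everywhere. This matters because \<open>Q\<^sup>t\<^sup>r\<close> evaluates it along a curve.\<close>

lemma norm_Er_le:
  assumes t: "t \<in> {0..T}" shows "norm (Er t x) \<le> \<epsilon> * jb t powr (- 3)"
proof -
  have cE: "continuous_on UNIV (E t)" by (rule differentiable_borel_measurable(1)[OF E_differentiable[OF t]])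
  have "continuous_on UNIV (\<lambda>x. cvec (E t x))"
    by (rule continuous_on_compose2[OF linear_continuous_on[OF bounded_linear_cvec, of UNIV] cE]) auto
  then have "continuous_on UNIV (\<lambda>x. cvec (E t x) - (\<Sum>\<sigma>\<in>{1, -1}. Eosc S0 S \<sigma> t x))"
    using Eosc_continuous[OF _ t] by (intro continuous_on_diff continuous_on_sum) auto
  then have c: "continuous_on UNIV (\<lambda>x. cvec (Er t x))" using E_split[OF t] by simp
  have "AE x in lborel. norm (cvec (Er t x)) \<le> \<epsilon> * jb t powr (- 3)" using Er_Linf[OF t] by simp
  from continuous_AE_bound[OF c this] show ?thesis by simp
qed

lemma norm_E_le:
  assumes t: "t \<in> {0..T}" shows "norm (E t x) \<le> 3 * \<epsilon> * jb t powr (- 3/2)"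
proof -
  have "norm (cvec (E t x)) \<le> norm (Eosc S0 S 1 t x) + norm (Eosc S0 S (-1) t x) + norm (cvec (Er t x))"
    unfolding E_split[OF t] by (simp add: norm_triangle_le norm_triangle_ineq)
  also have "\<dots> \<le> \<epsilon> * jb t powr (- 3/2) + \<epsilon> * jb t powr (- 3/2) + \<epsilon> * jb t powr (- 3/2)"
  proof (intro add_mono norm_Eosc_le t)
    have "jb t powr (- 3) \<le> jb t powr (- 3/2)" by (intro powr_mono) auto
    then show "norm (cvec (Er t x)) \<le> \<epsilon> * jb t powr (- 3/2)"
      using norm_Er_le[OF t, of x] eps by (simp add: order_trans[OF _ mult_left_mono])
  qed auto
  finally show ?thesis by simp
qed

lemma
  assumes \<sigma>: "\<sigma> \<in> {1, -1}" and t: "t \<in> {0..T}"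
  shows source_multiplier_eq: "multiplier (\<lambda>k. osc_a \<sigma> k * phi_symbol \<sigma> 1 v k) (\<lambda>y. cvec (grad (S t) y)) x
      = (LINT k|lborel. (wave x k * phi_symbol \<sigma> 1 v k) *s src \<sigma> t k)"
    and norm_source_multiplier_le: "norm (multiplier (\<lambda>k. osc_a \<sigma> k * phi_symbol \<sigma> 1 v k) (\<lambda>y. cvec (grad (S t) y)) x)
      \<le> (jb v)\<^sup>2 * (\<epsilon> * jb t powr (- 3))"
proof -
  let ?c = "1 / (2 * pi) ^ 3"
  have Fe: "(\<lambda>y. cvec (grad (S t) y)) = F t" by (simp add: F_def fun_eq_iff)
  let ?m = "\<lambda>k. osc_a \<sigma> k * phi_symbol \<sigma> 1 v k"
  have m: "multiplier ?m (\<lambda>y. cvec (grad (S t) y)) x = ?c *\<^sub>R (LINT k|lborel. (wave x k * ?m k) *s ft (F t) k)"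
    unfolding Fe
    by (rule multiplier_eq[OF has_fourier_transform_ft[OF F_L1[OF t]]]) measurable
  also have "\<dots> = (LINT k|lborel. ?c *\<^sub>R ((wave x k * ?m k) *s ft (F t) k))"
    by (rule Bochner_Integration.integral_scaleR_right[symmetric])
  also have "\<dots> = (LINT k|lborel. (wave x k * phi_symbol \<sigma> 1 v k) *s src \<sigma> t k)"
    unfolding src_eq[OF t] of_real_vscale[symmetric] vector_smult_assoc
    by (intro Bochner_Integration.integral_cong refl arg_cong2[where f="(*s)"]) (simp add: mult_ac)
  finally show "multiplier ?m (\<lambda>y. cvec (grad (S t) y)) x = (LINT k|lborel. (wave x k * phi_symbol \<sigma> 1 v k) *s src \<sigma> t k)" .
  interpret oscillatory_source \<sigma> "g0 \<sigma>" "src \<sigma>" K by (rule source[OF \<sigma>])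
  have lm: "Linf_multiplier (1 * (jb v)\<^sup>2) ?m"
    by (intro Linf_multiplier_mult Linf_multiplier_osc_a Linf_multiplier_phi_symbol \<sigma>)
  have "integrable lborel (\<lambda>k. phi_symbol \<sigma> 1 v k *s ((2 * pi) ^ 3 *\<^sub>R src \<sigma> t k))"
    by (rule integrable_vscale_bounded[OF _ _ Linf_multiplierD(2)[OF Linf_multiplier_phi_symbol[OF \<sigma>]]])
      (use f_integrable in auto)
  moreover have "phi_symbol \<sigma> 1 v k *s ((2 * pi) ^ 3 *\<^sub>R src \<sigma> t k) = ?m k *s ft (F t) k" for k
    unfolding src_eq[OF t] by (simp add: vec_eq_iff)
  ultimately have mi: "integrable lborel (\<lambda>k. ?m k *s ft (F t) k)" by simp
  have "AE x in lborel. norm (F t x) \<le> \<epsilon> * jb t powr (- 3)" using gradS_Linf[OF t] by (simp add: F_def)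
  from Linf_multiplier_ft_bound[OF lm F_L1[OF t] this mi, of x]
  have "norm (LINT k|lborel. (wave x k * ?m k) *s ft (F t) k) \<le> (2 * pi) ^ 3 * ((jb v)\<^sup>2 * (\<epsilon> * jb t powr (- 3)))" by (simp only: mult_1 mult_ac)
  then have "?c * norm (LINT k|lborel. (wave x k * ?m k) *s ft (F t) k) \<le> ?c * ((2 * pi) ^ 3 * ((jb v)\<^sup>2 * (\<epsilon> * jb t powr (- 3))))"
    by (rule mult_left_mono) simp
  then show "norm (multiplier ?m (\<lambda>y. cvec (grad (S t) y)) x) \<le> (jb v)\<^sup>2 * (\<epsilon> * jb t powr (- 3))"
    unfolding m by simp
qed

text \<open>The middle term is quadratic: one factor \<open>\<epsilon>\<langle>t\<rangle>\<^sup>-\<^sup>3\<^sup>/\<^sup>2\<close> comes from \<open>E\<close>, the other one from \<open>E\<^sup>o\<^sup>s\<^sup>c\<^sub>\<plusminus>\<close>.\<close>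

lemma norm_Qtr_le:
  assumes t: "t \<in> {0..T}" and v: "(jb v)\<^sup>2 \<le> P"
  shows "norm (Qtr S0 S Er E t x v) \<le> (2 * P + 108 * pi * P ^ 3 + 1) * \<epsilon> * jb t powr (- 3)"
proof -
  let ?w = "vhat_deriv v (E t x)"
  have P0: "0 \<le> P" using v zero_le_power2 order_trans by blast
  have v6: "jb v ^ 6 \<le> P ^ 3" using power_mono[OF v, of 3] by (simp flip: power_mult)
  define A where "A \<sigma> = multiplier (\<lambda>k. osc_a \<sigma> k * phi_symbol \<sigma> 1 v k) (\<lambda>y. cvec (grad (S t) y)) x" for \<sigma>
  define D where "D \<sigma> = frechet_derivative (\<lambda>y. Eoscj S0 S \<sigma> 2 t y v) (at x) ?w" for \<sigma>
  let ?e = "\<epsilon> * jb t powr (- 3)"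
  have e0: "0 \<le> ?e" using eps by simp
  have A: "norm (A \<sigma>) \<le> P * ?e" if "\<sigma> \<in> {1, -1}" for \<sigma>
    unfolding A_def by (rule order_trans[OF norm_source_multiplier_le[OF that t] mult_right_mono[OF v e0]])
  have D: "norm (D \<sigma>) \<le> 54 * pi * P ^ 3 * ?e" if "\<sigma> \<in> {1, -1}" for \<sigma>
  proof -
    let ?r = "jb t powr (- 3/2)"
    have w: "norm ?w \<le> 6 * (\<epsilon> * ?r)" using norm_vhat_deriv_le[of v "E t x"] norm_E_le[OF t, of x] by simp
    have "norm (D \<sigma>) \<le> 9 * pi * norm ?w * jb v ^ 6 * (\<epsilon> * ?r)"
      unfolding D_def by (rule norm_Eoscj_2_derivative_le[OF that t])
    also have "\<dots> \<le> 9 * pi * (6 * (\<epsilon> * ?r)) * P ^ 3 * (\<epsilon> * ?r)"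
      using w v6 eps P0 by (intro mult_mono) (auto simp: less_imp_le)
    also have "\<dots> = 54 * pi * P ^ 3 * (\<epsilon> * (\<epsilon> * (?r * ?r)))" by (simp add: mult_ac)
    also have "?r * ?r = jb t powr (- 3)" by (simp flip: powr_add)
    also have "\<epsilon> * (\<epsilon> * jb t powr (- 3)) \<le> 1 * ?e" using eps by (intro mult_right_mono) auto
    finally show ?thesis using P0 by (simp add: mult_left_mono)
  qed
  have "Qtr S0 S Er E t x v = - (A 1 + A (-1)) + (D 1 + D (-1)) + cvec (Er t x)"
    unfolding Qtr_def frechet_derivative_vhat A_def D_def by simp
  also have "norm \<dots> \<le> norm (A 1) + norm (A (-1)) + (norm (D 1) + norm (D (-1))) + norm (cvec (Er t x))"
  proof -
    have "norm (- (A 1 + A (-1))) \<le> norm (A 1) + norm (A (-1))"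
      unfolding norm_minus_cancel by (rule norm_triangle_ineq)
    then show ?thesis by (intro norm_triangle_le add_mono order_refl norm_triangle_ineq)
  qed
  also have "\<dots> \<le> P * ?e + P * ?e + (54 * pi * P ^ 3 * ?e + 54 * pi * P ^ 3 * ?e) + ?e"
    using norm_Er_le[OF t, of x] by (intro add_mono A D) auto
  also have "\<dots> = (2 * P + 108 * pi * P ^ 3 + 1) * \<epsilon> * jb t powr (- 3)" by (simp add: algebra_simps)
  finally show ?thesis .
qed

end

section \<open>The decomposition along characteristics\<close>

locale bootstrap_characteristic = bootstrap_field +
  fixes X V :: "real \<Rightarrow> real \<Rightarrow> R3 \<Rightarrow> R3 \<Rightarrow> R3" and t :: real and x v :: R3
  assumes chars: "characteristics T E X V" and t: "t \<in> {0..T}"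
begin

abbreviation "Xt \<tau> \<equiv> X \<tau> t x v"
abbreviation "Vt \<tau> \<equiv> V \<tau> t x v"

lemma
  shows X_final: "Xt t = x" and V_final: "Vt t = v"
    and X_deriv: "\<tau> \<in> {0..t} \<Longrightarrow> (Xt has_vector_derivative vhat (Vt \<tau>)) (at \<tau> within {0..t})"
    and V_deriv: "\<tau> \<in> {0..t} \<Longrightarrow> (Vt has_vector_derivative E \<tau> (Xt \<tau>)) (at \<tau> within {0..t})"
  using chars t unfolding characteristics_def by auto

definition force :: "real \<Rightarrow> R3" where
  "force \<tau> = indicator {0..t} \<tau> *\<^sub>R E \<tau> (Xt \<tau>)"

lemma force_eq: "\<tau> \<in> {0..t} \<Longrightarrow> force \<tau> = E \<tau> (Xt \<tau>)"
  by (simp add: force_def)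

lemma force_measurable [measurable]: "force \<in> borel_measurable borel"
  unfolding force_def[abs_def] using t V_deriv by (intro derivative_measurable) auto

lemma norm_force_le: "\<tau> \<in> {0..t} \<Longrightarrow> norm (force \<tau>) \<le> 3 * \<epsilon> * jb \<tau> powr (- 3/2)"
  using norm_E_le[of \<tau> "Xt \<tau>"] t by (simp add: force_eq)

lemma norm_force_le_3: "\<tau> \<in> {0..t} \<Longrightarrow> norm (force \<tau>) \<le> 3"
proof -
  assume \<tau>: "\<tau> \<in> {0..t}"
  have "jb \<tau> powr (- 3/2) \<le> jb \<tau> powr 0" by (intro powr_mono) auto
  then have "3 * \<epsilon> * jb \<tau> powr (- 3/2) \<le> 3 * 1 * 1" using eps by (intro mult_mono) auto
  then show ?thesis using norm_force_le[OF \<tau>] by simp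
qed

lemma
  assumes s: "s \<in> {0..t}"
  shows force_integrable: "set_integrable lborel {s..t} force"
    and velocity_difference: "(LINT \<tau>:{s..t}|lborel. force \<tau>) = v - Vt s"
proof -
  show i: "set_integrable lborel {s..t} force"
    by (rule set_integrable_bounded[OF force_measurable norm_force_le_3]) (use s in auto)
  have "(Vt has_vector_derivative force \<tau>) (at \<tau> within {s..t})" if "\<tau> \<in> {s..t}" for \<tau>
    using V_deriv[of \<tau>] that s by (auto simp: force_eq intro: has_vector_derivative_within_subset)
  from FTC_Lebesgue[OF _ this i] show "(LINT \<tau>:{s..t}|lborel. force \<tau>) = v - Vt s"
    using s by (simp add: V_final)
qed

text \<open>The force is at most \<open>3 \<epsilon>\<langle>\<tau>\<rangle>\<^sup>-\<^sup>3\<^sup>/\<^sup>2\<close> and the integral of \<open>\<langle>\<tau>\<rangle>\<^sup>-\<^sup>3\<^sup>/\<^sup>2\<close> at most 4.\<close>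

lemma norm_velocity_le:
  assumes s: "s \<in> {0..t}" shows "norm (Vt s) \<le> norm v + 12"
proof -
  note J = integral_jb_powr_minus_3_2[of s t]
  have "norm (LINT \<tau>:{s..t}|lborel. force \<tau>) \<le> (LINT \<tau>:{s..t}|lborel. 3 * \<epsilon> * jb \<tau> powr (- 3/2))"
    unfolding set_lebesgue_integral_def
  proof (rule norm_integral_le_AE)
    show "integrable lborel (\<lambda>\<tau>. indicator {s..t} \<tau> *\<^sub>R (3 * \<epsilon> * jb \<tau> powr (- 3/2)))"
      using J(1) s by (simp add: set_integrable_def mult.left_commute)
    show "AE \<tau> in lborel. norm (indicator {s..t} \<tau> *\<^sub>R force \<tau>) \<le> indicator {s..t} \<tau> *\<^sub>R (3 * \<epsilon> * jb \<tau> powr (- 3/2))"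
      using norm_force_le s by (intro AE_I2) (simp add: indicator_def)
  qed
  also have "\<dots> = 3 * \<epsilon> * (LINT \<tau>:{s..t}|lborel. jb \<tau> powr (- 3/2))" by (rule set_integral_mult_right)
  also have "\<dots> \<le> 3 * \<epsilon> * 4" using J s eps by (intro mult_left_mono) auto
  also have "\<dots> \<le> 12" using eps by simp
  finally have "norm (v - Vt s) \<le> 12" unfolding velocity_difference[OF s] by simp
  then show ?thesis using norm_triangle_ineq2[of "Vt s" v] by (simp add: norm_minus_commute)
qed

lemma jb_velocity_le:
  assumes "s \<in> {0..t}" "norm v \<le> R" shows "(jb (Vt s))\<^sup>2 \<le> 1 + (R + 12)\<^sup>2"
  unfolding jb_sq using power_mono[of "norm (Vt s)" "R + 12" 2] norm_velocity_le[OF assms(1)] assms(2) by simp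

text \<open>The rate of change of \<open>E\<^sup>o\<^sup>s\<^sup>c\<^sup>,\<^sup>1\<^sub>\<plusminus>\<close> along the characteristic, in the integrated sense of the next lemma.\<close>

definition osc_rate :: "real \<Rightarrow> real \<Rightarrow> C3" where
  "osc_rate \<sigma> \<tau> = Eosc S0 S \<sigma> \<tau> (Xt \<tau>)
     - frechet_derivative (\<lambda>y. Eoscj S0 S \<sigma> 2 \<tau> y (Vt \<tau>)) (at (Xt \<tau>)) (vhat_deriv (Vt \<tau>) (E \<tau> (Xt \<tau>)))
     + multiplier (\<lambda>k. osc_a \<sigma> k * phi_symbol \<sigma> 1 (Vt \<tau>) k) (\<lambda>y. cvec (grad (S \<tau>) y)) (Xt \<tau>)"

lemma
  assumes \<sigma>: "\<sigma> \<in> {1, -1}" and s: "s \<in> {0..t}"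
  shows osc_rate_integrable: "set_integrable lborel {s..t} (osc_rate \<sigma>)"
    and osc_rate_integral: "(LINT \<tau>:{s..t}|lborel. osc_rate \<sigma> \<tau>)
      = Eoscj S0 S \<sigma> 1 t (Xt t) (Vt t) - Eoscj S0 S \<sigma> 1 s (Xt s) (Vt s)"
proof -
  interpret oscillatory_source \<sigma> "g0 \<sigma>" "src \<sigma>" K by (rule source[OF \<sigma>])
  \<comment> \<open>Outside the time interval the trajectory is arbitrary; clamping the time makes it continuous,
    hence measurable, on the whole line.\<close>
  let ?X = "\<lambda>\<tau>. Xt (max 0 (min t \<tau>))" and ?V = "\<lambda>\<tau>. Vt (max 0 (min t \<tau>))"
  have eq: "?X \<tau> = Xt \<tau>" "?V \<tau> = Vt \<tau>" "force \<tau> = E \<tau> (Xt \<tau>)" if "\<tau> \<in> {s..t}" for \<tau>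
    using that s by (auto simp: min_def max_def force_eq)
  have sT: "\<tau> \<in> {0..T}" if "\<tau> \<in> {s..t}" for \<tau> using that s t by auto
  have sub: "\<tau> \<in> {0..t}" if "\<tau> \<in> {s..t}" for \<tau> using that s by auto
  have "continuous_on {0..t} Xt" "continuous_on {0..t} Vt"
    unfolding continuous_on_eq_continuous_within
    using has_vector_derivative_continuous[OF X_deriv] has_vector_derivative_continuous[OF V_deriv] by blast+
  then have m: "?X \<in> borel_measurable borel" "?V \<in> borel_measurable borel"
    using t by (auto intro!: borel_measurable_continuous_onI continuous_clamp)
  have X': "(?X has_vector_derivative vhat (?V \<tau>)) (at \<tau> within {s..t})" if \<tau>: "\<tau> \<in> {s..t}" for \<tau>
    unfolding eq(2)[OF \<tau>]
    by (rule has_vector_derivative_transform[OF \<tau> _ has_vector_derivative_within_subset[OF X_deriv]])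
      (use eq(1) sub[OF \<tau>] s in auto)
  have V': "(?V has_vector_derivative force \<tau>) (at \<tau> within {s..t})" if \<tau>: "\<tau> \<in> {s..t}" for \<tau>
    unfolding eq(3)[OF \<tau>]
    by (rule has_vector_derivative_transform[OF \<tau> _ has_vector_derivative_within_subset[OF V_deriv]])
      (use eq(2) sub[OF \<tau>] s in auto)
  have R: "(jb (?V \<tau>))\<^sup>2 \<le> 1 + (norm v + 12)\<^sup>2" if \<tau>: "\<tau> \<in> {s..t}" for \<tau>
    unfolding eq(2)[OF \<tau>] by (rule jb_velocity_le[OF sub[OF \<tau>] order_refl])
  have st: "0 \<le> s" "s \<le> t" using s by auto
  note id = characteristic_identity[OF st m force_measurable X' V' norm_force_le_3[OF sub] R]
  let ?I = "\<lambda>\<tau>. (LINT k|lborel. wave (?X \<tau>) k *s osc_hat \<sigma> \<tau> k)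
      - (LINT k|lborel. (wave (?X \<tau>) k * (\<i> * of_real (k \<bullet> vhat_deriv (?V \<tau>) (force \<tau>)) * phi_symbol \<sigma> 2 (?V \<tau>) k)) *s osc_hat \<sigma> \<tau> k)
      + (LINT k|lborel. (wave (?X \<tau>) k * phi_symbol \<sigma> 1 (?V \<tau>) k) *s src \<sigma> \<tau> k)"
  have rate: "?I \<tau> = osc_rate \<sigma> \<tau>" if \<tau>: "\<tau> \<in> {s..t}" for \<tau>
    unfolding osc_rate_def eq[OF \<tau>] Eosc_eq[OF \<sigma> sT[OF \<tau>]] Eoscj_2_derivative[OF \<sigma> sT[OF \<tau>]]
      source_multiplier_eq[OF \<sigma> sT[OF \<tau>]] ..
  have "set_integrable lborel {s..t} ?I" by (rule id(1))
  then show "set_integrable lborel {s..t} (osc_rate \<sigma>)"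
    by (subst (asm) set_integrable_cong[OF refl refl rate]) auto
  have "(LINT \<tau>:{s..t}|lborel. osc_rate \<sigma> \<tau>) = (LINT \<tau>:{s..t}|lborel. ?I \<tau>)"
    by (rule set_lebesgue_integral_cong) (use rate in auto)
  also have "\<dots> = (LINT k|lborel. (wave (?X t) k * phi_symbol \<sigma> 1 (?V t) k) *s osc_hat \<sigma> t k)
      - (LINT k|lborel. (wave (?X s) k * phi_symbol \<sigma> 1 (?V s) k) *s osc_hat \<sigma> s k)"
    by (rule id(2)[symmetric])
  also have "\<dots> = Eoscj S0 S \<sigma> 1 t (Xt t) (Vt t) - Eoscj S0 S \<sigma> 1 s (Xt s) (Vt s)"
    using eq[of t] eq[of s] st sT[of t] sT[of s] by (simp add: Eoscj_eq[OF \<sigma>])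
  finally show "(LINT \<tau>:{s..t}|lborel. osc_rate \<sigma> \<tau>)
      = Eoscj S0 S \<sigma> 1 t (Xt t) (Vt t) - Eoscj S0 S \<sigma> 1 s (Xt s) (Vt s)" .
qed

lemma Qtr_eq:
  assumes "\<tau> \<in> {0..t}"
  shows "Qtr S0 S Er E \<tau> (Xt \<tau>) (Vt \<tau>) = cvec (force \<tau>) - (osc_rate 1 \<tau> + osc_rate (-1) \<tau>)"
proof -
  have "\<tau> \<in> {0..T}" using assms t by auto
  from E_split[OF this, of "Xt \<tau>"]
  show ?thesis unfolding Qtr_def frechet_derivative_vhat osc_rate_def force_eq[OF assms] by simp
qed

text \<open>Integrate \<open>Qtr_eq\<close> from \<open>s\<close> to \<open>t\<close>: the force gives \<open>v - V\<^sub>s\<^sub>,\<^sub>t\<close>, and the rates give the difference of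
\<open>V\<^sup>o\<^sup>s\<^sup>c\<close> at the two times.\<close>

lemma velocity_decomposition:
  assumes s: "s \<in> {0..t}"
  shows "cvec (Vt s) = cvec v - Vosc S0 S X V t t x v + Vosc S0 S X V s t x v + Vtr S0 S Er E X V s t x v"
proof -
  have \<sigma>: "(1::real) \<in> {1, -1}" "(-1::real) \<in> {1, -1}" by auto
  have ic: "set_integrable lborel {s..t} (\<lambda>\<tau>. cvec (force \<tau>))"
    using integrable_bounded_linear[OF bounded_linear_cvec force_integrable[OF s, unfolded set_integrable_def]]
    by (simp add: set_integrable_def linear_cmul[OF bounded_linear.linear[OF bounded_linear_cvec]])
  have Ic: "(LINT \<tau>:{s..t}|lborel. cvec (force \<tau>)) = cvec (v - Vt s)"
    using integral_bounded_linear[OF bounded_linear_cvec force_integrable[OF s, unfolded set_integrable_def]]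
    unfolding velocity_difference[OF s, symmetric]
    by (simp add: set_lebesgue_integral_def linear_cmul[OF bounded_linear.linear[OF bounded_linear_cvec]])
  note i1 = osc_rate_integrable[OF \<sigma>(1) s] and i2 = osc_rate_integrable[OF \<sigma>(2) s]
  have "(LINT \<tau>:{s..t}|lborel. Qtr S0 S Er E \<tau> (Xt \<tau>) (Vt \<tau>))
      = (LINT \<tau>:{s..t}|lborel. cvec (force \<tau>) - (osc_rate 1 \<tau> + osc_rate (-1) \<tau>))"
    by (rule set_lebesgue_integral_cong) (use Qtr_eq s in auto)
  also have "\<dots> = (LINT \<tau>:{s..t}|lborel. cvec (force \<tau>)) - ((LINT \<tau>:{s..t}|lborel. osc_rate 1 \<tau>) + (LINT \<tau>:{s..t}|lborel. osc_rate (-1) \<tau>))"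
    using ic i1 i2 by (simp add: set_integral_diff set_integral_add)
  also have "\<dots> = cvec v - cvec (Vt s) - (Vosc S0 S X V t t x v - Vosc S0 S X V s t x v)"
    unfolding Ic osc_rate_integral[OF \<sigma>(1) s] osc_rate_integral[OF \<sigma>(2) s] Vosc_def
    by (simp add: linear_diff[OF bounded_linear.linear[OF bounded_linear_cvec]])
  finally show ?thesis unfolding Vtr_def by simp
qed

lemma norm_Vosc_le:
  assumes s: "s \<in> {0..t}" and R: "norm v \<le> R"
  shows "norm (Vosc S0 S X V s t x v) \<le> 2 * (1 + (R + 12)\<^sup>2) * \<epsilon> * jb s powr (- 3/2)"
proof -
  have sT: "s \<in> {0..T}" using s t by auto
  have "norm (Eoscj S0 S \<sigma> 1 s (Xt s) (Vt s)) \<le> (1 + (R + 12)\<^sup>2) * (\<epsilon> * jb s powr (- 3/2))" if "\<sigma> \<in> {1, -1}" for \<sigma>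
    by (rule order_trans[OF norm_Eoscj_1_le[OF that sT] mult_right_mono[OF jb_velocity_le[OF s R]]]) (use eps in simp)
  from this[of 1] this[of "-1"]
  have "norm (Eoscj S0 S 1 1 s (Xt s) (Vt s) + Eoscj S0 S (-1) 1 s (Xt s) (Vt s))
     \<le> (1 + (R + 12)\<^sup>2) * (\<epsilon> * jb s powr (- 3/2)) + (1 + (R + 12)\<^sup>2) * (\<epsilon> * jb s powr (- 3/2))"
    by (intro norm_triangle_le add_mono) auto
  then show ?thesis by (simp add: Vosc_def algebra_simps)
qed

lemma norm_Vtr_le:
  assumes s: "s \<in> {0..t}" and R: "norm v \<le> R"
  defines "P \<equiv> 1 + (R + 12)\<^sup>2"
  shows "norm (Vtr S0 S Er E X V s t x v) \<le> (2 * P + 108 * pi * P ^ 3 + 1) * \<epsilon> * jb s powr (- 2)"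
proof -
  let ?C = "(2 * P + 108 * pi * P ^ 3 + 1) * \<epsilon>"
  note J = integral_jb_powr_minus_3[of s t]
  have "0 \<le> P" by (simp add: P_def)
  then have C: "0 \<le> ?C" using eps by simp
  have "norm (LINT \<tau>:{s..t}|lborel. Qtr S0 S Er E \<tau> (Xt \<tau>) (Vt \<tau>)) \<le> (LINT \<tau>:{s..t}|lborel. ?C * jb \<tau> powr (- 3))"
    unfolding set_lebesgue_integral_def
  proof (rule norm_integral_le_AE)
    show "integrable lborel (\<lambda>\<tau>. indicator {s..t} \<tau> *\<^sub>R (?C * jb \<tau> powr (- 3)))"
      using integrable_mult_right[OF J(1)[unfolded set_integrable_def], of ?C] s by (simp add: mult.left_commute)
    have "norm (Qtr S0 S Er E \<tau> (Xt \<tau>) (Vt \<tau>)) \<le> ?C * jb \<tau> powr (- 3)" if "\<tau> \<in> {s..t}" for \<tau>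
      using that s t R unfolding P_def by (intro norm_Qtr_le jb_velocity_le) auto
    then show "AE \<tau> in lborel. norm (indicator {s..t} \<tau> *\<^sub>R Qtr S0 S Er E \<tau> (Xt \<tau>) (Vt \<tau>)) \<le> indicator {s..t} \<tau> *\<^sub>R (?C * jb \<tau> powr (- 3))"
      by (intro AE_I2) (simp add: indicator_def)
  qed
  also have "\<dots> = ?C * (LINT \<tau>:{s..t}|lborel. jb \<tau> powr (- 3))" by (rule set_integral_mult_right)
  also have "\<dots> \<le> ?C * jb s powr (- 2)" using J(2) s C by (intro mult_left_mono) auto
  finally show ?thesis by (simp add: Vtr_def)
qed

end

theorem proposition3p3:
  fixes \<alpha>0 :: nat
  assumes "8 \<le> \<alpha>0"
  shows "\<exists>\<epsilon>0>0. \<forall>R. \<exists>C. \<forall>\<epsilon> T f0 \<phi>0 \<phi>1 f \<phi> E S0 S Er X V.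
     0 < \<epsilon> \<and> \<epsilon> \<le> \<epsilon>0 \<and> 0 < T \<and>
     compactly_supported_in_v f0 \<and> VKG_solution T f0 \<phi>0 \<phi>1 f \<phi> E \<and>
     bootstrap T \<alpha>0 \<epsilon> S0 S Er E \<and> characteristics T E X V \<longrightarrow>
     (\<forall>s t x v. 0 \<le> s \<and> s \<le> t \<and> t \<le> T \<longrightarrow>
        cvec (V s t x v)
          = cvec v - Vosc S0 S X V t t x v + Vosc S0 S X V s t x v + Vtr S0 S Er E X V s t x v \<and>
        (norm v \<le> R \<longrightarrow>
           norm (Vosc S0 S X V s t x v) \<le> C * \<epsilon> * jb s powr (- 3/2) \<and>
           norm (Vtr S0 S Er E X V s t x v) \<le> C * \<epsilon> * jb s powr (- 2) \<and>
           norm (cvec (V s t x v) - cvec v + Vosc S0 S X V t t x v)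
             \<le> C * \<epsilon> * jb s powr (- 3/2)))"
proof (rule exI[of _ "1::real"], intro conjI allI)
  fix R :: real
  define P where "P = 1 + (R + 12)\<^sup>2"
  define C1 C2 where "C1 = 2 * P" and "C2 = 2 * P + 108 * pi * P ^ 3 + 1"
  have P: "0 \<le> P" by (simp add: P_def)
  have C: "0 \<le> C1" "0 \<le> C2" using P by (auto simp: C1_def C2_def)
  show "\<exists>C. \<forall>\<epsilon> T f0 \<phi>0 \<phi>1 f \<phi> E S0 S Er X V.
     0 < \<epsilon> \<and> \<epsilon> \<le> 1 \<and> 0 < T \<and>
     compactly_supported_in_v f0 \<and> VKG_solution T f0 \<phi>0 \<phi>1 f \<phi> E \<and>
     bootstrap T \<alpha>0 \<epsilon> S0 S Er E \<and> characteristics T E X V \<longrightarrow>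
     (\<forall>s t x v. 0 \<le> s \<and> s \<le> t \<and> t \<le> T \<longrightarrow>
        cvec (V s t x v)
          = cvec v - Vosc S0 S X V t t x v + Vosc S0 S X V s t x v + Vtr S0 S Er E X V s t x v \<and>
        (norm v \<le> R \<longrightarrow>
           norm (Vosc S0 S X V s t x v) \<le> C * \<epsilon> * jb s powr (- 3/2) \<and>
           norm (Vtr S0 S Er E X V s t x v) \<le> C * \<epsilon> * jb s powr (- 2) \<and>
           norm (cvec (V s t x v) - cvec v + Vosc S0 S X V t t x v)
             \<le> C * \<epsilon> * jb s powr (- 3/2)))"
  proof (rule exI[of _ "C1 + C2"], intro allI impI, elim conjE)
    fix \<epsilon> T :: real and f0 \<phi>0 \<phi>1 f \<phi> and E :: "real \<Rightarrow> R3 \<Rightarrow> R3" and S0 S Er X V and s t :: real and x v :: R3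
    assume eps: "0 < \<epsilon>" "\<epsilon> \<le> 1" and sol: "VKG_solution T f0 \<phi>0 \<phi>1 f \<phi> E"
      and boot: "bootstrap T \<alpha>0 \<epsilon> S0 S Er E" and chars: "characteristics T E X V"
      and st: "0 \<le> s" "s \<le> t" "t \<le> T"
    interpret bootstrap_characteristic T \<alpha>0 \<epsilon> S0 S Er E X V t x v
    proof
      fix \<tau> y assume \<tau>: "\<tau> \<in> {0..T}"
      have E: "E \<tau> = (\<lambda>x. - grad (\<phi> \<tau>) x)" and d: "grad (\<phi> \<tau>) differentiable (at y)"
        using sol \<tau> unfolding VKG_solution_def by auto
      show "E \<tau> differentiable (at y)" unfolding E using d by (rule differentiable_minus)
    qed (use assms eps boot chars st in auto)
    have s: "s \<in> {0..t}" using st by auto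
    have dec: "cvec (V s t x v) = cvec v - Vosc S0 S X V t t x v + Vosc S0 S X V s t x v + Vtr S0 S Er E X V s t x v"
      by (rule velocity_decomposition[OF s])
    have mono: "c * \<epsilon> * p \<le> c' * \<epsilon> * p" if "c \<le> c'" "0 \<le> p" for c c' p :: real
      using that eps by (intro mult_right_mono) auto
    have bounds: "norm (Vosc S0 S X V s t x v) \<le> (C1 + C2) * \<epsilon> * jb s powr (- 3/2) \<and>
         norm (Vtr S0 S Er E X V s t x v) \<le> (C1 + C2) * \<epsilon> * jb s powr (- 2) \<and>
         norm (cvec (V s t x v) - cvec v + Vosc S0 S X V t t x v) \<le> (C1 + C2) * \<epsilon> * jb s powr (- 3/2)"
      if R: "norm v \<le> R"
    proof -
      have 1: "norm (Vosc S0 S X V s t x v) \<le> C1 * \<epsilon> * jb s powr (- 3/2)"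
        using norm_Vosc_le[OF s R] by (simp add: C1_def P_def)
      have 2: "norm (Vtr S0 S Er E X V s t x v) \<le> C2 * \<epsilon> * jb s powr (- 2)"
        using norm_Vtr_le[OF s R] by (simp add: C2_def P_def)
      have "jb s powr (- 2) \<le> jb s powr (- 3/2)" by (intro powr_mono) auto
      then have 3: "C2 * \<epsilon> * jb s powr (- 2) \<le> C2 * \<epsilon> * jb s powr (- 3/2)"
        using C eps by (intro mult_left_mono) auto
      have "cvec (V s t x v) - cvec v + Vosc S0 S X V t t x v = Vosc S0 S X V s t x v + Vtr S0 S Er E X V s t x v"
        unfolding dec by simp
      then have "norm (cvec (V s t x v) - cvec v + Vosc S0 S X V t t x v)
          \<le> C1 * \<epsilon> * jb s powr (- 3/2) + C2 * \<epsilon> * jb s powr (- 3/2)"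
        using norm_triangle_le[OF add_mono[OF 1 order_trans[OF 2 3]]] by simp
      then show ?thesis
        using order_trans[OF 1 mono[of C1 "C1 + C2"]] order_trans[OF 2 mono[of C2 "C1 + C2"]] C
        by (simp add: distrib_right)
    qed
    show "cvec (V s t x v) = cvec v - Vosc S0 S X V t t x v + Vosc S0 S X V s t x v + Vtr S0 S Er E X V s t x v \<and>
        (norm v \<le> R \<longrightarrow>
           norm (Vosc S0 S X V s t x v) \<le> (C1 + C2) * \<epsilon> * jb s powr (- 3/2) \<and>
           norm (Vtr S0 S Er E X V s t x v) \<le> (C1 + C2) * \<epsilon> * jb s powr (- 2) \<and>
           norm (cvec (V s t x v) - cvec v + Vosc S0 S X V t t x v) \<le> (C1 + C2) * \<epsilon> * jb s powr (- 3/2))"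
      using dec bounds by blast
  qed
qed simp

end
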